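(* Let $k\ge 2$ and $p_1,\ldots,p_k\ge 1$ be integers, and let $H=\Theta(p_1,\ldots,p_k)$ be a generalized theta graph. \begin{enumerate} \item If $H$ contains at most one triangle, then there exists a constant $\alpha>0$ (depending only on $H$) such that $\mathrm{ex}(n,K_3,H)=O(n^{2-\alpha})$. \item If $H$ contains at least two triangles and does not contain $\Theta(1,2,2,3)$ as a subgraph, then $n^{2-o(1)}\le \mathrm{ex}(n,K_3,H)=o(n^2)$. \item Otherwise (i.e. if $H$ contains $\Theta(1,2,2,3)$ as a subgraph), $\mathrm{ex}(n,K_3,H)=\Theta(n^2)$. \end{enumerate}
   Context: All graphs are finite and simple. For graphs $T$ and $F$, the generalized Turán number $\mathrm{ex}(n,T,F)$ is the maximum possible number of copies of $T$ in an $n$-vertex graph containing no copy of $F$ as a subgraph. For integers $k\ge 2$ and $p_1,\ldots,p_k\ge1$, the generalized theta graph $\Theta(p_1,\ldots,p_k)$ is the (simple) graph consisting of a pair of end vertices joined by $k$ internally vertex-disjoint paths of lengths $p_1,\ldots,p_k$ respectively (so at most one $p_i$ equals $1$). $K_3$ denotes the triangle. Asymptotic notation is as $n\to\infty$ with $H$ fixed. *)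

theory Defs
  imports Complex_Main "HOL-Library.Landau_Symbols"
begin

type_synonym 'a graph = "'a set \<times> 'a set set"

abbreviation verts :: "'a graph \<Rightarrow> 'a set" where
  "verts G \<equiv> fst G"

abbreviation edges :: "'a graph \<Rightarrow> 'a set set" where
  "edges G \<equiv> snd G"

definition simple_graph :: "'a graph \<Rightarrow> bool" where
  "simple_graph G \<longleftrightarrow> finite (verts G) \<and> (\<forall>e\<in>edges G. e \<subseteq> verts G \<and> card e = 2)"

definition subgraph :: "'a graph \<Rightarrow> 'a graph \<Rightarrow> bool" where
  "subgraph S G \<longleftrightarrow> simple_graph S \<and> verts S \<subseteq> verts G \<and> edges S \<subseteq> edges G"

definition isomorphic :: "'a graph \<Rightarrow> 'b graph \<Rightarrow> bool" where
  "isomorphic G H \<longleftrightarrow>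
     (\<exists>f. bij_betw f (verts G) (verts H) \<and> edges H = (\<lambda>e. f ` e) ` edges G)"

text \<open>Copies are unlabelled and not necessarily induced.\<close>

definition copies :: "'a graph \<Rightarrow> 'b graph \<Rightarrow> 'b graph set" where
  "copies T G = {S. subgraph S G \<and> isomorphic S T}"

definition contains :: "'b graph \<Rightarrow> 'a graph \<Rightarrow> bool" where
  "contains G F \<longleftrightarrow> copies F G \<noteq> {}"

text \<open>The generalized Turan number ex(n,T,F).  Every finite graph is isomorphic to one whose
  vertices are natural numbers, so the host graphs are taken over \<^typ>\<open>nat\<close>.  The set under
  \<^const>\<open>Max\<close> is always finite, and it is nonempty as soon as \<open>F\<close> has an edge
  (lemmas \<open>finite_copy_counts\<close> and \<open>copy_counts_nonempty\<close>).\<close>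

definition copy_counts :: "nat \<Rightarrow> 'a graph \<Rightarrow> 'b graph \<Rightarrow> nat set" where
  "copy_counts n T F =
     {card (copies T G) | G :: nat graph.
        simple_graph G \<and> card (verts G) = n \<and> \<not> contains G F}"

definition gen_turan :: "nat \<Rightarrow> 'a graph \<Rightarrow> 'b graph \<Rightarrow> nat" where
  "gen_turan n T F = Max (copy_counts n T F)"

definition complete_graph :: "nat \<Rightarrow> nat graph" where
  "complete_graph n = ({..<n}, {e. e \<subseteq> {..<n} \<and> card e = 2})"

text \<open>The paths of \<open>theta_graph ps\<close> are indexed from 0, and \<open>theta_vertex ps i j\<close> is the vertex at
  distance \<open>j\<close> from the first end vertex along the \<open>i\<close>-th path.  Two paths of length 1 would yield
  the same edge, hence the condition on 1 in \<open>theta_lengths\<close>.\<close>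

datatype tvertex = End1 | End2 | Inner nat nat

definition theta_vertex :: "nat list \<Rightarrow> nat \<Rightarrow> nat \<Rightarrow> tvertex" where
  "theta_vertex ps i j = (if j = 0 then End1 else if j = ps ! i then End2 else Inner i j)"

definition theta_graph :: "nat list \<Rightarrow> tvertex graph" where
  "theta_graph ps =
     ({theta_vertex ps i j | i j. i < length ps \<and> j \<le> ps ! i},
      {{theta_vertex ps i j, theta_vertex ps i (Suc j)} | i j. i < length ps \<and> j < ps ! i})"

definition theta_lengths :: "nat list \<Rightarrow> bool" where
  "theta_lengths ps \<longleftrightarrow> length ps \<ge> 2 \<and> (\<forall>p\<in>set ps. p \<ge> 1) \<and> count_list ps 1 \<le> 1"

lemma finite_copy_counts: "finite (copy_counts n T F)"
proof (rule finite_subset)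
  show "copy_counts n T F \<subseteq> {..2 ^ n * 2 ^ (2 ^ n)}"
  proof
    fix c assume "c \<in> copy_counts n T F"
    then obtain G :: "nat graph" where G: "simple_graph G" "card (verts G) = n"
      and c: "c = card (copies T G)"
      by (auto simp: copy_counts_def)
    have fin: "finite (verts G)" using G by (simp add: simple_graph_def)
    have "copies T G \<subseteq> Pow (verts G) \<times> Pow (Pow (verts G))"
    proof
      fix S assume "S \<in> copies T G"
      then have "verts S \<subseteq> verts G" "edges S \<subseteq> edges G"
        by (auto simp: copies_def subgraph_def)
      moreover have "edges G \<subseteq> Pow (verts G)"
        using G(1) by (auto simp: simple_graph_def)
      ultimately show "S \<in> Pow (verts G) \<times> Pow (Pow (verts G))"
        by (cases S) auto
    qed
    then have "card (copies T G) \<le> card (Pow (verts G) \<times> Pow (Pow (verts G)))"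
      using fin by (intro card_mono) auto
    also have "\<dots> = 2 ^ n * 2 ^ (2 ^ n)"
      using fin G(2) by (simp add: card_cartesian_product card_Pow)
    finally show "c \<in> {..2 ^ n * 2 ^ (2 ^ n)}" using c by simp
  qed
qed simp

lemma copy_counts_nonempty:
  assumes "edges F \<noteq> {}"
  shows "copy_counts n T F \<noteq> {}"
proof -
  let ?G = "({..<n}, {}) :: nat graph"
  have "\<not> contains ?G F"
    using assms by (auto simp: contains_def copies_def subgraph_def isomorphic_def)
  moreover have "simple_graph ?G" "card (verts ?G) = n"
    by (auto simp: simple_graph_def)
  ultimately show ?thesis unfolding copy_counts_def by blast
qed

lemma theta_graph_edges_nonempty:
  assumes "theta_lengths ps"
  shows "edges (theta_graph ps) \<noteq> {}"
proof -
  have len: "0 < length ps" using assms by (auto simp: theta_lengths_def)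
  then have "1 \<le> ps ! 0"
    using assms nth_mem[OF len] unfolding theta_lengths_def by blast
  then have "0 < ps ! 0" by simp
  with len have "{theta_vertex ps 0 0, theta_vertex ps 0 (Suc 0)} \<in> edges (theta_graph ps)"
    unfolding theta_graph_def snd_conv by blast
  then show ?thesis by blast
qed

lemma simple_graph_theta_graph: "simple_graph (theta_graph ps)"
proof -
  have "verts (theta_graph ps) = (\<Union>i<length ps. theta_vertex ps i ` {..ps ! i})"
    by (auto simp: theta_graph_def)
  moreover have "card {theta_vertex ps i j, theta_vertex ps i (Suc j)} = 2" if "j < ps ! i" for i j
    using that by (auto simp: theta_vertex_def)
  ultimately show ?thesis
    unfolding simple_graph_def by (force simp: theta_graph_def)
qed

end

theory Submission
  imports Defs "HOL-Library.Ramsey"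
begin

text \<open>Deleting an end vertex from a theta graph leaves a tree, so in an \<open>H\<close>-free graph every vertex set \<open>U\<close>
  inside a neighbourhood spans only \<open>O(|U|)\<close> edges; this gives the quadratic upper bound.

  If \<open>H\<close> has at most one triangle, the number of triangles is even linear in the number of edges lying in
  triangles.  If that number exceeds the Kovari--Sos--Turan bound, there is a large biclique all of
  whose edges lie in triangles.  Alternating paths in it have the right parity or can be corrected with a third vertex
  of a triangle; if the available third vertices are too concentrated, then one of them is joined
  to a large biclique, which contains \<open>H\<close> minus an end vertex.

  If \<open>H\<close> has several triangles but no path of length 3, call an edge heavy if it lies in
  at least \<open>K\<close> triangles.  Heavy edges contain no large biclique and are therefore \<open>o(n\<^sup>2)\<close> in number, so triangles
  with two heavy edges are negligible.  Triangles without heavy edges are \<open>o(n\<^sup>2)\<close> by the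
  Ruzsa--Szemeredi theorem, which is proved by an energy increment on partitions by neighbourhoods.
  If triangles with one heavy edge had positive density, then Ramsey's theorem would yield a heavy edge whose
  ends are joined by many paths of each length at least 4.  The lower bounds come from Behrend's
  construction and from a perfect matching joined to an independent set.\<close>

subsection \<open>Counting tools\<close>

text \<open>Length 3 separates the last two cases because of one example: in a matching joined to an
  independent set every matching edge lies in many triangles, but its ends are joined by no path of
  length 3. A heavy edge can therefore be expected to yield every length except 3, and the argument
  for triangles with one heavy edge yields exactly these: the edge itself, a common neighbour, even
  lengths through the apexes over the edge, and odd lengths from 5 on through a second heavy edge.

  All embeddings rest on robustness: if a path of the required length survives the deletion of any
  \<open>sum_list ps\<close> vertices, it can be added to the paths already chosen.

  The energy increment can refine by single neighbourhoods because bounded codegrees make every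
  neighbourhood span only linearly many edges: a dense pair of cells in which it is large is then
  visibly irregular.\<close>

lemma power_mean:
  fixes y :: "'a \<Rightarrow> real"
  assumes "finite V" "\<And>x. x \<in> V \<Longrightarrow> y x \<ge> 0" "s \<ge> 1"
  shows "real (card V) * ((\<Sum>x\<in>V. y x) / real (card V)) ^ s \<le> (\<Sum>x\<in>V. y x ^ s)"
proof (cases "(\<Sum>x\<in>V. y x) = 0")
  case True
  then show ?thesis using assms by (auto simp: sum_nonneg power_0_left)
next
  case False
  define m where "m = (\<Sum>x\<in>V. y x) / real (card V)"
  have V: "card V > 0" using False assms(1) by (auto simp: card_gt_0_iff)
  have pos: "(\<Sum>x\<in>V. y x) > 0" using False assms(2) by (metis sum_nonneg order_le_less)
  have m: "m > 0" using V pos by (simp add: m_def)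
  \<comment> \<open>Convexity of the \<open>s\<close>-th power as a tangent line at the mean
    \<open>m\<close>: Bernoulli's inequality supplies it for \<open>y x / m\<close>, and the linear
    terms cancel in the sum.\<close>
  have "m ^ s * (1 + real s * (y x / m - 1)) \<le> y x ^ s" if "x \<in> V" for x
  proof -
    have "-1 \<le> y x / m - 1" using m assms(2)[OF that] by simp
    from Bernoulli_inequality[OF this, of s]
    have "m ^ s * (1 + real s * (y x / m - 1)) \<le> m ^ s * (y x / m) ^ s"
      using m by (intro mult_left_mono) auto
    also have "\<dots> = y x ^ s" using m by (simp add: power_divide)
    finally show ?thesis .
  qed
  then have "(\<Sum>x\<in>V. m ^ s * (1 + real s * (y x / m - 1))) \<le> (\<Sum>x\<in>V. y x ^ s)"
    by (rule sum_mono)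
  moreover have "(\<Sum>x\<in>V. m ^ s * (1 + real s * (y x / m - 1)))
      = m ^ s * (real (card V) + real s * ((\<Sum>x\<in>V. y x) / m - real (card V)))"
    by (simp add: sum_distrib_left[symmetric] sum.distrib sum_subtractf sum_divide_distrib[symmetric])
  moreover have "(\<Sum>x\<in>V. y x) / m = real (card V)" using pos V by (simp add: m_def)
  ultimately show ?thesis by (simp add: m_def mult.commute)
qed

lemma sum_card_swap:
  assumes "finite A" "finite B"
  shows "(\<Sum>x\<in>A. card {y\<in>B. P x y}) = (\<Sum>y\<in>B. card {x\<in>A. P x y})"
  using assms by (intro sum_multicount_gen) auto

lemma card_pairs_eq_sum:
  assumes "finite A" "finite B"
  shows "card {(x,y) \<in> A \<times> B. P x y} = (\<Sum>x\<in>A. card {y\<in>B. P x y})"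
proof -
  have "{(x,y) \<in> A \<times> B. P x y} = (SIGMA x:A. {y\<in>B. P x y})" by auto
  then show ?thesis using assms by simp
qed

text \<open>Double counting of pairs of a vertex \<open>x\<close> and an \<open>s\<close>-set inside
  its \<open>R\<close>-neighbourhood: each \<open>s\<close>-set has at most \<open>s\<close> common
  in-neighbours, and convexity turns this into a bound on the mean degree. \<open>R\<close> is an
  arbitrary relation, so that the bound applies to the edges lying in triangles and to the heavy
  edges alike.\<close>

theorem kovari_sos_turan:
  assumes fin: "finite V" and s: "s \<ge> 1"
    and no: "\<not> (\<exists>A\<subseteq>V. \<exists>B\<subseteq>V. card A = s \<and> card B = s \<and> (\<forall>a\<in>A. \<forall>b\<in>B. R a b))"
  shows "real (card {(x,y) \<in> V \<times> V. R x y}) \<le> 2 * real s ^ 2 * real (card V) powr (2 - 1 / real s)"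
proof (cases "card V = 0")
  case True
  then show ?thesis using fin by simp
next
  case False
  define n where "n = card V"
  define N where "N x = {y\<in>V. R x y}" for x
  define d where "d x = card (N x)" for x
  \<comment> \<open>Truncated at 0 so that \<open>y x ^ s\<close> stays below
    \<open>d x choose s\<close> even for degrees below \<open>s\<close>, while \<open>d x\<close> is
    still at most \<open>s + s * y x\<close>.\<close>
  define y where "y x = max 0 ((real (d x) - real s) / real s)" for x
  have n: "n \<ge> 1" using False by (simp add: n_def)
  define SS where "SS = {S. S \<subseteq> V \<and> card S = s}"
  have finSS: "finite SS" using fin by (simp add: SS_def)
  have e: "card {(x,y) \<in> V \<times> V. R x y} = (\<Sum>x\<in>V. d x)"
    unfolding d_def N_def by (rule card_pairs_eq_sum[OF fin fin])
  have finN: "finite (N x)" for x using fin by (simp add: N_def)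
  have "(\<Sum>x\<in>V. d x choose s) = (\<Sum>x\<in>V. card {S\<in>SS. S \<subseteq> N x})"
  proof (rule sum.cong)
    fix x
    have "{S\<in>SS. S \<subseteq> N x} = {S. S \<subseteq> N x \<and> card S = s}" by (auto simp: SS_def N_def)
    then show "d x choose s = card {S\<in>SS. S \<subseteq> N x}" using n_subsets[OF finN] by (simp add: d_def)
  qed simp
  also have "\<dots> = (\<Sum>S\<in>SS. card {x\<in>V. S \<subseteq> N x})" by (rule sum_card_swap[OF fin finSS])
  also have "\<dots> \<le> (\<Sum>S\<in>SS. s)"
  proof (rule sum_mono, rule ccontr)
    fix S assume S: "S \<in> SS" and "\<not> card {x\<in>V. S \<subseteq> N x} \<le> s"
    then have "s \<le> card {x\<in>V. S \<subseteq> N x}" by linarith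
    then obtain A where A: "A \<subseteq> {x\<in>V. S \<subseteq> N x}" "card A = s"
      by (rule obtain_subset_with_card_n)
    have "S \<subseteq> V" "card S = s" using S by (auto simp: SS_def)
    moreover have "\<forall>a\<in>A. \<forall>b\<in>S. R a b" using A by (auto simp: N_def)
    ultimately show False using no A by blast
  qed
  also have "\<dots> = s * (n choose s)"
    using n_subsets[OF fin, of s] by (simp add: SS_def n_def)
  also have "\<dots> \<le> s * n ^ s"
    by (cases "s \<le> n") (auto simp: binomial_le_pow binomial_eq_0)
  finally have 1: "(\<Sum>x\<in>V. d x choose s) \<le> s * n ^ s" .
  have ys: "y x ^ s \<le> real (d x choose s)" for x
  proof (cases "d x \<ge> s")
    case True
    have "y x ^ s \<le> (real (d x) / real s) ^ s"
      using True s by (intro power_mono) (auto simp: y_def field_simps)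
    also have "\<dots> \<le> real (d x choose s)"
      using binomial_ge_n_over_k_pow_k[OF True, where 'a=real] by simp
    finally show ?thesis .
  next
    case False
    then have "y x = 0" using s by (auto simp: y_def field_simps max_def)
    then show ?thesis using s by (simp add: power_0_left)
  qed
  define m where "m = (\<Sum>x\<in>V. y x) / real n"
  define b where "b = real s * real n powr (1 - 1 / real s)"
  have "real n * m ^ s \<le> (\<Sum>x\<in>V. y x ^ s)"
    unfolding m_def n_def by (rule power_mean[OF fin _ s]) (simp add: y_def)
  also have "\<dots> \<le> (\<Sum>x\<in>V. real (d x choose s))" by (rule sum_mono) (rule ys)
  also have "\<dots> \<le> real s * real n ^ s" 
    using of_nat_mono[OF 1, where 'a=real] by simp
  also have "\<dots> = real n * (real s * real n ^ (s - 1))" using s by (cases s) auto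
  finally have "m ^ s \<le> real s * real n ^ (s - 1)" using n by simp
  \<comment> \<open>Enlarging \<open>s\<close> to \<open>s ^ s\<close> makes the right-hand side a
    perfect \<open>s\<close>-th power, so that the root can be taken.\<close>
  also have "\<dots> \<le> real s ^ s * real n ^ (s - 1)"
    using s self_le_power[of "real s" s] by (intro mult_right_mono) auto
  also have "\<dots> = b ^ s"
  proof -
    have "(real n powr (1 - 1 / real s)) ^ s = real n powr ((1 - 1 / real s) * real s)"
      using n by (simp add: powr_powr[symmetric] powr_realpow)
    also have "(1 - 1 / real s) * real s = real (s - 1)" using s by (simp add: field_simps of_nat_diff)
    finally show ?thesis using n by (simp add: b_def power_mult_distrib powr_realpow)
  qed
  finally have mb: "m \<le> b" using power_mono_iff[of m b s] s
    by (metis b_def mult_nonneg_nonneg not_le of_nat_0_le_iff powr_ge_zero power_strict_mono not_one_le_zero zero_less_iff_neq_zero)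
  have dy: "real (d x) \<le> real s + real s * y x" for x
    using s by (auto simp: y_def max_def field_simps)
  have n1: "real n \<le> real n powr (2 - 1 / real s)"
    using powr_mono[of 1 "2 - 1 / real s" "real n"] n s by (simp add: field_simps)
  have "real (\<Sum>x\<in>V. d x) \<le> (\<Sum>x\<in>V. real s + real s * y x)"
    unfolding of_nat_sum by (rule sum_mono) (rule dy)
  also have "\<dots> = real s * real n + real s * real n * m"
    using n by (simp add: sum.distrib n_def m_def sum_distrib_left[symmetric])
  also have "\<dots> \<le> real s * real n + real s * real n * b"
    using mb by (intro add_left_mono mult_left_mono) auto
  also have "real s * real n * b = real s ^ 2 * real n powr (2 - 1 / real s)"
  proof -
    have "real n * real n powr (1 - 1 / real s) = real n powr (1 + (1 - 1 / real s))"
      using n by (subst powr_add) simp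
    then show ?thesis by (simp add: b_def power2_eq_square algebra_simps)
  qed
  also have "real s * real n \<le> real s ^ 2 * real n powr (2 - 1 / real s)"
    using n1 s by (intro mult_mono) (auto simp: power2_eq_square)
  finally show ?thesis using e by (simp add: n_def)
qed

text \<open>Let \<open>n\<close> be \<open>card W\<close> and \<open>L\<close> be
  \<open>card I\<close>. By Cauchy-Schwarz the intersections over all ordered pairs of indices have
  total size at least \<open>n * (L * \<eta>)^2\<close>. The diagonal accounts for at most
  \<open>L * n\<close>; if all other intersections were below half of the expected
  \<open>\<eta>^2 * n\<close>, this would force \<open>L * \<eta>^2 / 2 \<le> 1\<close>.\<close>

lemma dense_sets_intersect:
  fixes S :: "'i \<Rightarrow> 'a set"
  assumes fin: "finite W" "finite I" and I: "real (card I) > 2 / \<eta> ^ 2" and \<eta>: "\<eta> > 0"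
    and W: "W \<noteq> {}"
    and S: "\<And>i. i \<in> I \<Longrightarrow> S i \<subseteq> W" "\<And>i. i \<in> I \<Longrightarrow> real (card (S i)) \<ge> \<eta> * real (card W)"
  shows "\<exists>i\<in>I. \<exists>j\<in>I. i \<noteq> j \<and> real (card (S i \<inter> S j)) \<ge> \<eta> ^ 2 / 2 * real (card W)"
proof (rule ccontr)
  assume neg: "\<not> ?thesis"
  define n where "n = real (card W)"
  define L where "L = real (card I)"
  define c where "c w = real (card {i\<in>I. w \<in> S i})" for w
  have n: "n > 0" using W fin by (simp add: n_def card_gt_0_iff)
  have L: "L > 0" using I \<eta> by (smt (verit) L_def divide_pos_pos zero_less_power)
  have "L * (\<eta> * n) \<le> (\<Sum>i\<in>I. real (card (S i)))"
    unfolding L_def n_def using S(2) sum_mono[of I "\<lambda>_. \<eta> * real (card W)" "\<lambda>i. real (card (S i))"] by simp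
  also have "\<dots> = (\<Sum>i\<in>I. real (card {w\<in>W. w \<in> S i}))"
    by (intro sum.cong refl arg_cong[where f="\<lambda>X. real (card X)"]) (use S in auto)
  also have "\<dots> = (\<Sum>w\<in>W. c w)"
    unfolding c_def using sum_card_swap[OF fin(2,1), of "\<lambda>i w. w \<in> S i"]
    by (simp only: of_nat_sum[symmetric])
  finally have 1: "L * \<eta> * n \<le> (\<Sum>w\<in>W. c w)" by simp
  have "real (card W) * ((\<Sum>w\<in>W. c w) / real (card W)) ^ 2 \<le> (\<Sum>w\<in>W. c w ^ 2)"
    by (rule power_mean) (auto simp: fin c_def)
  then have "n * (L * \<eta>)^2 \<le> (\<Sum>w\<in>W. c w ^ 2)"
  proof (rule order_trans[rotated])
    have "L * \<eta> \<le> (\<Sum>w\<in>W. c w) / n" using 1 n by (simp add: field_simps)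
    then have "(L * \<eta>)^2 \<le> ((\<Sum>w\<in>W. c w) / n)^2" using L \<eta> by (intro power_mono) auto
    then show "n * (L * \<eta>)^2 \<le> real (card W) * ((\<Sum>w\<in>W. c w) / real (card W)) ^ 2"
      using n by (auto simp: n_def)
  qed
  also have "(\<Sum>w\<in>W. c w ^ 2) = (\<Sum>w\<in>W. real (card {p\<in>I\<times>I. w \<in> S (fst p) \<inter> S (snd p)}))"
  proof (rule sum.cong)
    fix w
    have "{p\<in>I\<times>I. w \<in> S (fst p) \<inter> S (snd p)} = {i\<in>I. w \<in> S i} \<times> {i\<in>I. w \<in> S i}" by auto
    then show "c w ^ 2 = real (card {p\<in>I\<times>I. w \<in> S (fst p) \<inter> S (snd p)})"
      by (simp add: c_def card_cartesian_product power2_eq_square)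
  qed simp
  also have "\<dots> = (\<Sum>p\<in>I\<times>I. real (card {w\<in>W. w \<in> S (fst p) \<inter> S (snd p)}))"
    using sum_card_swap[of W "I\<times>I" "\<lambda>w p. w \<in> S (fst p) \<inter> S (snd p)"] fin
    by (simp only: of_nat_sum[symmetric] finite_cartesian_product)
  also have "\<dots> \<le> (\<Sum>p\<in>I\<times>I. (if fst p = snd p then n else 0) + \<eta>^2/2 * n)"
  proof (rule sum_mono)
    fix p assume p: "p \<in> I \<times> I"
    have "{w\<in>W. w \<in> S (fst p) \<inter> S (snd p)} = S (fst p) \<inter> S (snd p)" using p S(1)[of "fst p"] by auto
    moreover have "real (card (S (fst p) \<inter> S (snd p))) \<le> n"
      unfolding n_def using p S(1)[of "fst p"] fin by (intro of_nat_mono card_mono) auto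
    moreover have "real (card (S (fst p) \<inter> S (snd p))) \<le> \<eta>^2/2 * n" if "fst p \<noteq> snd p"
      using neg p that unfolding n_def by (cases p) (force simp: not_le intro: less_imp_le)
    moreover have "\<eta>^2/2 * n \<ge> 0" using n by simp
    ultimately show "real (card {w\<in>W. w \<in> S (fst p) \<inter> S (snd p)})
        \<le> (if fst p = snd p then n else 0) + \<eta>^2/2 * n" by (smt (verit, best))
  qed
  also have "\<dots> = L * n + L^2 * (\<eta>^2/2 * n)"
  proof -
    have "(\<Sum>p\<in>I\<times>I. if fst p = snd p then n else 0) = (\<Sum>i\<in>I. \<Sum>j\<in>I. if i = j then n else 0)"
      by (simp add: sum.cartesian_product case_prod_beta)
    also have "\<dots> = L * n" using fin by (simp add: L_def)
    finally show ?thesis by (simp add: sum.distrib L_def card_cartesian_product power2_eq_square)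
  qed
  finally have "n * (L * \<eta>)^2 \<le> L * n + L^2 * (\<eta>^2/2 * n)" .
  then have "(L * n) * (L * \<eta>^2 / 2) \<le> (L * n) * 1"
    by (simp add: power2_eq_square algebra_simps)
  then have "L * \<eta>^2 / 2 \<le> 1" using L n by (metis mult_le_cancel_left_pos mult_pos_pos)
  moreover have "L > 2 / \<eta>^2" using I by (simp add: L_def)
  ultimately show False using \<eta> by (simp add: field_simps)
qed

text \<open>Join two indices if their sets intersect substantially: by Cauchy--Schwarz there is no large independent
  set, so Ramsey's theorem yields a clique.\<close>

lemma dense_sets_clique:
  fixes \<eta> :: real and r :: nat
  assumes \<eta>: "\<eta> > 0"
  shows "\<exists>L\<ge>1. \<forall>(W::'a set) (I::'i set) S. finite W \<and> finite I \<and> card I \<ge> L \<and> W \<noteq> {} \<and>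
     (\<forall>i\<in>I. S i \<subseteq> W \<and> real (card (S i)) \<ge> \<eta> * real (card W)) \<longrightarrow>
     (\<exists>J\<subseteq>I. card J = r \<and> (\<forall>i\<in>J. \<forall>j\<in>J. i \<noteq> j \<longrightarrow> real (card (S i \<inter> S j)) \<ge> \<eta> ^ 2 / 2 * real (card W)))"
proof -
  define q where "q = nat \<lceil>2 / \<eta>^2\<rceil> + 1"
  have q: "real q > 2 / \<eta>^2" unfolding q_def by linarith
  obtain L where L: "L \<ge> 1" "\<forall>(V::'i set) (E::'i set set). finite V \<and> card V \<ge> L \<longrightarrow>
    (\<exists>R \<subseteq> V. card R = r \<and> clique R E \<or> card R = q \<and> indep R E)"
    using ramsey2 by blast
  show ?thesis
  proof (intro exI[of _ L] conjI L(1) allI impI)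
    fix W :: "'a set" and I :: "'i set" and S
    assume a: "finite W \<and> finite I \<and> L \<le> card I \<and> W \<noteq> {} \<and>
      (\<forall>i\<in>I. S i \<subseteq> W \<and> real (card (S i)) \<ge> \<eta> * real (card W))"
    define E where "E = {{i,j} | i j. real (card (S i \<inter> S j)) \<ge> \<eta> ^ 2 / 2 * real (card W)}"
    have E: "{i,j} \<in> E \<longleftrightarrow> real (card (S i \<inter> S j)) \<ge> \<eta> ^ 2 / 2 * real (card W)" for i j
      by (auto simp: E_def doubleton_eq_iff Int_commute)
    obtain J where J: "J \<subseteq> I" "card J = r \<and> clique J E \<or> card J = q \<and> indep J E"
      using L(2) a by metis
    have "\<not> (card J = q \<and> indep J E)"
    proof
      assume b: "card J = q \<and> indep J E"
      have "\<exists>i\<in>J. \<exists>j\<in>J. i \<noteq> j \<and> real (card (S i \<inter> S j)) \<ge> \<eta> ^ 2 / 2 * real (card W)"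
        by (rule dense_sets_intersect) (use a b J q \<eta> in \<open>auto intro: finite_subset\<close>)
      then show False using b E by (auto simp: indep_def)
    qed
    then show "\<exists>J\<subseteq>I. card J = r \<and> (\<forall>i\<in>J. \<forall>j\<in>J. i \<noteq> j \<longrightarrow> real (card (S i \<inter> S j)) \<ge> \<eta> ^ 2 / 2 * real (card W))"
      using J E by (auto simp: clique_def)
  qed
qed


subsection \<open>Averaging over the cells of a finite partition\<close>

text \<open>The cells are the fibres of a key function \<open>k\<close>; \<open>cell_avg\<close> is the conditional expectation.\<close>

definition cell :: "'a set \<Rightarrow> ('a \<Rightarrow> 'k) \<Rightarrow> 'a \<Rightarrow> 'a set" where
  "cell X k p = {q\<in>X. k q = k p}"

definition cell_avg :: "'a set \<Rightarrow> ('a \<Rightarrow> 'k) \<Rightarrow> ('a \<Rightarrow> real) \<Rightarrow> 'a \<Rightarrow> real" where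
  "cell_avg X k f p = (\<Sum>q\<in>cell X k p. f q) / real (card (cell X k p))"

lemma cell_avg_cong: "k p = k q \<Longrightarrow> cell_avg X k f p = cell_avg X k f q"
  by (simp add: cell_avg_def cell_def)

lemma sum_by_cells:
  fixes f :: "'a \<Rightarrow> real"
  assumes "finite X"
  shows "(\<Sum>p\<in>X. f p) = (\<Sum>c\<in>k ` X. \<Sum>p\<in>{q\<in>X. k q = c}. f p)"
  using sum.image_gen[OF assms, of f k] .

text \<open>The defining property of a conditional expectation: it may be exchanged for
  \<open>f\<close> under a sum against any function constant on the cells, and \<open>g\<close>
  composed with \<open>k\<close> is the general form of such a function.\<close>

lemma sum_cell_avg:
  assumes "finite X"
  shows "(\<Sum>p\<in>X. cell_avg X k f p * g (k p)) = (\<Sum>p\<in>X. f p * g (k p))"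
proof -
  have "(\<Sum>p\<in>{q\<in>X. k q = c}. cell_avg X k f p * g (k p)) = (\<Sum>p\<in>{q\<in>X. k q = c}. f p * g (k p))"
    if c: "c \<in> k ` X" for c
  proof -
    let ?C = "{q\<in>X. k q = c}"
    have C: "card ?C > 0" using c assms by (auto simp: card_gt_0_iff)
    have "cell_avg X k f p = (\<Sum>q\<in>?C. f q) / real (card ?C)" if "p \<in> ?C" for p
      using that by (simp add: cell_avg_def cell_def)
    then have "(\<Sum>p\<in>?C. cell_avg X k f p * g (k p)) = (\<Sum>p\<in>?C. (\<Sum>q\<in>?C. f q) / real (card ?C) * g c)"
      by (intro sum.cong) auto
    also have "\<dots> = (\<Sum>q\<in>?C. f q) * g c" using C by simp
    also have "\<dots> = (\<Sum>p\<in>?C. f p * g (k p))" by (simp add: sum_distrib_right)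
    finally show ?thesis .
  qed
  then show ?thesis
    unfolding sum_by_cells[OF assms, of _ k] by (rule sum.cong[OF refl])
qed

lemma cell_avg_bounds:
  assumes "\<And>p. p \<in> X \<Longrightarrow> 0 \<le> f p" "\<And>p. p \<in> X \<Longrightarrow> f p \<le> 1"
  shows "0 \<le> cell_avg X k f p" "cell_avg X k f p \<le> 1"
proof -
  show "0 \<le> cell_avg X k f p"
    unfolding cell_avg_def by (intro divide_nonneg_nonneg sum_nonneg) (auto simp: cell_def assms)
  have "(\<Sum>q\<in>cell X k p. f q) \<le> (\<Sum>q\<in>cell X k p. 1)"
    by (rule sum_mono) (auto simp: cell_def assms)
  then show "cell_avg X k f p \<le> 1"
    unfolding cell_avg_def by (auto simp: divide_le_eq)
qed

text \<open>\<open>T\<close> fills less than a share \<open>\<delta>\<close> of each sparse cell,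
  and the cells are disjoint. In the proof the sparse cells are selected by a function
  \<open>g\<close> of the key, so that averaging over cells does not change the sum.\<close>

lemma card_sparse_cells:
  assumes "finite X" "T \<subseteq> X" "\<delta> \<ge> 0"
  shows "real (card {x\<in>T. real (card (T \<inter> cell X k x)) < \<delta> * real (card (cell X k x))}) \<le> \<delta> * real (card X)"
proof -
  let ?f = "\<lambda>x. of_bool (x \<in> T) :: real"
  have avg: "cell_avg X k ?f x = real (card (T \<inter> cell X k x)) / real (card (cell X k x))" for x
  proof -
    have "(\<Sum>q\<in>cell X k x. ?f q) = real (card (cell X k x \<inter> T))"
      using assms(1) by (simp add: cell_def)
    then show ?thesis by (simp add: cell_avg_def Int_commute)
  qed
  define g where "g c = (if \<exists>p\<in>X. k p = c \<and> cell_avg X k ?f p < \<delta> then 1 else 0 :: real)" for c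
  have g: "g (k p) = (if cell_avg X k ?f p < \<delta> then 1 else 0)" if "p \<in> X" for p
    using that by (auto simp: g_def dest: cell_avg_cong[of k _ p X ?f])
  have "real (card {x\<in>T. real (card (T \<inter> cell X k x)) < \<delta> * real (card (cell X k x))})
      = real (card {x\<in>X. x \<in> T \<and> cell_avg X k ?f x < \<delta>})"
  proof -
    have "card (cell X k x) > 0" if "x \<in> X" for x
      using that assms(1) by (auto simp: card_gt_0_iff cell_def)
    then show ?thesis unfolding avg using assms(2)
      by (intro arg_cong[where f="\<lambda>A. real (card A)"]) (auto simp: pos_divide_less_eq subset_iff)
  qed
  also have "\<dots> = (\<Sum>p\<in>X. ?f p * g (k p))"
  proof -
    have "(\<Sum>p\<in>X. ?f p * g (k p)) = (\<Sum>p\<in>X. if p \<in> T \<and> cell_avg X k ?f p < \<delta> then 1 else 0)"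
      by (rule sum.cong) (auto simp: g)
    then show ?thesis using assms(1) by (simp add: sum.If_cases Int_def)
  qed
  also have "\<dots> = (\<Sum>p\<in>X. cell_avg X k ?f p * g (k p))" by (rule sum_cell_avg[OF assms(1), symmetric])
  also have "\<dots> \<le> (\<Sum>p\<in>X. \<delta>)" by (rule sum_mono) (use g assms(3) in auto)
  finally show ?thesis by (simp add: mult.commute)
qed

text \<open>Union bound over at most \<open>card K\<close> cells, each contributing fewer than
  \<open>\<beta>\<close> elements. \<open>K\<close> may be any finite superset of the keys that
  occur; later it is the powerset of the probe set.\<close>

lemma card_small_cells:
  assumes "finite X" "finite K" "k ` X \<subseteq> K" "\<beta> \<ge> 0"
  shows "real (card {x\<in>X. real (card (cell X k x)) < \<beta>}) \<le> \<beta> * real (card K)"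
proof -
  have sub: "{x\<in>X. real (card (cell X k x)) < \<beta>} \<subseteq> (\<Union>c\<in>{c\<in>K. real (card {q\<in>X. k q = c}) < \<beta>}. {q\<in>X. k q = c})"
    using assms by (auto simp: cell_def)
  have "card {x\<in>X. real (card (cell X k x)) < \<beta>} \<le> (\<Sum>c\<in>{c\<in>K. real (card {q\<in>X. k q = c}) < \<beta>}. card {q\<in>X. k q = c})"
    by (rule order_trans[OF card_mono[OF _ sub] card_UN_le]) (use assms in auto)
  then have "real (card {x\<in>X. real (card (cell X k x)) < \<beta>})
     \<le> (\<Sum>c\<in>{c\<in>K. real (card {q\<in>X. k q = c}) < \<beta>}. real (card {q\<in>X. k q = c}))"
    by (simp only: of_nat_sum[symmetric] of_nat_le_iff)
  also have "\<dots> \<le> (\<Sum>c\<in>{c\<in>K. real (card {q\<in>X. k q = c}) < \<beta>}. \<beta>)" by (rule sum_mono) auto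
  also have "\<dots> \<le> real (card K) * \<beta>"
    using assms by (auto intro!: mult_right_mono card_mono)
  finally show ?thesis by (simp add: mult.commute)
qed

text \<open>Pythagoras' theorem for the projection onto functions that are constant on the cells.\<close>

lemma energy_increment:
  assumes "finite X" "\<And>p. p \<in> X \<Longrightarrow> k p = h (k' p)"
  shows "(\<Sum>p\<in>X. cell_avg X k' f p ^ 2) - (\<Sum>p\<in>X. cell_avg X k f p ^ 2)
       = (\<Sum>p\<in>X. (cell_avg X k' f p - cell_avg X k f p) ^ 2)"
proof -
  define G where "G c = (\<Sum>q\<in>{q\<in>X. k q = c}. f q) / real (card {q\<in>X. k q = c})" for c
  have G: "cell_avg X k f p = G (k p)" for p by (simp add: G_def cell_avg_def cell_def)
  have "(\<Sum>p\<in>X. cell_avg X k' f p * G (k p)) = (\<Sum>p\<in>X. cell_avg X k' f p * (G \<circ> h) (k' p))"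
    by (rule sum.cong) (auto simp: assms(2))
  also have "\<dots> = (\<Sum>p\<in>X. f p * (G \<circ> h) (k' p))" by (rule sum_cell_avg[OF assms(1)])
  also have "\<dots> = (\<Sum>p\<in>X. f p * G (k p))" by (rule sum.cong) (auto simp: assms(2))
  also have "\<dots> = (\<Sum>p\<in>X. cell_avg X k f p * G (k p))" by (rule sum_cell_avg[OF assms(1), symmetric])
  also have "\<dots> = (\<Sum>p\<in>X. cell_avg X k f p ^ 2)" by (simp add: G power2_eq_square)
  finally have "(\<Sum>p\<in>X. cell_avg X k' f p * cell_avg X k f p) = (\<Sum>p\<in>X. cell_avg X k f p ^ 2)"
    by (simp add: G)
  then show ?thesis
    by (simp add: power2_diff sum.distrib sum_subtractf mult.assoc sum_distrib_left[symmetric])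
qed

lemma energy_le:
  assumes "\<And>p. p \<in> X \<Longrightarrow> 0 \<le> f p" "\<And>p. p \<in> X \<Longrightarrow> f p \<le> 1"
  shows "(\<Sum>p\<in>X. cell_avg X k f p ^ 2) \<le> real (card X)"
proof -
  have "(\<Sum>p\<in>X. cell_avg X k f p ^ 2) \<le> (\<Sum>p\<in>X. 1)"
    by (rule sum_mono) (use cell_avg_bounds[of X f k] assms in \<open>auto intro!: power_le_one\<close>)
  then show ?thesis by simp
qed

subsection \<open>Finding theta graphs greedily\<close>

text \<open>Only the interior vertices are listed, because these are what distinct paths of a theta
  graph must not share. \<open>Z\<close> restricts the interior alone, so the ends may lie in it,
  and \<open>p\<close> = 0 is impossible.\<close>

definition inner_path :: "('a \<Rightarrow> 'a \<Rightarrow> bool) \<Rightarrow> 'a \<Rightarrow> 'a \<Rightarrow> nat \<Rightarrow> 'a set \<Rightarrow> 'a list \<Rightarrow> bool" where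
  "inner_path E u v p Z xs \<longleftrightarrow>
     Suc (length xs) = p \<and> distinct xs \<and> set xs \<inter> (Z \<union> {u, v}) = {} \<and> successively E (u # xs @ [v])"

definition avoiding_path :: "('a \<Rightarrow> 'a \<Rightarrow> bool) \<Rightarrow> 'a \<Rightarrow> 'a \<Rightarrow> nat \<Rightarrow> 'a set \<Rightarrow> bool" where
  "avoiding_path E u v p Z \<longleftrightarrow> (\<exists>xs. inner_path E u v p Z xs)"

definition robust_path :: "('a \<Rightarrow> 'a \<Rightarrow> bool) \<Rightarrow> 'a \<Rightarrow> 'a \<Rightarrow> nat \<Rightarrow> nat \<Rightarrow> bool" where
  "robust_path E u v p k \<longleftrightarrow> (\<forall>Z. finite Z \<and> card Z \<le> k \<longrightarrow> avoiding_path E u v p Z)"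

definition has_theta :: "('a \<Rightarrow> 'a \<Rightarrow> bool) \<Rightarrow> nat list \<Rightarrow> bool" where
  "has_theta E ps \<longleftrightarrow> (\<exists>u v xss. u \<noteq> v \<and> (\<forall>i<length ps. inner_path E u v (ps ! i) {} (xss i)) \<and>
     (\<forall>i<length ps. \<forall>j<length ps. i \<noteq> j \<longrightarrow> set (xss i) \<inter> set (xss j) = {}))"

lemma robust_pathD: "robust_path E u v p k \<Longrightarrow> finite Z \<Longrightarrow> card Z \<le> k \<Longrightarrow> avoiding_path E u v p Z"
  by (simp add: robust_path_def)

lemma avoiding_path_edge: "E u v \<Longrightarrow> avoiding_path E u v (Suc 0) Z"
  unfolding avoiding_path_def inner_path_def by (intro exI[of _ "[]"]) auto

lemma robust_path_edge: "E u v \<Longrightarrow> robust_path E u v (Suc 0) k"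
  by (simp add: robust_path_def avoiding_path_edge)

lemma avoiding_path_two: "E u t \<Longrightarrow> E t v \<Longrightarrow> t \<notin> insert u (insert v Z) \<Longrightarrow> avoiding_path E u v 2 Z"
  unfolding avoiding_path_def inner_path_def by (intro exI[of _ "[t]"]) auto

text \<open>The second leg has to avoid \<open>u\<close>, the \<open>p - 1\<close> interior vertices
  of the first leg and \<open>Z\<close>, whence \<open>card Z + p\<close>. The junction
  \<open>v\<close> becomes an interior vertex, so it must not lie in \<open>Z\<close>; the end
  \<open>w\<close> is kept off the first leg by inserting it into the forbidden set there.\<close>

lemma avoiding_path_append:
  assumes uv: "avoiding_path E u v p (insert w Z)" and vw: "robust_path E v w q k"
    and k: "card Z + p \<le> k" and Z: "finite Z" "v \<notin> Z" and ne: "u \<noteq> v" "v \<noteq> w" "u \<noteq> w"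
  shows "avoiding_path E u w (p + q) Z"
proof -
  obtain xs where xs: "inner_path E u v p (insert w Z) xs"
    using uv by (auto simp: avoiding_path_def)
  let ?Z = "insert u (Z \<union> set xs)"
  have "card ?Z \<le> Suc (card Z + card (set xs))"
    using Z card_Un_le[of Z "set xs"] card_insert_le_m1 by (simp add: card_insert_if)
  also have "\<dots> \<le> card Z + p" using xs card_length[of xs] by (auto simp: inner_path_def)
  finally obtain ys where ys: "inner_path E v w q ?Z ys"
    using robust_pathD[OF vw, of ?Z] k Z by (auto simp: avoiding_path_def)
  have "successively E ((u # xs @ [v]) @ ys @ [w])"
    using xs ys unfolding inner_path_def successively_append_iff[of E "u # xs @ [v]"]
    by (simp add: successively_Cons[of E v])
  then have "inner_path E u w (p + q) Z (xs @ v # ys)"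
    using xs ys ne Z unfolding inner_path_def by auto
  then show ?thesis by (auto simp: avoiding_path_def)
qed

text \<open>Greedy choice of the remaining paths: those already chosen have at most
  \<open>sum_list ps\<close> interior vertices together, and a robust path can avoid them. The
  prescribed family \<open>J0\<close> leaves room for a path that is not robust.\<close>

lemma has_theta_extend:
  assumes uv: "u \<noteq> v"
    and J0: "J0 \<subseteq> {..<length ps}" "\<And>i. i \<in> J0 \<Longrightarrow> inner_path E u v (ps ! i) {} (xss0 i)"
      "\<And>i j. i \<in> J0 \<Longrightarrow> j \<in> J0 \<Longrightarrow> i \<noteq> j \<Longrightarrow> set (xss0 i) \<inter> set (xss0 j) = {}"
    and rob: "\<And>i. i < length ps \<Longrightarrow> i \<notin> J0 \<Longrightarrow> robust_path E u v (ps ! i) (sum_list ps)"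
  shows "has_theta E ps"
proof -
  have "\<exists>xss. (\<forall>i\<in>J0 \<union> J. inner_path E u v (ps ! i) {} (xss i)) \<and>
     (\<forall>i\<in>J0 \<union> J. \<forall>j\<in>J0 \<union> J. i \<noteq> j \<longrightarrow> set (xss i) \<inter> set (xss j) = {})"
    if "finite J" "J \<subseteq> {..<length ps} - J0" for J
    using that
  proof (induction J)
    case empty
    then show ?case using J0 by (intro exI[of _ xss0]) auto
  next
    case (insert i J)
    then obtain xss where *: "\<forall>i\<in>J0 \<union> J. inner_path E u v (ps ! i) {} (xss i)"
      "\<forall>i\<in>J0 \<union> J. \<forall>j\<in>J0 \<union> J. i \<noteq> j \<longrightarrow> set (xss i) \<inter> set (xss j) = {}"
      by auto
    have xss: "\<And>j. j \<in> J0 \<union> J \<Longrightarrow> inner_path E u v (ps ! j) {} (xss j)"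
      "\<And>j j'. j \<in> J0 \<union> J \<Longrightarrow> j' \<in> J0 \<union> J \<Longrightarrow> j \<noteq> j' \<Longrightarrow> set (xss j) \<inter> set (xss j') = {}"
      using * by blast+
    let ?Z = "\<Union>j\<in>J0 \<union> J. set (xss j)"
    have sub: "J0 \<union> J \<subseteq> {..<length ps}" using J0(1) insert by auto
    then have fin: "finite (J0 \<union> J)" by (rule finite_subset) simp
    have "card ?Z \<le> (\<Sum>j\<in>J0 \<union> J. card (set (xss j)))" by (rule card_UN_le[OF fin])
    also have "\<dots> \<le> (\<Sum>j\<in>J0 \<union> J. ps ! j)"
    proof (rule sum_mono)
      fix j assume "j \<in> J0 \<union> J"
      then show "card (set (xss j)) \<le> ps ! j"
        using xss(1)[of j] card_length[of "xss j"] by (auto simp: inner_path_def)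
    qed
    also have "\<dots> \<le> (\<Sum>j<length ps. ps ! j)" by (rule sum_mono2) (use sub in auto)
    also have "\<dots> = sum_list ps" by (simp add: sum_list_sum_nth atLeast0LessThan)
    finally obtain ys where ys: "inner_path E u v (ps ! i) ?Z ys"
      using robust_pathD[OF rob, of i ?Z] insert fin by (auto simp: avoiding_path_def)
    have i: "i \<notin> J0 \<union> J" using insert by auto
    have "inner_path E u v (ps ! i) {} ys" using ys by (auto simp: inner_path_def)
    moreover have "set ys \<inter> set (xss j) = {}" if "j \<in> J0 \<union> J" for j
      using ys that by (auto simp: inner_path_def)
    ultimately show ?case
      using xss i by (intro exI[of _ "xss(i := ys)"]) (auto simp: Int_commute)
  qed
  from this[of "{..<length ps} - J0"] obtain xss where
    "\<forall>i\<in>{..<length ps}. inner_path E u v (ps ! i) {} (xss i)"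
    "\<forall>i\<in>{..<length ps}. \<forall>j\<in>{..<length ps}. i \<noteq> j \<longrightarrow> set (xss i) \<inter> set (xss j) = {}"
    using J0(1) by (auto simp: Un_absorb1)
  then show ?thesis using uv unfolding has_theta_def by blast
qed

lemma has_theta_robust:
  assumes "u \<noteq> v" "\<And>p. p \<in> set ps \<Longrightarrow> robust_path E u v p (sum_list ps)"
  shows "has_theta E ps"
  by (rule has_theta_extend[of u v "{}"]) (use assms in auto)

lemma has_theta_robust_except:
  assumes "u \<noteq> v" "i < length ps" "avoiding_path E u v (ps ! i) {}"
    "\<And>j. j < length ps \<Longrightarrow> j \<noteq> i \<Longrightarrow> robust_path E u v (ps ! j) (sum_list ps)"
  shows "has_theta E ps"
proof -
  obtain xs where "inner_path E u v (ps ! i) {} xs" using assms(3) by (auto simp: avoiding_path_def)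
  then show ?thesis
    by (intro has_theta_extend[of u v "{i}" ps E "\<lambda>_. xs"]) (use assms in auto)
qed

section \<open>Graphs as symmetric relations, and robust paths in them\<close>

locale fin_graph =
  fixes V :: "'a set" and E :: "'a \<Rightarrow> 'a \<Rightarrow> bool"
  assumes finV: "finite V" and E_V: "E x y \<Longrightarrow> x \<in> V"
    and E_sym: "E x y \<Longrightarrow> E y x" and E_irrefl: "\<not> E x x"
begin

definition N :: "'a \<Rightarrow> 'a set" where "N x = {y. E x y}"

lemma E_V2: "E x y \<Longrightarrow> y \<in> V" using E_V E_sym by blast

lemma N_sub: "N x \<subseteq> V" using E_V E_sym by (auto simp: N_def)

lemma finN [simp]: "finite (N x)" using N_sub finV by (rule finite_subset)

lemma N_iff [simp]: "y \<in> N x \<longleftrightarrow> E x y" by (simp add: N_def)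

lemma E_ne: "E x y \<Longrightarrow> x \<noteq> y" using E_irrefl by auto

lemma exists_avoiding:
  assumes "finite Z" "card Z < card A"
  shows "\<exists>x\<in>A. x \<notin> Z"
  using assms by (metis card_mono not_le subsetI)

lemma robust_path_two:
  assumes "k < card (N u \<inter> N v)"
  shows "robust_path E u v 2 k"
  unfolding robust_path_def
proof (intro allI impI)
  fix Z :: "'a set" assume "finite Z \<and> card Z \<le> k"
  then obtain t where "t \<in> N u \<inter> N v" "t \<notin> Z" using exists_avoiding[of Z "N u \<inter> N v"] assms by auto
  then show "avoiding_path E u v 2 Z"
    using E_ne[of u t] E_ne[of v t] E_sym by (intro avoiding_path_two[of _ _ t]) auto
qed

text \<open>The path hops between vertices of \<open>A\<close> through common neighbours,
  \<open>j + 1\<close> hops in all. After a hop two more vertices are forbidden and one hop fewer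
  remains, so \<open>k + 2 * j\<close> is invariant in the induction.\<close>

lemma robust_path_even:
  assumes A: "finite A" "\<And>a b. a \<in> A \<Longrightarrow> b \<in> A \<Longrightarrow> a \<noteq> b \<Longrightarrow> M \<le> card (N a \<inter> N b)"
    and a: "a \<in> A" "b \<in> A" "a \<noteq> b" and k: "k + 2 * j + 2 < card A" "k + 2 * j + 2 < M"
  shows "robust_path E a b (2 * j + 2) k"
  using a k
proof (induction j arbitrary: a k)
  case 0
  then have "k < card (N a \<inter> N b)" using A(2)[of a b] by auto
  then show ?case using robust_path_two[of k a b] by (simp only: mult_0_right add_0)
next
  case (Suc j)
  show ?case unfolding robust_path_def
  proof (intro allI impI)
    fix Z :: "'a set" assume Z: "finite Z \<and> card Z \<le> k"
    then have "card (insert a (insert b Z)) < card A"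
      using Suc.prems(4) by (auto simp: card_insert_if)
    then obtain c where c: "c \<in> A" "c \<notin> insert a (insert b Z)"
      using exists_avoiding[of "insert a (insert b Z)" A] Z by auto
    have "k + 1 < card (N a \<inter> N c)" using A(2)[of a c] c Suc.prems by auto
    moreover have "card (insert b Z) \<le> k + 1" using Z by (auto simp: card_insert_if)
    ultimately have "avoiding_path E a c 2 (insert b Z)"
      using robust_pathD[OF robust_path_two, of "k+1" a c "insert b Z"] Z by auto
    moreover have "robust_path E c b (2 * j + 2) (k + 2)"
      by (rule Suc.IH) (use c Suc.prems in auto)
    ultimately have "avoiding_path E a b (2 + (2 * j + 2)) Z"
      by (rule avoiding_path_append) (use Z c Suc.prems in auto)
    then show "avoiding_path E a b (2 * Suc j + 2) Z" by simp
  qed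
qed

section \<open>Alternating paths in bicliques\<close>

definition biclique :: "'a set \<Rightarrow> 'a set \<Rightarrow> nat \<Rightarrow> bool" where
  "biclique A B s \<longleftrightarrow> finite A \<and> finite B \<and> s \<le> card A \<and> s \<le> card B \<and> (\<forall>a\<in>A. \<forall>b\<in>B. E a b)"

lemma biclique_sym: "biclique A B s \<Longrightarrow> biclique B A s"
  using E_sym by (auto simp: biclique_def)

lemma biclique_even:
  assumes "biclique A B s" "a \<in> A" "b \<in> A" "a \<noteq> b" "k + 2 * j + 2 < s"
  shows "robust_path E a b (2 * j + 2) k"
proof (rule robust_path_even[of A s])
  show "s \<le> card (N a' \<inter> N b')" if "a' \<in> A" "b' \<in> A" for a' b'
  proof -
    have "B \<subseteq> N a' \<inter> N b'" using assms(1) that by (auto simp: biclique_def)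
    then show ?thesis using assms(1) card_mono[of "N a' \<inter> N b'" B] by (auto simp: biclique_def)
  qed
qed (use assms in \<open>auto simp: biclique_def\<close>)

lemma biclique_odd:
  assumes bi: "biclique A B s" "a \<in> A" "b \<in> B" and k: "k + 2 * j + 2 < s"
  shows "robust_path E a b (2 * j + 1) k"
proof (cases j)
  case 0
  then show ?thesis using bi by (auto simp: biclique_def intro: robust_path_edge)
next
  case (Suc i)
  show ?thesis unfolding robust_path_def
  proof (intro allI impI)
    fix Z :: "'a set" assume Z: "finite Z \<and> card Z \<le> k"
    then have "card (insert b Z) < card B" using k bi by (auto simp: card_insert_if biclique_def)
    then obtain c where c: "c \<in> B" "c \<notin> insert b Z"
      using exists_avoiding[of "insert b Z" B] Z by auto
    have E: "E a c" "E a b" using bi c by (auto simp: biclique_def)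
    have "robust_path E c b (2 * i + 2) (k + 1)"
      by (rule biclique_even[OF biclique_sym[OF bi(1)]]) (use bi c k Suc in auto)
    from avoiding_path_append[OF avoiding_path_edge[of E a c] this] E E_ne c Z
    have "avoiding_path E a b (Suc 0 + (2 * i + 2)) Z" by auto
    then show "avoiding_path E a b (2 * j + 1) Z" using Suc by simp
  qed
qed

text \<open>Removing an end vertex from a theta graph leaves a tree, which embeds greedily into a
  graph of large minimum degree.\<close>

lemma has_theta_neighbourhood_min_degree:
  assumes U: "U \<noteq> {}" "U \<subseteq> N w" and deg: "\<And>x. x \<in> U \<Longrightarrow> 2 * sum_list ps < card (N x \<inter> U)"
    and ps: "\<And>p. p \<in> set ps \<Longrightarrow> 1 \<le> p"
  shows "has_theta E ps"
proof -
  \<comment> \<open>Walk \<open>p\<close> steps greedily inside \<open>U\<close>, then step to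
    \<open>w\<close>, to which every vertex of \<open>U\<close> is adjacent. Each step forbids one
    more vertex, so \<open>k + p\<close> is invariant; both summands start at no more than
    \<open>sum_list ps\<close>, hence the factor 2 in the degree bound.\<close>
  have rob: "robust_path E v w (Suc p) k" if "v \<in> U" "k + p \<le> 2 * sum_list ps" for v p k
    using that
  proof (induction p arbitrary: v k)
    case 0
    then have "E v w" using U E_sym[of w v] by auto
    then show ?case by (rule robust_path_edge)
  next
    case (Suc p)
    show ?case unfolding robust_path_def
    proof (intro allI impI)
      fix Z :: "'a set" assume Z: "finite Z \<and> card Z \<le> k"
      then have "card Z < card (N v \<inter> U)" using deg[of v] Suc.prems by auto
      then obtain y where y: "E v y" "y \<in> U" "y \<notin> Z"
        using exists_avoiding[of Z "N v \<inter> U"] Z by auto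
      have "robust_path E y w (Suc p) (k + 1)" by (rule Suc.IH) (use y Suc.prems in auto)
      moreover have "v \<noteq> y" "y \<noteq> w" "v \<noteq> w"
        using y U Suc.prems E_irrefl N_iff by (metis subsetD)+
      ultimately have "avoiding_path E v w (Suc 0 + Suc p) Z"
        using y Z by (intro avoiding_path_append[where k = "k+1"] avoiding_path_edge) auto
      then show "avoiding_path E v w (Suc (Suc p)) Z" by simp
    qed
  qed
  obtain v where v: "v \<in> U" using U by auto
  then have "v \<noteq> w" using U E_irrefl by (metis N_iff subsetD)
  then show ?thesis
  proof (rule has_theta_robust)
    fix p assume p: "p \<in> set ps"
    then have "p \<le> sum_list ps" by (rule member_le_sum_list) simp
    then show "robust_path E v w p (sum_list ps)" using rob[OF v, of "sum_list ps" "p - 1"] ps[OF p] by simp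
  qed
qed

text \<open>Delete a vertex of degree at most \<open>D\<close>: the degree sum drops by at most
  \<open>2 * D\<close>, since each lost edge is counted at both ends, while the threshold
  \<open>2 * D * card U\<close> drops by exactly \<open>2 * D\<close>. The strict inequality
  persists, so the process stops before the set is empty.\<close>

lemma min_degree_subset:
  assumes "finite U" "2 * D * card U < (\<Sum>x\<in>U. card (N x \<inter> U))"
  shows "\<exists>U'\<subseteq>U. U' \<noteq> {} \<and> (\<forall>x\<in>U'. D < card (N x \<inter> U'))"
  using assms
proof (induction U rule: finite_psubset_induct)
  case (psubset U)
  show ?case
  proof (cases "\<forall>x\<in>U. D < card (N x \<inter> U)")
    case True
    moreover have "U \<noteq> {}" using psubset.prems by auto
    ultimately show ?thesis by blast
  next
    case False
    then obtain x where x: "x \<in> U" "card (N x \<inter> U) \<le> D" by auto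
    let ?W = "U - {x}"
    have *: "card (N y \<inter> U) = card (N y \<inter> ?W) + (if E x y then 1 else 0)" for y
    proof (cases "E x y")
      case True
      then have "N y \<inter> U = insert x (N y \<inter> ?W)" using x E_sym by auto
      then show ?thesis using True by simp
    next
      case False
      then have "N y \<inter> U = N y \<inter> ?W" using E_sym by auto
      then show ?thesis using False by simp
    qed
    have "(\<Sum>y\<in>U. card (N y \<inter> U)) = card (N x \<inter> U) + (\<Sum>y\<in>?W. card (N y \<inter> U))"
      by (rule sum.remove[OF psubset.hyps x(1)])
    also have "(\<Sum>y\<in>?W. card (N y \<inter> U)) = (\<Sum>y\<in>?W. card (N y \<inter> ?W)) + (\<Sum>y\<in>?W. if E x y then 1 else 0)"
      by (subst *) (rule sum.distrib)
    also have "(\<Sum>y\<in>?W. if E x y then 1 else 0) = card (N x \<inter> ?W)"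
      using psubset.hyps by (simp add: sum.If_cases Int_def conj_commute)
    also have "card (N x \<inter> ?W) \<le> card (N x \<inter> U)" by (rule card_mono) auto
    finally have "(\<Sum>y\<in>U. card (N y \<inter> U)) \<le> 2 * D + (\<Sum>y\<in>?W. card (N y \<inter> ?W))" using x by simp
    moreover have "card U = Suc (card ?W)" using psubset.hyps x by (metis card.remove)
    ultimately have "2 * D * card ?W < (\<Sum>y\<in>?W. card (N y \<inter> ?W))"
      using psubset.prems by simp
    then show ?thesis using psubset.IH[of ?W] x by blast
  qed
qed

text \<open>The 4 is a product of two factors 2, one from passing from average to minimum degree and
  one from the minimum degree that \<open>has_theta_neighbourhood_min_degree\<close> asks
  for.\<close>

lemma theta_free_neighbourhood_edges:
  assumes "\<not> has_theta E ps" "\<And>p. p \<in> set ps \<Longrightarrow> 1 \<le> p" "U \<subseteq> N w"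
  shows "card {(x,y) \<in> U \<times> U. E x y} \<le> 4 * sum_list ps * card U"
proof (rule ccontr)
  assume "\<not> ?thesis"
  moreover have fin: "finite U" using assms(3) finN by (rule finite_subset)
  moreover have "{y\<in>U. E x y} = N x \<inter> U" for x by auto
  ultimately have "2 * (2 * sum_list ps) * card U < (\<Sum>x\<in>U. card (N x \<inter> U))"
    using card_pairs_eq_sum[OF fin fin, of E] by simp
  from min_degree_subset[OF fin this] obtain U' where "U' \<subseteq> U" "U' \<noteq> {}"
    "\<forall>x\<in>U'. 2 * sum_list ps < card (N x \<inter> U')" by blast
  then show False using has_theta_neighbourhood_min_degree[of U' w ps] assms by blast
qed

text \<open>Ordered triples, so each triangle occurs six times. This only costs a constant in the
  upper bounds; the lower bounds count a set of triples that represents each of its triangles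
  once.\<close>

definition triangles :: "('a \<times> 'a \<times> 'a) set" where
  "triangles = {(x,y,z). E x y \<and> E x z \<and> E y z}"

lemma triangles_sub: "triangles \<subseteq> V \<times> V \<times> V"
  using E_V E_sym by (auto simp: triangles_def)

lemma fin_triangles: "finite triangles"
  by (rule finite_subset[OF triangles_sub]) (simp add: finV)

end

subsection \<open>Graphs whose edges lie in few triangles\<close>

lemma card_le_fibres:
  assumes "finite T" "finite P" "f ` T \<subseteq> P" "\<And>p. p \<in> P \<Longrightarrow> card {t\<in>T. f t = p} \<le> K"
  shows "card T \<le> K * card P"
proof -
  have "card T \<le> card (\<Union>p\<in>P. {t\<in>T. f t = p})" using assms by (intro card_mono) auto
  also have "\<dots> \<le> (\<Sum>p\<in>P. card {t\<in>T. f t = p})" by (rule card_UN_le[OF assms(2)])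
  also have "\<dots> \<le> (\<Sum>p\<in>P. K)" by (rule sum_mono) (rule assms(4))
  finally show ?thesis by (simp add: mult.commute)
qed

context fin_graph
begin

text \<open>Vertices are classified by their adjacency to a small probe set \<open>S\<close>, into
  at most \<open>2 ^ card S\<close> cells. Adding a vertex \<open>w\<close> to \<open>S\<close>
  splits every cell into the neighbours and the non-neighbours of \<open>w\<close>.\<close>

definition nkey :: "'a set \<Rightarrow> 'a \<Rightarrow> 'a set" where "nkey S x = N x \<inter> S"

definition pkey :: "'a set \<Rightarrow> 'a \<times> 'a \<Rightarrow> 'a set \<times> 'a set" where
  "pkey S p = (nkey S (fst p), nkey S (snd p))"

definition edge_ind :: "'a \<times> 'a \<Rightarrow> real" where "edge_ind p = of_bool (E (fst p) (snd p))"

definition energy :: "'a set \<Rightarrow> real" where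
  "energy S = (\<Sum>p\<in>V \<times> V. cell_avg (V \<times> V) (pkey S) edge_ind p ^ 2)"

lemma cell_pkey: "cell (V \<times> V) (pkey S) (x, y) = cell V (nkey S) x \<times> cell V (nkey S) y"
  by (auto simp: cell_def pkey_def)

text \<open>Any two coordinates of a triangle form an edge and the third is a common neighbour of
  its ends, so each of the three projections has fibres of size at most \<open>K\<close>.\<close>

lemma card_triangles_fibre:
  assumes codeg: "\<And>x y. E x y \<Longrightarrow> card (N x \<inter> N y) \<le> K"
    and T: "T \<subseteq> triangles" and P: "finite P"
    and \<phi>: "\<phi> = (\<lambda>(w,x,y). (w,x)) \<or> \<phi> = (\<lambda>(w,x,y). (w,y)) \<or> \<phi> = (\<lambda>(w,x,y). (x,y))"
    and TP: "\<phi> ` T \<subseteq> P"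
  shows "card T \<le> K * card P"
proof (rule card_le_fibres[OF _ P TP])
  show "finite T" using T fin_triangles by (rule finite_subset)
  fix p assume "p \<in> P"
  obtain a b where p: "p = (a, b)" by (cases p)
  let ?F = "{t\<in>T. \<phi> t = p}"
  show "card ?F \<le> K"
  proof (cases "?F = {}")
    case False
    then have E: "E a b" using T \<phi> p E_sym by (auto simp: triangles_def)
    define g where "g = (if \<phi> = (\<lambda>(w,x,y). (w,x)) then (\<lambda>(w,x,y). y)
       else if \<phi> = (\<lambda>(w,x,y). (w,y)) then (\<lambda>(w,x,y). x) else (\<lambda>(w::'a,x::'a,y::'a). w))"
    have "inj_on g ?F" using \<phi> by (auto simp: inj_on_def g_def p split: if_splits)
    moreover have "g ` ?F \<subseteq> N a \<inter> N b"
      using T \<phi> E_sym by (auto simp: g_def p triangles_def subset_iff split: if_splits)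
    ultimately have "card ?F \<le> card (N a \<inter> N b)" by (intro card_inj_on_le) auto
    then show ?thesis using codeg[OF E] by simp
  next
    case True
    then show ?thesis by (simp only: card.empty)
  qed
qed

lemma sum_pairs_eq_card:
  assumes "finite A" "finite B"
  shows "(\<Sum>p\<in>A \<times> B. edge_ind p) = real (card {(x,y) \<in> A \<times> B. E x y})"
proof -
  have "(\<Sum>p\<in>A \<times> B. edge_ind p) = real (card ((A \<times> B) \<inter> {p. E (fst p) (snd p)}))"
    unfolding edge_ind_def using assms by (subst sum_of_bool_eq) auto
  also have "(A \<times> B) \<inter> {p. E (fst p) (snd p)} = {(x,y) \<in> A \<times> B. E x y}" by auto
  finally show ?thesis .
qed

text \<open>The neighbourhood of a vertex \<open>w\<close> spans few edges.  After discarding atypical triangles, every remaining triangle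
  \<open>(w, x, y)\<close> shows that the neighbourhood of \<open>w\<close> cuts a large but very sparse rectangle out of the dense pair of cells
  of \<open>x\<close> and \<open>y\<close>.  Refining by one such \<open>w\<close> for each of these pairs increases the energy.\<close>

lemma energy_step:
  fixes \<epsilon> :: real and K m :: nat
  defines "n \<equiv> real (card V)" and "\<delta> \<equiv> \<epsilon> / (10 * real K)"
  assumes codeg: "\<And>x y. E x y \<Longrightarrow> card (N x \<inter> N y) \<le> K" and K: "K \<ge> 1"
    and S: "S \<subseteq> V" "card S \<le> m" and \<epsilon>: "\<epsilon> > 0"
    and tri: "\<epsilon> * n ^ 2 \<le> real (card triangles)"
    and large: "real K * n \<le> \<delta> / 2 * (\<delta> ^ 2 * (\<delta> * n / 2 ^ m) ^ 2)"
  shows "\<exists>S'\<subseteq>V. card S' \<le> m + 4 ^ m \<and> energy S + \<delta> ^ 4 / 4 * (\<epsilon> / (2 * real K)) * n ^ 2 \<le> energy S'"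
proof -
  have \<delta>: "\<delta> > 0" using \<epsilon> K by (simp add: \<delta>_def)
  have finS: "finite S" using S(1) finV by (rule finite_subset)
  \<comment> \<open>There are at most \<open>2 ^ m\<close> cells, so the cells smaller than this
    hold at most \<open>\<delta> * n\<close> vertices together.\<close>
  define \<beta> where "\<beta> = \<delta> * n / 2 ^ m"
  have n0: "n \<ge> 0" by (simp add: n_def)
  have \<beta>: "\<beta> \<ge> 0" using \<delta> n0 by (simp add: \<beta>_def)
  define c where "c x = cell V (nkey S) x" for x
  define Ed where "Ed = {p. E (fst p) (snd p)}"
  have Ed: "Ed \<subseteq> V \<times> V" using E_V E_V2 by (auto simp: Ed_def)
  define small where "small = {x\<in>V. real (card (c x)) < \<beta>}"
  have small: "real (card small) \<le> \<delta> * n"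
  proof -
    have "real (card small) \<le> \<beta> * real (card (Pow S))"
      unfolding small_def c_def
      by (rule card_small_cells) (use finV finS \<beta> in \<open>auto simp: nkey_def\<close>)
    also have "\<dots> \<le> \<beta> * 2 ^ m"
      using S(2) \<beta> finS by (intro mult_left_mono) (auto simp: card_Pow)
    finally show ?thesis by (simp add: \<beta>_def)
  qed
  \<comment> \<open>Three kinds of atypical pairs: the second vertex lies in a small cell, the
    neighbourhood of the first is sparse in the cell of the second, or an edge runs between a sparse
    pair of cells. Each kind has at most \<open>\<delta> * n ^ 2\<close> members.\<close>
  define P1 where "P1 = V \<times> small"
  define P3 where "P3 = (SIGMA w:V. {x\<in>N w. real (card (N w \<inter> c x)) < \<delta> * real (card (c x))})"
  define P5 where "P5 = {p\<in>Ed. real (card (Ed \<inter> cell (V \<times> V) (pkey S) p)) < \<delta> * real (card (cell (V \<times> V) (pkey S) p))}"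
  have P1: "real (card P1) \<le> \<delta> * n ^ 2" "finite P1"
    using mult_left_mono[OF small n0] finV
    by (auto simp: P1_def small_def n_def power2_eq_square card_cartesian_product mult.left_commute mult.assoc)
  have P3: "real (card P3) \<le> \<delta> * n ^ 2" "finite P3"
  proof -
    have "real (card P3) = (\<Sum>w\<in>V. real (card {x\<in>N w. real (card (N w \<inter> c x)) < \<delta> * real (card (c x))}))"
      unfolding P3_def using finV by (simp del: N_iff)
    also have "\<dots> \<le> (\<Sum>w\<in>V. \<delta> * n)"
      unfolding c_def n_def by (intro sum_mono card_sparse_cells[OF finV N_sub]) (use \<delta> in auto)
    finally show "real (card P3) \<le> \<delta> * n ^ 2" by (simp add: n_def power2_eq_square mult.left_commute)
    show "finite P3" unfolding P3_def using finV by (auto simp del: N_iff)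
  qed
  have P5: "real (card P5) \<le> \<delta> * n ^ 2" "finite P5"
  proof -
    have "real (card P5) \<le> \<delta> * real (card (V \<times> V))"
      unfolding P5_def by (rule card_sparse_cells) (use finV Ed \<delta> in auto)
    then show "real (card P5) \<le> \<delta> * n ^ 2" by (simp add: n_def power2_eq_square card_cartesian_product)
    show "finite P5" unfolding P5_def using finV Ed by (auto intro: finite_subset)
  qed
  define bad where "bad \<phi> P = {t\<in>triangles. \<phi> t \<in> P}" for \<phi> :: "'a \<times> 'a \<times> 'a \<Rightarrow> 'a \<times> 'a" and P
  have bad: "real (card (bad \<phi> P)) \<le> real K * (\<delta> * n ^ 2)"
    if "\<phi> = (\<lambda>(w,x,y). (w,x)) \<or> \<phi> = (\<lambda>(w,x,y). (w,y)) \<or> \<phi> = (\<lambda>(w,x,y). (x,y))"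
      "real (card P) \<le> \<delta> * n ^ 2" "finite P" for \<phi> P
  proof -
    have "card (bad \<phi> P) \<le> K * card P"
      by (rule card_triangles_fibre[OF codeg _ that(3,1)]) (auto simp: bad_def)
    then have "real (card (bad \<phi> P)) \<le> real K * real (card P)" by (metis of_nat_le_iff of_nat_mult)
    also have "\<dots> \<le> real K * (\<delta> * n ^ 2)" using that(2) by (intro mult_left_mono) auto
    finally show ?thesis .
  qed
  define Bad where "Bad = bad (\<lambda>(w,x,y). (w,x)) P1 \<union> (bad (\<lambda>(w,x,y). (w,y)) P1 \<union>
     (bad (\<lambda>(w,x,y). (w,x)) P3 \<union> (bad (\<lambda>(w,x,y). (w,y)) P3 \<union> bad (\<lambda>(w,x,y). (x,y)) P5)))"
  have Bad: "real (card Bad) \<le> 5 * (real K * (\<delta> * n ^ 2))"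
  proof -
    have "card Bad \<le> card (bad (\<lambda>(w,x,y). (w,x)) P1) + (card (bad (\<lambda>(w,x,y). (w,y)) P1) +
     (card (bad (\<lambda>(w,x,y). (w,x)) P3) + (card (bad (\<lambda>(w,x,y). (w,y)) P3) + card (bad (\<lambda>(w,x,y). (x,y)) P5))))"
      unfolding Bad_def by (intro order_trans[OF card_Un_le] add_left_mono) simp
    then have "real (card Bad) \<le> real (card (bad (\<lambda>(w,x,y). (w,x)) P1)) + (real (card (bad (\<lambda>(w,x,y). (w,y)) P1)) +
     (real (card (bad (\<lambda>(w,x,y). (w,x)) P3)) + (real (card (bad (\<lambda>(w,x,y). (w,y)) P3)) + real (card (bad (\<lambda>(w,x,y). (x,y)) P5)))))"
      by (simp only: of_nat_add[symmetric] of_nat_le_iff)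
    then show ?thesis
      using bad[OF _ P1, of "\<lambda>(w,x,y). (w,x)"] bad[OF _ P1, of "\<lambda>(w,x,y). (w,y)"]
        bad[OF _ P3, of "\<lambda>(w,x,y). (w,x)"] bad[OF _ P3, of "\<lambda>(w,x,y). (w,y)"]
        bad[OF _ P5, of "\<lambda>(w,x,y). (x,y)"] by simp
  qed
  define G where "G = triangles - Bad"
  have "real (card triangles) \<le> real (card G) + real (card Bad)"
  proof -
    have "finite Bad" unfolding Bad_def bad_def using fin_triangles by auto
    moreover have "triangles \<subseteq> G \<union> Bad" by (auto simp: G_def)
    ultimately have "card triangles \<le> card (G \<union> Bad)" using fin_triangles by (intro card_mono) (auto simp: G_def)
    also have "\<dots> \<le> card G + card Bad" by (rule card_Un_le)
    finally show ?thesis by (simp only: of_nat_add[symmetric] of_nat_le_iff)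
  qed
  \<comment> \<open>Five bad families of triangles, as \<open>P1\<close> and \<open>P3\<close> apply
    both to \<open>(w,x)\<close> and to \<open>(w,y)\<close>. The 10 in \<open>\<delta>\<close>
    makes them fill at most half of the assumed \<open>\<epsilon> * n ^ 2\<close> triangles.\<close>
  moreover have "5 * (real K * (\<delta> * n ^ 2)) = \<epsilon> / 2 * n ^ 2" using K by (simp add: \<delta>_def)
  ultimately have G: "\<epsilon> / 2 * n ^ 2 \<le> real (card G)" using tri Bad by linarith
  have G_tri: "G \<subseteq> triangles" by (auto simp: G_def)
  have goodG: "E w x \<and> E w y \<and> E x y \<and> x \<in> V \<and> y \<in> V \<and> w \<in> V \<and> \<beta> \<le> real (card (c x)) \<and> \<beta> \<le> real (card (c y)) \<and>
     \<delta> * real (card (c x)) \<le> real (card (N w \<inter> c x)) \<and> \<delta> * real (card (c y)) \<le> real (card (N w \<inter> c y)) \<and>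
     \<delta> * real (card (c x \<times> c y)) \<le> real (card (Ed \<inter> c x \<times> c y))" if "(w,x,y) \<in> G" for w x y
  proof -
    have t: "(w,x,y) \<in> triangles" using that by (simp add: G_def)
    then have E: "E w x" "E w y" "E x y" "x \<in> V" "y \<in> V" "w \<in> V"
      using E_V by (auto simp: triangles_def dest: E_sym)
    have "(w,x) \<notin> P1" "(w,y) \<notin> P1" "(w,x) \<notin> P3" "(w,y) \<notin> P3" "(x,y) \<notin> P5"
      using that t by (auto simp: G_def Bad_def bad_def)
    then show ?thesis using E by (auto simp: P1_def P3_def P5_def small_def Ed_def cell_pkey c_def not_less)
  qed
  define Q where "Q = (\<lambda>(w,x,y). (x,y)) ` G"
  have QV: "Q \<subseteq> V \<times> V" using goodG by (auto simp: Q_def)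
  then have finQ: "finite Q" using finV by (auto intro: finite_subset)
  have "card G \<le> K * card Q" by (rule card_triangles_fibre[OF codeg G_tri finQ, where \<phi> = "\<lambda>(w,x,y). (x,y)"]) (auto simp: Q_def)
  then have "real (card G) \<le> real K * real (card Q)" by (metis of_nat_le_iff of_nat_mult)
  with G have "\<epsilon> / 2 * n ^ 2 \<le> real K * real (card Q)" by simp
  then have Q: "\<epsilon> / (2 * real K) * n ^ 2 \<le> real (card Q)" using K by (simp add: field_simps)
  define C where "C = pkey S ` Q"
  have C_sub: "C \<subseteq> Pow S \<times> Pow S" by (auto simp: C_def pkey_def nkey_def)
  have finC: "finite C" using finQ by (simp add: C_def)
  have "\<forall>k\<in>C. \<exists>w x y. (w,x,y) \<in> G \<and> pkey S (x,y) = k" by (auto simp: C_def Q_def) force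
  \<comment> \<open>One good triangle for each pair of cells; its vertex \<open>W k\<close> is the
    probe that exposes the irregularity of that pair.\<close>
  then obtain W X Y where WXY: "\<And>k. k \<in> C \<Longrightarrow> (W k, X k, Y k) \<in> G \<and> pkey S (X k, Y k) = k" by metis
  define S' where "S' = S \<union> W ` C"
  have S'V: "S' \<subseteq> V" using S(1) WXY goodG by (force simp: S'_def)
  have cardS': "card S' \<le> m + 4 ^ m"
  proof -
    have "card C \<le> card (Pow S \<times> Pow S)" by (rule card_mono) (use C_sub finS in auto)
    also have "\<dots> = 2 ^ card S * 2 ^ card S" using finS by (simp add: card_cartesian_product card_Pow)
    also have "\<dots> = 4 ^ card S" by (simp add: power_mult_distrib[symmetric])
    also have "\<dots> \<le> 4 ^ m" using S(2) by (intro power_increasing) auto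
    finally have "card (W ` C) \<le> 4 ^ m" using card_image_le[OF finC, of W] by simp
    then show ?thesis using card_Un_le[of S "W ` C"] S(2) by (simp add: S'_def)
  qed
  let ?d = "cell_avg (V \<times> V) (pkey S) edge_ind" and ?d' = "cell_avg (V \<times> V) (pkey S') edge_ind"
  define fib where "fib k = {p\<in>V \<times> V. pkey S p = k}" for k
  have fin_fib: "finite (fib k)" for k using finV by (simp add: fib_def)
  have local: "\<delta> ^ 4 / 4 * real (card (fib k)) \<le> (\<Sum>p\<in>fib k. (?d' p - ?d p) ^ 2)" if k: "k \<in> C" for k
  proof -
    define w where "w = W k"
    have w: "w \<in> S'" using k by (simp add: w_def S'_def)
    note good = goodG[OF conjunct1[OF WXY[OF k]], folded w_def]
    have key: "pkey S (X k, Y k) = k" using WXY[OF k] by simp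
    define A where "A = c (X k)"
    define B where "B = c (Y k)"
    have fib: "fib k = A \<times> B"
      using cell_pkey[of S "X k" "Y k"] key by (simp add: fib_def A_def B_def c_def cell_def)
    have finAB: "finite A" "finite B" using finV by (auto simp: A_def B_def c_def cell_def)
    define R where "R = (N w \<inter> A) \<times> (N w \<inter> B)"
    have RV: "R \<subseteq> V \<times> V" using N_sub by (auto simp: R_def)
    have finR: "finite R" by (simp add: R_def)
    have cR: "\<delta> ^ 2 * real (card (A \<times> B)) \<le> real (card R)"
    proof -
      have "(\<delta> * real (card A)) * (\<delta> * real (card B)) \<le> real (card (N w \<inter> A)) * real (card (N w \<inter> B))"
        using good \<delta> by (intro mult_mono) (auto simp: A_def B_def)
      then show ?thesis by (simp add: R_def card_cartesian_product power2_eq_square algebra_simps)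
    qed
    have "\<beta> ^ 2 \<le> real (card (A \<times> B))"
      using good \<beta> mult_mono[of \<beta> "real (card A)" \<beta> "real (card B)"]
      by (simp add: A_def B_def card_cartesian_product power2_eq_square)
    then have "\<delta> ^ 2 * \<beta> ^ 2 \<le> real (card R)" using cR \<delta> by (meson mult_left_mono order_trans zero_le_power2)
    then have "\<delta> / 2 * (\<delta> ^ 2 * \<beta> ^ 2) \<le> \<delta> / 2 * real (card R)" using \<delta> by (intro mult_left_mono) auto
    then have KR: "real K * n \<le> \<delta> / 2 * real (card R)" using large by (simp add: \<beta>_def)
    have "(\<Sum>p\<in>R. edge_ind p) = real (card {(x,y) \<in> (N w \<inter> A) \<times> (N w \<inter> B). E x y})"
      unfolding R_def by (rule sum_pairs_eq_card) auto
    also have "\<dots> \<le> real (card {(x,y) \<in> N w \<times> N w. E x y})"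
      by (intro of_nat_mono card_mono finite_subset[of "{(x,y) \<in> N w \<times> N w. E x y}" "N w \<times> N w"]) auto
    also have "\<dots> = (\<Sum>x\<in>N w. real (card {y\<in>N w. E x y}))"
      by (subst card_pairs_eq_sum) auto
    also have "\<dots> \<le> (\<Sum>x\<in>N w. real K)"
    proof (rule sum_mono)
      fix x assume x: "x \<in> N w"
      have "{y\<in>N w. E x y} = N w \<inter> N x" by auto
      then show "real (card {y\<in>N w. E x y}) \<le> real K" using codeg[of w x] x by simp
    qed
    also have "\<dots> \<le> real K * n"
      using card_mono[OF finV N_sub[of w]] by (simp add: n_def mult.commute mult_left_mono)
    finally have fR: "(\<Sum>p\<in>R. edge_ind p) \<le> \<delta> / 2 * real (card R)" using KR by simp
    \<comment> \<open>\<open>R\<close> is a union of cells of the refined partition, since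
      \<open>w\<close> belongs to \<open>S'\<close>; \<open>g\<close> expresses its indicator
      through the new key, from which intersection with \<open>S\<close> recovers the old one. Hence
      the new averages have the same sum over \<open>R\<close> as the edge indicator, while the old
      averages are at least \<open>\<delta>\<close> there.\<close>
    define g where "g q = (of_bool ((fst q \<inter> S, snd q \<inter> S) = k \<and> w \<in> fst q \<and> w \<in> snd q) :: real)" for q
    have g: "g (pkey S' p) = of_bool (p \<in> R)" if p: "p \<in> V \<times> V" for p
    proof -
      have "N z \<inter> S' \<inter> S = N z \<inter> S" for z by (auto simp: S'_def)
      moreover have "p \<in> R \<longleftrightarrow> pkey S p = k \<and> E w (fst p) \<and> E w (snd p)"
        using fib p by (cases p) (auto simp: R_def fib_def)
      ultimately show ?thesis using w E_sym by (auto simp: g_def pkey_def nkey_def)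
    qed
    have sumR: "(\<Sum>p\<in>V \<times> V. h p * g (pkey S' p)) = (\<Sum>p\<in>R. h p)" for h :: "'a \<times> 'a \<Rightarrow> real"
    proof -
      have "(\<Sum>p\<in>V \<times> V. h p * g (pkey S' p)) = (\<Sum>p\<in>V \<times> V. if p \<in> R then h p else 0)"
        by (rule sum.cong) (simp_all add: g)
      also have "\<dots> = (\<Sum>p\<in>R. h p)" using finV RV by (simp add: sum.inter_restrict[symmetric] Int_absorb1)
      finally show ?thesis .
    qed
    have d'R: "(\<Sum>p\<in>R. ?d' p) = (\<Sum>p\<in>R. edge_ind p)"
      using sum_cell_avg[of "V \<times> V" "pkey S'" edge_ind g] finV by (simp add: sumR)
    have dR: "\<delta> \<le> ?d p" if "p \<in> R" for p
    proof -
      have "pkey S p = k" using that fib by (auto simp: R_def fib_def)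
      then have "?d p = ?d (X k, Y k)" using key by (intro cell_avg_cong) simp
      also have "\<dots> = real (card (Ed \<inter> A \<times> B)) / real (card (A \<times> B))"
      proof -
        have "(\<Sum>q\<in>A \<times> B. edge_ind q) = real (card (Ed \<inter> A \<times> B))"
          unfolding edge_ind_def Ed_def using finAB by (subst sum_of_bool_eq) (auto simp: Int_commute)
        then show ?thesis by (simp add: cell_avg_def cell_pkey A_def B_def c_def)
      qed
      also have "\<dots> \<ge> \<delta>"
      proof -
        have "X k \<in> A" "Y k \<in> B" using good by (auto simp: A_def B_def c_def cell_def)
        then have "card (A \<times> B) > 0" using finAB by (auto simp: card_gt_0_iff)
        then show ?thesis using good by (simp add: A_def B_def pos_le_divide_eq)
      qed
      finally show ?thesis .
    qed
    \<comment> \<open>On \<open>R\<close> the density falls by at least \<open>\<delta> / 2\<close>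
      on average. The inequality \<open>\<delta> * t - \<delta> ^ 2 / 4 \<le> t ^ 2\<close>, summed
      over \<open>R\<close>, turns this linear gain into a gain of squares.\<close>
    have "\<delta> ^ 4 / 4 * real (card (fib k)) = \<delta> ^ 2 / 4 * (\<delta> ^ 2 * real (card (A \<times> B)))"
      by (simp add: fib power4_eq_xxxx power2_eq_square)
    also have "\<dots> \<le> \<delta> ^ 2 / 4 * real (card R)" using cR by (intro mult_left_mono) auto
    also have "\<dots> = \<delta> * (\<delta> * real (card R) - \<delta> / 2 * real (card R)) - \<delta> ^ 2 / 4 * real (card R)"
      by (simp add: power2_eq_square algebra_simps)
    also have "\<dots> \<le> \<delta> * ((\<Sum>p\<in>R. ?d p) - (\<Sum>p\<in>R. ?d' p)) - \<delta> ^ 2 / 4 * real (card R)"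
    proof -
      have "\<delta> * real (card R) \<le> (\<Sum>p\<in>R. ?d p)" using sum_mono[of R "\<lambda>_. \<delta>" ?d] dR by (simp add: mult.commute)
      then show ?thesis using fR d'R \<delta> by (intro diff_right_mono mult_left_mono diff_mono) auto
    qed
    also have "\<dots> = (\<Sum>p\<in>R. \<delta> * (?d p - ?d' p) - \<delta> ^ 2 / 4)"
      by (simp add: sum_subtractf sum_distrib_left[symmetric])
    also have "\<dots> \<le> (\<Sum>p\<in>R. (?d' p - ?d p) ^ 2)"
    proof (rule sum_mono)
      fix p
      have "0 \<le> ((?d p - ?d' p) - \<delta> / 2) ^ 2" by simp
      then show "\<delta> * (?d p - ?d' p) - \<delta> ^ 2 / 4 \<le> (?d' p - ?d p) ^ 2"
        by (simp add: power2_eq_square algebra_simps)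
    qed
    also have "\<dots> \<le> (\<Sum>p\<in>fib k. (?d' p - ?d p) ^ 2)"
      by (rule sum_mono2[OF fin_fib]) (auto simp: R_def fib)
    finally show ?thesis .
  qed
  have disj: "\<forall>k\<in>C. \<forall>k'\<in>C. k \<noteq> k' \<longrightarrow> fib k \<inter> fib k' = {}" by (auto simp: fib_def)
  have "\<delta> ^ 4 / 4 * (\<epsilon> / (2 * real K)) * n ^ 2 \<le> \<delta> ^ 4 / 4 * real (card Q)"
    using mult_left_mono[OF Q, of "\<delta> ^ 4 / 4"] by (simp add: mult.assoc)
  also have "\<dots> \<le> \<delta> ^ 4 / 4 * real (card (\<Union>k\<in>C. fib k))"
  proof -
    have "Q \<subseteq> (\<Union>k\<in>C. fib k)" using QV by (auto simp: C_def fib_def)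
    then show ?thesis using finC fin_fib by (intro mult_left_mono of_nat_mono card_mono) auto
  qed
  also have "\<dots> = (\<Sum>k\<in>C. \<delta> ^ 4 / 4 * real (card (fib k)))"
    using card_UN_disjoint[OF finC _ disj] fin_fib by (simp add: sum_distrib_left)
  also have "\<dots> \<le> (\<Sum>k\<in>C. \<Sum>p\<in>fib k. (?d' p - ?d p) ^ 2)" by (rule sum_mono) (rule local)
  also have "\<dots> = (\<Sum>p\<in>(\<Union>k\<in>C. fib k). (?d' p - ?d p) ^ 2)"
    by (rule sum.UNION_disjoint[symmetric]) (use finC fin_fib disj in auto)
  also have "\<dots> \<le> (\<Sum>p\<in>V \<times> V. (?d' p - ?d p) ^ 2)"
    by (rule sum_mono2) (use finV in \<open>auto simp: fib_def\<close>)
  also have "\<dots> = energy S' - energy S"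
    unfolding energy_def
  proof (rule energy_increment[symmetric])
    fix p
    have "N z \<inter> S' \<inter> S = N z \<inter> S" for z by (auto simp: S'_def)
    then show "pkey S p = (\<lambda>(a,b). (a \<inter> S, b \<inter> S)) (pkey S' p)" by (simp add: pkey_def nkey_def)
  qed (use finV in simp)
  finally show ?thesis using S'V cardS' by (intro exI[of _ S']) auto
qed

end

text \<open>The energy lies between 0 and the square of \<open>card V\<close>, and each application
  of \<open>energy_step\<close> adds the fixed share \<open>\<gamma>\<close> of that square, so more
  than \<open>1 / \<gamma>\<close> applications are impossible. \<open>m j\<close> bounds the probe
  set after \<open>j\<close> steps and grows like a tower of exponentials; \<open>n0\<close> is
  chosen for \<open>m J\<close>, the largest of these bounds.\<close>

theorem few_triangles_if_bounded_codegree: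
  fixes \<epsilon> :: real and K :: nat
  assumes \<epsilon>: "\<epsilon> > 0"
  shows "\<exists>n0. \<forall>(V::'a set) E. fin_graph V E \<and> n0 \<le> card V \<and>
     (\<forall>x y. E x y \<longrightarrow> card (fin_graph.N E x \<inter> fin_graph.N E y) \<le> K) \<longrightarrow>
     real (card (fin_graph.triangles E)) \<le> \<epsilon> * real (card V) ^ 2"
proof -
  define K' where "K' = max 1 K"
  define \<delta> where "\<delta> = \<epsilon> / (10 * real K')"
  define \<gamma> where "\<gamma> = \<delta> ^ 4 / 4 * (\<epsilon> / (2 * real K'))"
  define J where "J = nat \<lceil>1 / \<gamma>\<rceil> + 1"
  define m where "m = rec_nat 0 (\<lambda>_ a::nat. a + 4 ^ a)"
  have K': "K' \<ge> 1" "K \<le> K'" by (auto simp: K'_def)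
  have \<delta>: "\<delta> > 0" and \<gamma>: "\<gamma> > 0" using \<epsilon> K' by (auto simp: \<delta>_def \<gamma>_def)
  have m0: "m 0 = 0" and mSuc: "m (Suc j) = m j + 4 ^ m j" for j by (simp_all add: m_def)
  have mono: "mono m" by (rule incseq_SucI) (simp add: mSuc)
  define b where "b = \<delta> / 2 * (\<delta> ^ 2 * (\<delta> / 2 ^ m J) ^ 2)"
  have b: "b > 0" using \<delta> by (simp add: b_def)
  define n0 where "n0 = nat \<lceil>real K' / b\<rceil> + 1"
  show ?thesis
  proof (rule exI[of _ n0], intro allI impI, elim conjE, rule ccontr)
    fix V :: "'a set" and E
    assume gr: "fin_graph V E" and n: "n0 \<le> card V"
      and codeg: "\<forall>x y. E x y \<longrightarrow> card (fin_graph.N E x \<inter> fin_graph.N E y) \<le> K"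
      and tri: "\<not> real (card (fin_graph.triangles E)) \<le> \<epsilon> * real (card V) ^ 2"
    interpret fin_graph V E by (rule gr)
    let ?n = "real (card V)"
    have npos: "?n > 0" using n by (simp add: n0_def)
    have "real K' / b \<le> ?n" using n unfolding n0_def by linarith
    then have "real K' \<le> b * ?n" using b by (simp add: field_simps)
    then have large0: "real K' * ?n \<le> \<delta> / 2 * (\<delta> ^ 2 * (\<delta> * ?n / 2 ^ m J) ^ 2)"
      using mult_right_mono[of "real K'" "b * ?n" ?n] npos
      by (simp add: b_def power2_eq_square algebra_simps)
    have large: "real K' * ?n \<le> \<delta> / 2 * (\<delta> ^ 2 * (\<delta> * ?n / 2 ^ m j) ^ 2)" if "j \<le> J" for j
    proof -
      have "(2::real) ^ m j \<le> 2 ^ m J" using that mono by (intro power_increasing) (auto dest: monoD)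
      then have "\<delta> * ?n / 2 ^ m J \<le> \<delta> * ?n / 2 ^ m j" using \<delta> by (intro divide_left_mono) auto
      then have "\<delta> / 2 * (\<delta> ^ 2 * (\<delta> * ?n / 2 ^ m J) ^ 2) \<le> \<delta> / 2 * (\<delta> ^ 2 * (\<delta> * ?n / 2 ^ m j) ^ 2)"
        using \<delta> by (intro mult_left_mono power_mono) auto
      with large0 show ?thesis by simp
    qed
    have "\<exists>S\<subseteq>V. card S \<le> m j \<and> real j * (\<gamma> * ?n ^ 2) \<le> energy S" if "j \<le> J" for j
      using that
    proof (induction j)
      case 0
      then show ?case by (intro exI[of _ "{}"]) (auto simp: energy_def intro!: sum_nonneg)
    next
      case (Suc j)
      then obtain S where S: "S \<subseteq> V" "card S \<le> m j" "real j * (\<gamma> * ?n ^ 2) \<le> energy S" by auto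
      have "\<exists>S'\<subseteq>V. card S' \<le> m j + 4 ^ m j \<and>
         energy S + (\<epsilon> / (10 * real K')) ^ 4 / 4 * (\<epsilon> / (2 * real K')) * ?n ^ 2 \<le> energy S'"
      proof (rule energy_step)
        show "card (N x \<inter> N y) \<le> K'" if "E x y" for x y
          using codeg K'(2) that by (meson order_trans)
        show "real K' * ?n \<le> \<epsilon> / (10 * real K') / 2 *
          ((\<epsilon> / (10 * real K')) ^ 2 * (\<epsilon> / (10 * real K') * ?n / 2 ^ m j) ^ 2)"
          using large[of j] Suc.prems by (simp add: \<delta>_def)
      qed (use S K' \<epsilon> tri in auto)
      then obtain S' where "S' \<subseteq> V" "card S' \<le> m (Suc j)" "energy S + \<gamma> * ?n ^ 2 \<le> energy S'"
        by (auto simp: mSuc \<gamma>_def \<delta>_def)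
      then show ?case using S(3) by (intro exI[of _ S']) (auto simp: algebra_simps)
    qed
    from this[of J] obtain S where "real J * (\<gamma> * ?n ^ 2) \<le> energy S" by auto
    also have "energy S \<le> ?n ^ 2"
      using energy_le[of "V \<times> V" edge_ind "pkey S"]
      by (simp add: energy_def edge_ind_def card_cartesian_product power2_eq_square)
    finally have "(real J * \<gamma>) * ?n ^ 2 \<le> 1 * ?n ^ 2" by simp
    then have "real J * \<gamma> \<le> 1" using npos by (simp add: mult_le_cancel_right)
    moreover have "real J > 1 / \<gamma>" unfolding J_def by linarith
    ultimately show False using \<gamma> by (simp add: field_simps)
  qed
qed

subsection \<open>Bicliques whose edges lie in triangles\<close>

context fin_graph
begin

text \<open>A detour of length 2 from \<open>a\<close> into \<open>B\<close> that survives the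
  deletion of \<open>k\<close> vertices. For \<open>a\<close> in the other side of a biclique it
  replaces an edge and thereby changes the parity of an alternating path.\<close>

definition apex_rich :: "'a set \<Rightarrow> 'a \<Rightarrow> nat \<Rightarrow> bool" where
  "apex_rich B a k \<longleftrightarrow> (\<forall>Z. finite Z \<and> card Z \<le> k \<longrightarrow> (\<exists>b\<in>B - Z. \<exists>t. t \<notin> Z \<and> E a t \<and> E b t))"

lemma apex_richD:
  assumes "apex_rich B a k" "finite Z" "card Z \<le> k"
  obtains b t where "b \<in> B" "b \<notin> Z" "t \<notin> Z" "E a t" "E b t"
  using assms unfolding apex_rich_def by blast

lemma not_apex_richD:
  assumes "\<not> apex_rich B a k"
  shows "\<exists>Z. finite Z \<and> card Z \<le> k \<and> (\<forall>b\<in>B - Z. \<forall>t. E a t \<and> E b t \<longrightarrow> t \<in> Z)"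
proof -
  obtain Z where "finite Z \<and> card Z \<le> k" "\<not> (\<exists>b\<in>B - Z. \<exists>t. t \<notin> Z \<and> E a t \<and> E b t)"
    using assms unfolding apex_rich_def by (simp only: not_all not_imp) blast
  then show ?thesis by (intro exI[of _ Z]) auto
qed

lemma apex_rich_odd:
  assumes bi: "biclique A B s" and a: "a \<in> A" "a' \<in> A" "a \<noteq> a'" and rich: "apex_rich B a (k + 2)"
    and s: "k + 2 * j + 4 < s"
  shows "robust_path E a a' (2 * j + 3) k"
  unfolding robust_path_def
proof (intro allI impI)
  fix Z :: "'a set" assume Z: "finite Z \<and> card Z \<le> k"
  then have "card (insert a (insert a' Z)) \<le> k + 2" by (auto simp: card_insert_if)
  then obtain b t where bt: "b \<in> B" "b \<notin> insert a (insert a' Z)" "t \<notin> insert a (insert a' Z)" "E a t" "E b t"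
    using apex_richD[OF rich, of "insert a (insert a' Z)"] Z by auto
  have "avoiding_path E a b 2 (insert a' Z)"
    using bt E_ne[of b t] E_sym by (intro avoiding_path_two[of E a t b]) auto
  moreover have "robust_path E b a' (2 * j + 1) (k + 2)"
    by (rule biclique_odd[OF biclique_sym[OF bi]]) (use bt a s in auto)
  ultimately have "avoiding_path E a a' (2 + (2 * j + 1)) Z"
    by (rule avoiding_path_append) (use Z bt a in auto)
  then show "avoiding_path E a a' (2 * j + 3) Z" by (simp add: numeral_3_eq_3)
qed

text \<open>The detour is followed by an even path between two vertices of \<open>B\<close>, of
  length at least 2. So the shortest even length obtained across the biclique is 4, and a path of
  length 2 has to come from elsewhere.\<close>

lemma apex_rich_even:
  assumes bi: "biclique A B s" and a: "a \<in> A" "b' \<in> B" and rich: "apex_rich B a (k + 2)"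
    and s: "k + 2 * j + 4 < s"
  shows "robust_path E a b' (2 * j + 4) k"
  unfolding robust_path_def
proof (intro allI impI)
  fix Z :: "'a set" assume Z: "finite Z \<and> card Z \<le> k"
  have ab': "a \<noteq> b'" using bi a E_irrefl by (auto simp: biclique_def)
  have "card (insert a (insert b' Z)) \<le> k + 2" using Z by (auto simp: card_insert_if)
  then obtain b t where bt: "b \<in> B" "b \<notin> insert a (insert b' Z)" "t \<notin> insert a (insert b' Z)" "E a t" "E b t"
    using apex_richD[OF rich, of "insert a (insert b' Z)"] Z by auto
  have "avoiding_path E a b 2 (insert b' Z)"
    using bt E_ne[of b t] E_sym by (intro avoiding_path_two[of E a t b]) auto
  moreover have "robust_path E b b' (2 * j + 2) (k + 2)"
    by (rule biclique_even[OF biclique_sym[OF bi]]) (use bt a s in auto)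
  ultimately have "avoiding_path E a b' (2 + (2 * j + 2)) Z"
    by (rule avoiding_path_append) (use Z bt a ab' in auto)
  then show "avoiding_path E a b' (2 * j + 4) Z" by (simp add: numeral_eq_Suc)
qed

text \<open>Without a path of length 1 both ends are taken in \<open>A\<close>: even lengths
  alternate, odd lengths from 3 on use the detour. With one, the ends are the vertices of an edge
  \<open>ab\<close> across the biclique: odd lengths alternate, even lengths from 4 on use the
  detour, and length 2 is served once, by the third vertex of a triangle on \<open>ab\<close>. This
  is where a second triangle would break the argument.\<close>

lemma has_theta_apex_rich:
  assumes bi: "biclique A B s" and a: "a \<in> A" and rich: "apex_rich B a (sum_list ps + 2)"
    and s: "2 * sum_list ps + 2 < s"
    and ps: "\<And>p. p \<in> set ps \<Longrightarrow> 1 \<le> p" and tri: "1 \<notin> set ps \<or> count_list ps 2 \<le> 1"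
  shows "has_theta E ps"
proof -
  let ?k = "sum_list ps"
  have le: "p \<le> ?k" if "p \<in> set ps" for p using that by (rule member_le_sum_list) simp
  show ?thesis
  proof (cases "1 \<in> set ps")
    case False
    have "card {a} < card A" using bi s by (auto simp: biclique_def)
    then obtain a' where a': "a' \<in> A" "a \<noteq> a'" using exists_avoiding[of "{a}" A] by auto
    show ?thesis
    proof (rule has_theta_robust[OF a'(2)])
      fix p assume p: "p \<in> set ps"
      then have p2: "p \<ge> 2" using ps[OF p] False by (cases "p = 1") auto
      show "robust_path E a a' p ?k"
      proof (cases "even p")
        case True
        define j where "j = (p - 2) div 2"
        have j: "p = 2 * j + 2" using True p2 by (auto simp: j_def)
        show ?thesis unfolding j
          by (rule biclique_even[OF bi]) (use a a' s le[OF p] j in auto)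
      next
        case False
        define j where "j = (p - 3) div 2"
        have "p \<noteq> 2" using False by auto
        then have j: "p = 2 * j + 3" using False p2 by (auto simp: j_def elim!: oddE)
        show ?thesis unfolding j
          by (rule apex_rich_odd[OF bi]) (use a a' s le[OF p] j rich in auto)
      qed
    qed
  next
    case True
    obtain b t where bt: "b \<in> B" "t \<noteq> b" "E a t" "E b t"
      using apex_richD[OF rich, of "{}"] E_ne by (metis card.empty finite.emptyI le0)
    have ab: "E a b" "a \<noteq> b" using bi a bt E_irrefl by (auto simp: biclique_def)
    have rob: "robust_path E a b p ?k" if p: "p \<in> set ps" "p \<noteq> 2" for p
    proof (cases "even p")
      case True
      define j where "j = (p - 4) div 2"
      have j: "p = 2 * j + 4" using True p ps[OF p(1)] by (auto simp: j_def elim!: evenE)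
      show ?thesis unfolding j
        by (rule apex_rich_even[OF bi]) (use a bt s le[OF p(1)] j rich in auto)
    next
      case False
      define j where "j = p div 2"
      have j: "p = 2 * j + 1" using False by (auto simp: j_def)
      show ?thesis unfolding j
        by (rule biclique_odd[OF bi]) (use a bt s le[OF p(1)] j in auto)
    qed
    show ?thesis
    proof (cases "2 \<in> set ps")
      case False
      then show ?thesis using rob by (intro has_theta_robust[OF ab(2)]) (metis)
    next
      case True
      then obtain i where i: "i < length ps" "ps ! i = 2" by (auto simp: in_set_conv_nth)
      have uniq: "ps ! j \<noteq> 2" if "j < length ps" "j \<noteq> i" for j
      proof
        assume "ps ! j = 2"
        then have "{i, j} \<subseteq> {x. x < length ps \<and> ps ! x = 2}" using that i by auto
        then have "card {i, j} \<le> count_list ps 2"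
          unfolding count_list_eq_length_filter length_filter_conv_card
          by (intro card_mono) (auto simp: eq_commute)
        then show False using that tri \<open>1 \<in> set ps\<close> by auto
      qed
      have "avoiding_path E a b (ps ! i) {}"
        unfolding i(2) using bt E_ne[OF bt(3)] E_sym[OF bt(4)] by (intro avoiding_path_two[of E a t b]) auto
      then show ?thesis
        by (rule has_theta_robust_except[OF ab(2) i(1)]) (use rob uniq in auto)
    qed
  qed
qed

text \<open>If no vertex of a large biclique is apex rich, then the third vertices of the triangles on
  its edges are confined to bounded sets, and by pigeonhole one of them is joined to
  a whole sub-biclique.\<close>

lemma common_apex:
  fixes k r :: nat
  defines "M \<equiv> k + r * k + 1"
  defines "s \<equiv> M * k + r * (M * k * 2 ^ M) + M + 1"
  assumes bi: "biclique A B s" and tri: "\<And>a b. a \<in> A \<Longrightarrow> b \<in> B \<Longrightarrow> \<exists>t. E a t \<and> E b t"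
    and no: "\<And>a. a \<in> A \<Longrightarrow> \<not> apex_rich B a k" "\<And>b. b \<in> B \<Longrightarrow> \<not> apex_rich A b k"
  shows "\<exists>z A' B'. A' \<subseteq> A \<and> B' \<subseteq> B \<and> card A' = r \<and> card B' = r \<and> (\<forall>x\<in>A' \<union> B'. E z x)"
proof -
  have fin: "finite A" "finite B" and cA: "s \<le> card A" and cB: "s \<le> card B"
    using bi by (auto simp: biclique_def)
  have "\<forall>a\<in>A. \<exists>Z. finite Z \<and> card Z \<le> k \<and> (\<forall>b\<in>B - Z. \<forall>t. E a t \<and> E b t \<longrightarrow> t \<in> Z)"
    using no(1) not_apex_richD by simp
  then obtain ZA where ZA: "\<And>a. a \<in> A \<Longrightarrow> finite (ZA a) \<and> card (ZA a) \<le> k \<and>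
      (\<forall>b\<in>B - ZA a. \<forall>t. E a t \<and> E b t \<longrightarrow> t \<in> ZA a)" by metis
  have "\<forall>b\<in>B. \<exists>Z. finite Z \<and> card Z \<le> k \<and> (\<forall>a\<in>A - Z. \<forall>t. E b t \<and> E a t \<longrightarrow> t \<in> Z)"
    using no(2) not_apex_richD by simp
  then obtain ZB where ZB: "\<And>b. b \<in> B \<Longrightarrow> finite (ZB b) \<and> card (ZB b) \<le> k \<and>
      (\<forall>a\<in>A - ZB b. \<forall>t. E b t \<and> E a t \<longrightarrow> t \<in> ZB b)" by metis
  \<comment> \<open>A fixed sample \<open>B0\<close> makes \<open>Z\<close> a set of bounded size
    common to all \<open>a\<close>: for \<open>a\<close> outside \<open>Z\<close>, third vertices on
    edges from \<open>a\<close> to \<open>B0 - ZA a\<close> lie both in \<open>Z\<close> and in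
    \<open>ZA a\<close>, which has at most \<open>k\<close> elements.\<close>
  obtain B0 where B0: "B0 \<subseteq> B" "card B0 = M"
    using obtain_subset_with_card_n[of M B] cB by (auto simp: s_def)
  have finB0: "finite B0" using B0(1) fin(2) by (rule finite_subset)
  define Z where "Z = (\<Union>b\<in>B0. ZB b)"
  have finZ: "finite Z" using finB0 B0 ZB by (auto simp: Z_def)
  have "card Z \<le> (\<Sum>b\<in>B0. card (ZB b))" unfolding Z_def by (rule card_UN_le[OF finB0])
  also have "\<dots> \<le> (\<Sum>b\<in>B0. k)" by (rule sum_mono) (use B0 ZB in auto)
  finally have cZ: "card Z \<le> M * k" by (simp add: B0)
  define A1 where "A1 = A - Z"
  have "card A - card Z \<le> card A1" unfolding A1_def by (rule diff_card_le_card_Diff[OF finZ])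
  then have cA1: "r * (M * k * 2 ^ M) < card A1" using cA cZ by (simp add: s_def)
  have finA1: "finite A1" using fin by (simp add: A1_def)
  have "\<exists>q. fst q \<in> Z \<and> snd q \<subseteq> B0 \<and> r \<le> card (snd q) \<and> E (fst q) a \<and> (\<forall>b\<in>snd q. E (fst q) b)"
    if a: "a \<in> A1" for a
  proof -
    have aA: "a \<in> A" "a \<notin> Z" using a by (auto simp: A1_def)
    have "\<forall>b\<in>B0. \<exists>t. E a t \<and> E b t" using tri aA B0 by blast
    then obtain t where t: "\<And>b. b \<in> B0 \<Longrightarrow> E a (t b) \<and> E b (t b)" by metis
    have tZ: "t b \<in> ZA a \<inter> Z" if "b \<in> B0 - ZA a" for b
      using ZA[OF aA(1)] ZB[of b] t[of b] that aA B0 by (auto simp: Z_def)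
    \<comment> \<open>Here \<open>M\<close> being \<open>k + r * k + 1\<close> enters: after
      removing the at most \<open>k\<close> vertices of \<open>ZA a\<close>, more than
      \<open>r * k\<close> vertices of \<open>B0\<close> compete for at most \<open>k\<close> values
      of \<open>t\<close>.\<close>
    have "\<exists>z\<in>ZA a \<inter> Z. r < card {b\<in>B0 - ZA a. t b = z}"
    proof (rule ccontr)
      assume "\<not> ?thesis"
      then have "card (B0 - ZA a) \<le> r * card (ZA a \<inter> Z)"
        using finB0 finZ tZ by (intro card_le_fibres[where f = t]) (auto simp: not_less)
      also have "\<dots> \<le> r * k"
        using ZA[OF aA(1)] card_mono[of "ZA a" "ZA a \<inter> Z"] by (intro mult_left_mono) auto
      finally have "card (B0 - ZA a) \<le> r * k" .
      moreover have "card B0 - card (ZA a) \<le> card (B0 - ZA a)"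
        using ZA[OF aA(1)] by (intro diff_card_le_card_Diff) auto
      moreover have "card (ZA a) \<le> k" using ZA[OF aA(1)] by simp
      ultimately show False using B0(2) unfolding M_def by linarith
    qed
    then obtain z where z: "z \<in> ZA a \<inter> Z" "r < card {b\<in>B0 - ZA a. t b = z}" by auto
    then have "{b\<in>B0 - ZA a. t b = z} \<noteq> {}" by (metis card.empty not_less0)
    then have "E z a" using t E_sym by auto
    then show ?thesis using z t E_sym
      by (intro exI[of _ "(z, {b\<in>B0 - ZA a. t b = z})"]) auto
  qed
  then obtain g where g: "\<And>a. a \<in> A1 \<Longrightarrow> fst (g a) \<in> Z \<and> snd (g a) \<subseteq> B0 \<and> r \<le> card (snd (g a)) \<and>
      E (fst (g a)) a \<and> (\<forall>b\<in>snd (g a). E (fst (g a)) b)" by metis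
  \<comment> \<open>Second pigeonhole, over the pairs of an apex and the subset of \<open>B0\<close>
    that it serves. There are at most \<open>M * k * 2 ^ M\<close> of them, which explains the term
    with factor \<open>r\<close> in \<open>s\<close>.\<close>
  have "\<exists>q\<in>Z \<times> Pow B0. r < card {a\<in>A1. g a = q}"
  proof (rule ccontr)
    assume neg: "\<not> ?thesis"
    have "card A1 \<le> r * card (Z \<times> Pow B0)"
    proof (rule card_le_fibres[OF finA1])
      show "g ` A1 \<subseteq> Z \<times> Pow B0"
      proof
        fix q assume "q \<in> g ` A1"
        then obtain a where "a \<in> A1" "q = g a" by auto
        then show "q \<in> Z \<times> Pow B0" using g[of a] by (simp add: mem_Times_iff)
      qed
    qed (use finZ finB0 neg in \<open>auto simp: not_less\<close>)
    also have "\<dots> \<le> r * (M * k * 2 ^ M)"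
      using cZ finB0 B0 by (auto simp: card_cartesian_product card_Pow intro!: mult_left_mono)
    finally show False using cA1 by simp
  qed
  then obtain z Bs where q: "r < card {a\<in>A1. g a = (z, Bs)}" by auto
  then obtain A' where A': "A' \<subseteq> {a\<in>A1. g a = (z, Bs)}" "card A' = r"
    by (meson less_imp_le obtain_subset_with_card_n)
  obtain a where a: "a \<in> A1" "g a = (z, Bs)"
    using q by (metis (mono_tags, lifting) card.empty empty_Collect_eq not_less0)
  obtain B' where B': "B' \<subseteq> Bs" "card B' = r"
    using g[OF a(1)] a(2) by (metis obtain_subset_with_card_n snd_conv)
  have "E z x" if "x \<in> A' \<union> B'" for x
    using that A' B' g[of x] g[OF a(1)] a(2) by auto
  moreover have "A' \<subseteq> A" using A' by (auto simp: A1_def)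
  moreover have "B' \<subseteq> B" using B' B0 g[OF a(1)] a(2) by auto
  ultimately show ?thesis using A' B' by blast
qed

text \<open>Either some vertex on one of the sides is apex rich, or \<open>common_apex\<close> gives
  a vertex \<open>z\<close> whose neighbourhood contains a biclique with sides of size
  \<open>r\<close>. That biclique has minimum degree at least \<open>r\<close>, and \<open>r\<close>
  exceeds \<open>2 * sum_list ps\<close> by 1 to fit
  \<open>has_theta_neighbourhood_min_degree\<close>.\<close>

lemma has_theta_biclique_triangles:
  fixes ps :: "nat list"
  defines "k \<equiv> sum_list ps + 2" and "r \<equiv> 2 * sum_list ps + 1"
  defines "M \<equiv> k + r * k + 1"
  defines "s \<equiv> M * k + r * (M * k * 2 ^ M) + M + 1"
  assumes bi: "biclique A B s" and tri: "\<And>a b. a \<in> A \<Longrightarrow> b \<in> B \<Longrightarrow> \<exists>t. E a t \<and> E b t"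
    and ps: "\<And>p. p \<in> set ps \<Longrightarrow> 1 \<le> p" "1 \<notin> set ps \<or> count_list ps 2 \<le> 1"
  shows "has_theta E ps"
proof -
  have "2 * k \<le> M * k" by (intro mult_right_mono) (auto simp: M_def k_def r_def)
  then have s: "2 * sum_list ps + 2 < s" by (simp add: s_def k_def)
  consider (A) a where "a \<in> A" "apex_rich B a k" | (B) b where "b \<in> B" "apex_rich A b k"
    | (none) "\<forall>a\<in>A. \<not> apex_rich B a k" "\<forall>b\<in>B. \<not> apex_rich A b k" by blast
  then show ?thesis
  proof cases
    case A
    then show ?thesis using has_theta_apex_rich[OF bi] s ps by (simp add: k_def)
  next
    case B
    then show ?thesis using has_theta_apex_rich[OF biclique_sym[OF bi]] s ps by (simp add: k_def)
  next
    case none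
    then have "\<exists>z A' B'. A' \<subseteq> A \<and> B' \<subseteq> B \<and> card A' = r \<and> card B' = r \<and> (\<forall>x\<in>A' \<union> B'. E z x)"
      using bi tri unfolding s_def M_def by (intro common_apex) auto
    then obtain z A' B' where z: "A' \<subseteq> A" "B' \<subseteq> B" "card A' = r" "card B' = r" "\<forall>x\<in>A' \<union> B'. E z x"
      by blast
    show ?thesis
    proof (rule has_theta_neighbourhood_min_degree[of "A' \<union> B'" z])
      show "A' \<union> B' \<noteq> {}" using z by (auto simp: r_def)
      show "A' \<union> B' \<subseteq> N z" using z by auto
      fix x assume x: "x \<in> A' \<union> B'"
      have "A' \<subseteq> N x \<inter> (A' \<union> B') \<or> B' \<subseteq> N x \<inter> (A' \<union> B')"
        using x z bi E_sym by (auto simp: biclique_def subset_iff)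
      moreover have "finite (N x \<inter> (A' \<union> B'))" by simp
      ultimately have "r \<le> card (N x \<inter> (A' \<union> B'))" using z card_mono by metis
      then show "2 * sum_list ps < card (N x \<inter> (A' \<union> B'))" by (simp add: r_def)
    qed (rule ps(1))
  qed
qed

text \<open>Summing the neighbourhood bound over the sets of \<open>R\<close>-neighbours gives a
  count linear in the number of \<open>R\<close>-pairs. It is applied to all edges, to the edges
  lying in triangles and to the heavy edges.\<close>

lemma theta_free_cherries:
  assumes free: "\<not> has_theta E ps" and ps: "\<And>p. p \<in> set ps \<Longrightarrow> 1 \<le> p"
    and R: "\<And>x y. R x y \<Longrightarrow> E x y"
  shows "card {(w,x,y). R w x \<and> R w y \<and> E x y} \<le> 4 * sum_list ps * card {(w,x) \<in> V \<times> V. R w x}"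
proof -
  define U where "U w = {x. R w x}" for w
  have U: "U w \<subseteq> N w" for w using R by (auto simp: U_def)
  have finU: "finite (U w)" for w using U finN by (rule finite_subset)
  have finE: "finite {(x,y) \<in> U w \<times> U w. E x y}" for w
    by (rule finite_subset[of _ "U w \<times> U w"]) (auto simp: finU)
  have "{(w,x,y). R w x \<and> R w y \<and> E x y} = (SIGMA w:V. {(x,y) \<in> U w \<times> U w. E x y})"
    using R E_V by (auto simp: U_def)
  then have "card {(w,x,y). R w x \<and> R w y \<and> E x y} = (\<Sum>w\<in>V. card {(x,y) \<in> U w \<times> U w. E x y})"
    using finV finE by (simp del: mem_Sigma_iff)
  also have "\<dots> \<le> (\<Sum>w\<in>V. 4 * sum_list ps * card (U w))"
    by (intro sum_mono theta_free_neighbourhood_edges[OF free ps U])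
  also have "\<dots> = 4 * sum_list ps * (\<Sum>w\<in>V. card {x\<in>V. R w x})"
  proof -
    have "U w = {x\<in>V. R w x}" for w using R E_V2 by (auto simp: U_def)
    then show ?thesis by (simp add: sum_distrib_left)
  qed
  also have "(\<Sum>w\<in>V. card {x\<in>V. R w x}) = card {(w,x) \<in> V \<times> V. R w x}"
    by (rule card_pairs_eq_sum[OF finV finV, symmetric])
  finally show ?thesis .
qed

lemma theta_free_triangles_quadratic:
  assumes free: "\<not> has_theta E ps" and ps: "\<And>p. p \<in> set ps \<Longrightarrow> 1 \<le> p"
  shows "card triangles \<le> 4 * sum_list ps * card V ^ 2"
proof -
  have "card triangles \<le> 4 * sum_list ps * card {(w,x) \<in> V \<times> V. E w x}"
    unfolding triangles_def by (rule theta_free_cherries[OF free ps])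
  also have "card {(w,x) \<in> V \<times> V. E w x} \<le> card (V \<times> V)"
    using finV by (intro card_mono) auto
  finally show ?thesis by (simp add: card_cartesian_product power2_eq_square)
qed

end

theorem theta_free_triangles_subquadratic:
  assumes ps: "\<And>p. p \<in> set ps \<Longrightarrow> 1 \<le> p" "1 \<notin> set ps \<or> count_list ps 2 \<le> 1"
  shows "\<exists>s::nat. s \<ge> 1 \<and> (\<forall>(V::'a set) E. fin_graph V E \<and> \<not> has_theta E ps \<longrightarrow>
     real (card (fin_graph.triangles E)) \<le>
       4 * real (sum_list ps) * (2 * real s ^ 2 * real (card V) powr (2 - 1 / real s)))"
proof -
  define k where "k = sum_list ps + 2"
  define r where "r = 2 * sum_list ps + 1"
  define M where "M = k + r * k + 1"
  define s where "s = M * k + r * (M * k * 2 ^ M) + M + 1"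
  have s1: "s \<ge> 1" by (simp add: s_def)
  show ?thesis
  proof (intro exI[of _ s] conjI s1 allI impI, elim conjE)
    fix V :: "'a set" and E assume "fin_graph V E" and free: "\<not> has_theta E ps"
    interpret fin_graph V E by fact
    define R where "R x y \<longleftrightarrow> E x y \<and> (\<exists>t. E x t \<and> E y t)" for x y
    have "triangles \<subseteq> {(w,x,y). R w x \<and> R w y \<and> E x y}"
      using E_sym by (auto simp: triangles_def R_def)
    moreover have "finite {(w,x,y). R w x \<and> R w y \<and> E x y}"
      using fin_triangles by (rule finite_subset[rotated]) (auto simp: triangles_def R_def)
    ultimately have "card triangles \<le> card {(w,x,y). R w x \<and> R w y \<and> E x y}" by (intro card_mono)
    also have "\<dots> \<le> 4 * sum_list ps * card {(w,x) \<in> V \<times> V. R w x}"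
      by (rule theta_free_cherries[OF free]) (use ps(1) in \<open>auto simp: R_def\<close>)
    finally have "real (card triangles) \<le> real (4 * sum_list ps * card {(w,x) \<in> V \<times> V. R w x})"
      by (rule of_nat_mono)
    also have "\<dots> = 4 * real (sum_list ps) * real (card {(w,x) \<in> V \<times> V. R w x})" by simp
    also have "\<dots> \<le> 4 * real (sum_list ps) * (2 * real s ^ 2 * real (card V) powr (2 - 1 / real s))"
    proof (intro mult_left_mono kovari_sos_turan[OF finV s1] notI, goal_cases)
      case 1
      then obtain A B where AB: "A \<subseteq> V" "B \<subseteq> V" "card A = s" "card B = s" "\<forall>a\<in>A. \<forall>b\<in>B. R a b" by blast
      then have "biclique A B s" using finV by (auto simp: biclique_def R_def intro: finite_subset)
      then have "has_theta E ps"
        unfolding s_def M_def k_def r_def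
        by (rule has_theta_biclique_triangles) (use AB ps in \<open>auto simp: R_def\<close>)
      then show False using free by simp
    qed simp
    finally show "real (card triangles) \<le> \<dots>" .
  qed
qed

subsection \<open>Heavy edges\<close>

context fin_graph
begin

lemma robust_path_between_edges:
  assumes E: "E u w" "E w' v" and rob: "robust_path E w w' p (k + 3)"
    and ne: "u \<noteq> v" "u \<noteq> w'" "v \<noteq> w" "w \<noteq> w'" "w \<notin> Z" "w' \<notin> Z" and Z: "finite Z" "card Z \<le> k"
    and p: "p \<ge> 1"
  shows "avoiding_path E u v (p + 2) Z"
proof -
  have ne': "u \<noteq> w" "w' \<noteq> v" using E E_ne by auto
  have "avoiding_path E u w' (Suc 0 + p) (insert v Z)"
    by (rule avoiding_path_append[OF avoiding_path_edge[of E, OF E(1)] rob])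
      (use ne ne' Z in \<open>auto simp: card_insert_if\<close>)
  then have "avoiding_path E u v ((Suc 0 + p) + Suc 0) Z"
    by (rule avoiding_path_append[where k = "card Z + Suc p"])
      (use ne ne' Z E(2) in \<open>auto intro: robust_path_edge\<close>)
  then show ?thesis by simp
qed

text \<open>The paths use exactly one other matching edge; this is what makes their length odd.\<close>

lemma robust_path_odd_matching:
  assumes J: "finite J" "2 * k + 2 * j + 8 < card J" "2 * k + 2 * j + 8 < M"
    and match: "\<And>p q. p \<in> J \<Longrightarrow> q \<in> J \<Longrightarrow> p \<noteq> q \<Longrightarrow> fst p \<noteq> fst q \<and> snd p \<noteq> snd q \<and> fst p \<noteq> snd q"
    and edge: "\<And>p. p \<in> J \<Longrightarrow> E (fst p) (snd p)"
    and com: "\<And>p q. p \<in> J \<Longrightarrow> q \<in> J \<Longrightarrow> p \<noteq> q \<Longrightarrow>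
      M \<le> card (N (fst p) \<inter> N (fst q)) \<and> M \<le> card (N (snd p) \<inter> N (snd q))"
    and uv: "(u, v) \<in> J"
  shows "robust_path E u v (2 * j + 5) k"
  unfolding robust_path_def
proof (intro allI impI)
  fix Z :: "'a set" assume Z: "finite Z \<and> card Z \<le> k"
  define Z' where "Z' = insert u (insert v Z)"
  have Z': "finite Z'" "card Z' \<le> k + 2" using Z by (auto simp: Z'_def card_insert_if)
  have inj: "inj_on fst J" "inj_on snd J" using match by (blast intro: inj_onI)+
  \<comment> \<open>Each forbidden vertex occurs in at most one first and at most one second
    coordinate, so at most \<open>2 * (k + 2)\<close> pairs of \<open>J\<close> are lost.\<close>
  have "card {p\<in>J. fst p \<in> Z'} \<le> card Z'"
    by (rule card_inj_on_le[of fst]) (use inj Z' in \<open>auto intro: inj_on_subset\<close>)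
  moreover have "card {p\<in>J. snd p \<in> Z'} \<le> card Z'"
    by (rule card_inj_on_le[of snd]) (use inj Z' in \<open>auto intro: inj_on_subset\<close>)
  moreover have "card ({p\<in>J. fst p \<in> Z'} \<union> {p\<in>J. snd p \<in> Z'}) \<le> card {p\<in>J. fst p \<in> Z'} + card {p\<in>J. snd p \<in> Z'}"
    by (rule card_Un_le)
  ultimately have "card ({p\<in>J. fst p \<in> Z'} \<union> {p\<in>J. snd p \<in> Z'}) < card J" using Z' J by simp
  then obtain p where "p \<in> J" "p \<notin> {p\<in>J. fst p \<in> Z'} \<union> {p\<in>J. snd p \<in> Z'}"
    using exists_avoiding[of "{p\<in>J. fst p \<in> Z'} \<union> {p\<in>J. snd p \<in> Z'}" J] J(1) by auto
  then obtain x y where xy: "(x, y) \<in> J" "x \<notin> Z'" "y \<notin> Z'" by (cases p) auto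
  have E: "E u v" "E x y" using edge[OF uv] edge[OF xy(1)] by auto
  have ne: "x \<noteq> u" "x \<noteq> v" "y \<noteq> u" "y \<noteq> v" "u \<noteq> v" "x \<noteq> y" "x \<notin> Z" "y \<notin> Z"
    using xy E E_irrefl by (auto simp: Z'_def)
  \<comment> \<open>The lengths add up as \<open>(2 * j + 2) + 1 + 2\<close>: through common
    neighbours of first coordinates, over the edge \<open>xy\<close>, and through one common
    neighbour of \<open>y\<close> and \<open>v\<close>.\<close>
  have "robust_path E u x (2 * j + 2) (k + 2)"
  proof (rule robust_path_even[where A = "fst ` J" and M = M])
    have "card (fst ` J) = card J" using inj(1) by (rule card_image)
    then show "k + 2 + 2 * j + 2 < card (fst ` J)" using J by simp
    show "M \<le> card (N a \<inter> N b)" if "a \<in> fst ` J" "b \<in> fst ` J" "a \<noteq> b" for a b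
      using that com by auto
    show "u \<in> fst ` J" "x \<in> fst ` J" using uv xy by force+
  qed (use J ne in auto)
  moreover have "finite (insert y (insert v Z))" "card (insert y (insert v Z)) \<le> k + 2"
    using Z by (auto simp: card_insert_if)
  ultimately have "avoiding_path E u x (2 * j + 2) (insert y (insert v Z))" by (rule robust_pathD)
  then have "avoiding_path E u y ((2 * j + 2) + Suc 0) (insert v Z)"
    by (rule avoiding_path_append[OF _ robust_path_edge[of E, OF E(2)], where k = "card (insert v Z) + (2 * j + 2)"])
      (use ne Z in auto)
  moreover have "robust_path E y v 2 (k + 2 * j + 3)"
  proof (rule robust_path_two)
    have "(x, y) \<noteq> (u, v)" using ne by auto
    then have "M \<le> card (N y \<inter> N v)" using com[OF xy(1) uv] by simp
    then show "k + 2 * j + 3 < card (N y \<inter> N v)" using J by simp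
  qed
  ultimately have "avoiding_path E u v (((2 * j + 2) + Suc 0) + 2) Z"
    by (rule avoiding_path_append) (use ne Z in auto)
  then show "avoiding_path E u v (2 * j + 5) Z" by (simp add: numeral_eq_Suc)
qed

text \<open>The paths start and end with two vertices of \<open>W\<close> that have many common neighbours in \<open>D\<close>; in
  between they follow a Ramsey clique of such common neighbours.  The assumption on \<open>L\<close> is the conclusion of
  \<open>dense_sets_clique\<close>.\<close>

lemma robust_path_even_through:
  fixes \<eta> :: real and k j L :: nat
  defines "n \<equiv> real (card V)"
  assumes W: "finite W" "\<And>w. w \<in> W \<Longrightarrow> E u w \<and> E w v" "\<And>w. w \<in> W \<Longrightarrow> \<eta> * n \<le> real (card (N w \<inter> D))"
    and cW: "real (card W) > 2 / \<eta> ^ 2 + real k" and \<eta>: "\<eta> > 0"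
    and D: "\<And>x. x \<in> D \<Longrightarrow> \<eta> * n \<le> real (card (N x))"
    and uv: "u \<noteq> v"
    and L: "\<And>(W::'a set) (I::'a set) S. finite W \<and> finite I \<and> card I \<ge> L \<and> W \<noteq> {} \<and>
     (\<forall>i\<in>I. S i \<subseteq> W \<and> real (card (S i)) \<ge> \<eta> * real (card W)) \<Longrightarrow>
     (\<exists>J\<subseteq>I. card J = r \<and> (\<forall>i\<in>J. \<forall>j\<in>J. i \<noteq> j \<longrightarrow> real (card (S i \<inter> S j)) \<ge> \<eta> ^ 2 / 2 * real (card W)))"
    and r: "2 * k + 2 * j + 20 < r"
    and large: "\<eta> ^ 2 / 2 * n > real (2 * k + 2 * j + 20)" "\<eta> ^ 2 / 2 * n > real L"
  shows "robust_path E u v (2 * j + 4) k"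
  unfolding robust_path_def
proof (intro allI impI)
  fix Z :: "'a set" assume Z: "finite Z \<and> card Z \<le> k"
  have V0: "V \<noteq> {}" using large(2) by (auto simp: n_def)
  have cWZ: "card W - card Z \<le> card (W - Z)" using Z by (intro diff_card_le_card_Diff) auto
  have "\<exists>w\<in>W - Z. \<exists>w'\<in>W - Z. w \<noteq> w' \<and> real (card ((N w \<inter> D) \<inter> (N w' \<inter> D))) \<ge> \<eta> ^ 2 / 2 * real (card V)"
  proof (rule dense_sets_intersect[OF finV _ _ \<eta> V0])
    show "real (card (W - Z)) > 2 / \<eta> ^ 2" using cW cWZ Z by linarith
  qed (use W N_sub in \<open>auto simp: n_def\<close>)
  then obtain w w' where w: "w \<in> W" "w \<notin> Z" "w' \<in> W" "w' \<notin> Z" "w \<noteq> w'"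
    and com: "\<eta> ^ 2 / 2 * n \<le> real (card ((N w \<inter> D) \<inter> (N w' \<inter> D)))" by (auto simp: n_def)
  define X where "X = (N w \<inter> D) \<inter> (N w' \<inter> D)"
  have X: "finite X" "\<And>x. x \<in> X \<Longrightarrow> E w x \<and> E w' x" by (auto simp: X_def)
  have cX: "\<eta> ^ 2 / 2 * n \<le> real (card X)" using com by (simp add: X_def)
  have ww': "robust_path E w w' (2 * j + 2) (k + 3)"
  proof (cases j)
    case 0
    have "card X \<le> card (N w \<inter> N w')" by (rule card_mono) (auto simp: X_def)
    then have "k + 3 < card (N w \<inter> N w')" using cX large(1) by linarith
    then show ?thesis using robust_path_two 0 by (simp only: mult_0_right add_0)
  next
    case (Suc i)
    \<comment> \<open>All of \<open>X\<close> lies in \<open>D\<close>, so its vertices have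
      neighbourhoods of density at least \<open>\<eta>\<close> in \<open>V\<close>, and
      \<open>L\<close> yields \<open>r\<close> of them whose pairwise common neighbourhoods are
      linear in \<open>n\<close>.\<close>
    have "\<exists>J\<subseteq>X. card J = r \<and> (\<forall>i\<in>J. \<forall>j\<in>J. i \<noteq> j \<longrightarrow> real (card (N i \<inter> N j)) \<ge> \<eta> ^ 2 / 2 * real (card V))"
    proof (rule L)
      have "L \<le> card X" using cX large(2) by linarith
      then show "finite V \<and> finite X \<and> L \<le> card X \<and> V \<noteq> {} \<and>
        (\<forall>i\<in>X. N i \<subseteq> V \<and> \<eta> * real (card V) \<le> real (card (N i)))"
        using X D V0 N_sub finV by (auto simp: X_def n_def)
    qed
    then obtain J where J: "J \<subseteq> X" "card J = r"
      "\<And>x y. x \<in> J \<Longrightarrow> y \<in> J \<Longrightarrow> x \<noteq> y \<Longrightarrow> real (card (N x \<inter> N y)) \<ge> \<eta> ^ 2 / 2 * n"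
      unfolding n_def by blast
    have finJ: "finite J" using J(1) X(1) by (rule finite_subset)
    have "avoiding_path E w w' ((2 * i + 2) + 2) Z'" if Z': "finite Z'" "card Z' \<le> k + 3" for Z'
    proof -
      define Y where "Y = insert w (insert w' Z')"
      have Y: "finite Y" "card Y \<le> k + 5" using Z' by (auto simp: Y_def card_insert_if)
      then obtain x where x: "x \<in> J" "x \<notin> Y" using exists_avoiding[of Y J] J r by auto
      have "card (insert x Y) \<le> k + 6" using Y by (auto simp: card_insert_if)
      then obtain x' where x': "x' \<in> J" "x' \<notin> insert x Y"
        using exists_avoiding[of "insert x Y" J] J r Y by auto
      have "robust_path E x x' (2 * i + 2) (k + 3 + 3)"
      proof (rule robust_path_even[OF finJ])
        show "2 * k + 2 * j + 20 \<le> card (N a \<inter> N b)" if "a \<in> J" "b \<in> J" "a \<noteq> b" for a b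
          using J(3)[OF that] large(1) by linarith
      qed (use x x' r J Suc in auto)
      then show ?thesis
        by (rule robust_path_between_edges[rotated 2])
          (use X J x x' E_sym Z' w in \<open>auto simp: Y_def\<close>)
    qed
    then show ?thesis using Suc by (auto simp: robust_path_def)
  qed
  have "avoiding_path E u v ((2 * j + 2) + 2) Z"
    by (rule robust_path_between_edges[OF _ _ ww'])
      (use W(2)[OF w(1)] W(2)[OF w(3)] w uv Z E_ne in auto)
  then show "avoiding_path E u v (2 * j + 4) Z" by (simp add: numeral_eq_Suc)
qed

definition heavy :: "nat \<Rightarrow> 'a \<Rightarrow> 'a \<Rightarrow> bool" where
  "heavy K x y \<longleftrightarrow> E x y \<and> K \<le> card (N x \<inter> N y)"

definition light :: "nat \<Rightarrow> 'a \<Rightarrow> 'a \<Rightarrow> bool" where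
  "light K x y \<longleftrightarrow> E x y \<and> \<not> K \<le> card (N x \<inter> N y)"

lemma heavy_sym: "heavy K x y \<Longrightarrow> heavy K y x"
  using E_sym by (auto simp: heavy_def Int_commute)

lemma light_sym: "light K x y \<Longrightarrow> light K y x"
  using E_sym by (auto simp: light_def Int_commute)

text \<open>Heavy edges have so many common neighbours that the vertices of \<open>A\<close> are
  apex rich. For ends \<open>a\<close> and \<open>b\<close> across the biclique, odd lengths
  alternate, length 2 comes from heaviness and even lengths from 4 on use the detour; no length is
  excluded, not even 3.\<close>

lemma has_theta_heavy_biclique:
  assumes bi: "finite A" "finite B" "s \<le> card A" "s \<le> card B" "\<And>a b. a \<in> A \<Longrightarrow> b \<in> B \<Longrightarrow> heavy K a b"
    and K: "2 * sum_list ps + 10 < K" and s: "2 * sum_list ps + 10 < s"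
    and ps: "\<And>p. p \<in> set ps \<Longrightarrow> 1 \<le> p"
  shows "has_theta E ps"
proof -
  let ?k = "sum_list ps"
  have bic: "biclique A B s" using bi by (auto simp: biclique_def heavy_def)
  have "A \<noteq> {}" "B \<noteq> {}" using bi s by auto
  then obtain a b where ab: "a \<in> A" "b \<in> B" by auto
  have E: "E a b" "a \<noteq> b" using bi(5)[OF ab] E_ne by (auto simp: heavy_def)
  have rich: "apex_rich B a (?k + 2)"
    unfolding apex_rich_def
  proof (intro allI impI)
    fix Z :: "'a set" assume Z: "finite Z \<and> card Z \<le> ?k + 2"
    then obtain b where b: "b \<in> B" "b \<notin> Z" using exists_avoiding[of Z B] bi s by auto
    have "card Z < card (N a \<inter> N b)" using bi(5)[OF ab(1) b(1)] Z K by (auto simp: heavy_def)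
    then obtain t where "t \<in> N a \<inter> N b" "t \<notin> Z" using exists_avoiding Z by blast
    then show "\<exists>b\<in>B - Z. \<exists>t. t \<notin> Z \<and> E a t \<and> E b t" using b by (intro bexI[of _ b]) auto
  qed
  have le: "p \<le> ?k" if "p \<in> set ps" for p using that by (rule member_le_sum_list) simp
  show ?thesis
  proof (rule has_theta_robust[OF E(2)])
    fix p assume p: "p \<in> set ps"
    have "p = 2 \<or> odd p \<or> even p \<and> p \<ge> 4" using ps[OF p] by presburger
    then consider "p = 2" | "odd p" | "even p" "p \<ge> 4" by blast
    then show "robust_path E a b p ?k"
    proof cases
      case 1
      have "?k < card (N a \<inter> N b)" using bi(5)[OF ab] K by (simp add: heavy_def)
      then show ?thesis using 1 robust_path_two by simp
    next
      case 2
      define j where "j = p div 2"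
      have j: "p = 2 * j + 1" using 2 by (auto simp: j_def)
      show ?thesis unfolding j by (rule biclique_odd[OF bic]) (use ab s le[OF p] j in auto)
    next
      case 3
      define j where "j = (p - 4) div 2"
      have j: "p = 2 * j + 4" using 3 by (auto simp: j_def elim!: evenE)
      show ?thesis unfolding j
        by (rule apex_rich_even[OF bic]) (use ab s le[OF p] j rich in auto)
    qed
  qed
qed

end

text \<open>Greedy: a chosen pair \<open>(a, b)\<close> rules out at most \<open>4 * K\<close>
  pairs, since each of \<open>a\<close> and \<open>b\<close> occurs at most \<open>K\<close> times
  in either coordinate. The condition \<open>fst p \<noteq> snd q\<close> makes the pairs disjoint
  as edges.\<close>

lemma matching_in_bounded_degree:
  assumes "finite P" "\<And>a. card {p\<in>P. fst p = a} \<le> K" "\<And>a. card {p\<in>P. snd p = a} \<le> K"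
    and "4 * K * l \<le> card P" "K \<ge> 1"
  shows "\<exists>J\<subseteq>P. card J = l \<and> (\<forall>p\<in>J. \<forall>q\<in>J. p \<noteq> q \<longrightarrow> fst p \<noteq> fst q \<and> snd p \<noteq> snd q \<and> fst p \<noteq> snd q)"
  using assms
proof (induction l arbitrary: P)
  case 0
  then show ?case by (intro exI[of _ "{}"]) auto
next
  case (Suc l)
  have "card P \<noteq> 0" using Suc.prems(4,5) by auto
  then obtain a b where ab: "(a, b) \<in> P" by (metis card.empty ex_in_conv surj_pair)
  define P' where "P' = {q\<in>P. fst q \<notin> {a, b} \<and> snd q \<notin> {a, b}}"
  have "P \<subseteq> P' \<union> (({p\<in>P. fst p = a} \<union> {p\<in>P. fst p = b}) \<union> ({p\<in>P. snd p = a} \<union> {p\<in>P. snd p = b}))"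
    by (auto simp: P'_def)
  then have "card P \<le> card (P' \<union> (({p\<in>P. fst p = a} \<union> {p\<in>P. fst p = b}) \<union> ({p\<in>P. snd p = a} \<union> {p\<in>P. snd p = b})))"
    using Suc.prems(1) by (intro card_mono) (auto simp: P'_def)
  also have "\<dots> \<le> card P' + ((card {p\<in>P. fst p = a} + card {p\<in>P. fst p = b}) + (card {p\<in>P. snd p = a} + card {p\<in>P. snd p = b}))"
    by (intro order_trans[OF card_Un_le] add_mono) auto
  also have "\<dots> \<le> card P' + ((K + K) + (K + K))"
    by (intro add_mono Suc.prems order_refl)
  finally have "4 * K * l \<le> card P'" using Suc.prems(4) by simp
  moreover have "card {p\<in>P'. fst p = c} \<le> K" "card {p\<in>P'. snd p = c} \<le> K" for c
    by (rule order_trans[OF card_mono Suc.prems(2)[of c]] order_trans[OF card_mono Suc.prems(3)[of c]];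
        use Suc.prems(1) in \<open>auto simp: P'_def\<close>)+
  moreover have "finite P'" using Suc.prems(1) by (simp add: P'_def)
  ultimately obtain J where J: "J \<subseteq> P'" "card J = l"
    "\<forall>p\<in>J. \<forall>q\<in>J. p \<noteq> q \<longrightarrow> fst p \<noteq> fst q \<and> snd p \<noteq> snd q \<and> fst p \<noteq> snd q"
    using Suc.IH[of P'] Suc.prems(5) by blast
  have sep: "fst q \<noteq> a \<and> fst q \<noteq> b \<and> snd q \<noteq> a \<and> snd q \<noteq> b" if "q \<in> J" for q
    using that J(1) by (auto simp: P'_def)
  have "(a, b) \<notin> J" using sep by force
  moreover have "finite J" using J(1) Suc.prems(1) by (auto simp: P'_def intro: finite_subset)
  ultimately have "card (insert (a, b) J) = Suc l" using J(2) by simp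
  moreover have "insert (a, b) J \<subseteq> P" using J(1) ab by (auto simp: P'_def)
  moreover have "\<forall>p\<in>insert (a, b) J. \<forall>q\<in>insert (a, b) J. p \<noteq> q \<longrightarrow> fst p \<noteq> fst q \<and> snd p \<noteq> snd q \<and> fst p \<noteq> snd q"
    using J(3) sep by (metis fst_conv insert_iff snd_conv)
  ultimately show ?case by blast
qed

context fin_graph
begin

definition heavy_cherries :: "nat \<Rightarrow> ('a \<times> 'a \<times> 'a) set" where
  "heavy_cherries K = {(w,x,y). heavy K w x \<and> heavy K w y \<and> E x y}"

text \<open>The first coordinate is the apex, opposite to the only heavy edge. In
  \<open>heavy_cherries\<close> the apex also comes first, but there the two edges at the apex are
  the heavy ones.\<close>

definition light_cherries :: "nat \<Rightarrow> ('a \<times> 'a \<times> 'a) set" where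
  "light_cherries K = {(w,u,v). heavy K u v \<and> light K w u \<and> light K w v}"

lemma cherries_sub: "heavy_cherries K \<subseteq> triangles" "light_cherries K \<subseteq> triangles"
  by (auto simp: heavy_cherries_def light_cherries_def triangles_def heavy_def light_def)

lemma card_light_cherries_fibre:
  assumes T: "T \<subseteq> light_cherries K" and P: "finite P"
    and \<phi>: "\<phi> = (\<lambda>(w,u,v). (w,u)) \<or> \<phi> = (\<lambda>(w,u,v). (w,v))" and TP: "\<phi> ` T \<subseteq> P"
  shows "card T \<le> K * card P"
proof (rule card_le_fibres[OF _ P TP])
  show "finite T" using T cherries_sub(2) fin_triangles by (meson finite_subset)
  fix p assume "p \<in> P"
  obtain a b where p: "p = (a, b)" by (cases p)
  let ?F = "{t\<in>T. \<phi> t = p}"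
  show "card ?F \<le> K"
  proof (cases "?F = {}")
    case True
    then show ?thesis by (simp only: card.empty)
  next
    case False
    then have ab: "light K a b" using T \<phi> p by (auto simp: light_cherries_def)
    define g where "g = (if \<phi> = (\<lambda>(w,x,y). (w,x)) then (\<lambda>(w::'a,x::'a,y::'a). y) else (\<lambda>(w,x,y). x))"
    have "inj_on g ?F" using \<phi> by (auto simp: inj_on_def g_def p split: if_splits)
    moreover have "g ` ?F \<subseteq> N a \<inter> N b"
      using T \<phi> E_sym by (auto simp: g_def p light_cherries_def light_def heavy_def subset_iff split: if_splits)
    ultimately have "card ?F \<le> card (N a \<inter> N b)" by (intro card_inj_on_le) auto
    then show ?thesis using ab by (simp add: light_def)
  qed
qed

end

text \<open>If there are many, then after pruning one apex \<open>w\<close> keeps linearly many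
  opposite pairs. The light edges at \<open>w\<close> bound their degrees, so they contain a large
  matching, of which Ramsey's theorem keeps pairs with large common neighbourhoods. Any remaining
  pair \<open>(u,v)\<close> serves as ends: odd lengths from 5 on run through another matching edge,
  even lengths from 4 on through the apexes of \<open>(u,v)\<close>. The scarcity of heavy pairs
  guarantees that pairs with enough apexes survive.\<close>

theorem few_light_cherries:
  fixes \<epsilon> :: real
  assumes \<epsilon>: "\<epsilon> > 0" and ps: "\<And>p. p \<in> set ps \<Longrightarrow> 1 \<le> p \<and> p \<noteq> 3" and K: "2 * sum_list ps + 10 < K"
  shows "\<exists>\<gamma>>0. \<exists>n0. \<forall>(V::'a set) E. fin_graph V E \<and> n0 \<le> card V \<and> \<not> has_theta E ps \<and>
     real (card {(u,v) \<in> V \<times> V. fin_graph.heavy E K u v}) \<le> \<gamma> * real (card V) ^ 2 \<longrightarrow>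
     real (card (fin_graph.light_cherries E K)) \<le> \<epsilon> * real (card V) ^ 2"
proof -
  define sl where "sl = sum_list ps"
  \<comment> \<open>Each of the three degree prunings below costs at most
    \<open>K * \<eta> * n ^ 2\<close> triples, that is
    \<open>\<epsilon> / 6 * n ^ 2\<close>.\<close>
  define \<eta> where "\<eta> = \<epsilon> / (6 * real K)"
  define r where "r = 8 * sl + 40"
  have \<eta>: "\<eta> > 0" using \<epsilon> K by (simp add: \<eta>_def)
  then have \<eta>2: "\<eta> ^ 2 > 0" by simp
  \<comment> \<open>This instance has density \<open>\<eta> ^ 2\<close> and works on pairs: it will
    be applied to the products \<open>N u \<times> N v\<close> inside \<open>V \<times> V\<close>,
    so that a single use of Ramsey's theorem controls both coordinates.\<close>
  from dense_sets_clique[OF \<eta>2, of r, where 'a = "'a \<times> 'a" and 'i = "'a \<times> 'a"] obtain L1 where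
    L1: "\<And>(W::('a\<times>'a) set) (I::('a\<times>'a) set) S. finite W \<and> finite I \<and> card I \<ge> L1 \<and> W \<noteq> {} \<and>
     (\<forall>i\<in>I. S i \<subseteq> W \<and> real (card (S i)) \<ge> \<eta> ^ 2 * real (card W)) \<Longrightarrow>
     (\<exists>J\<subseteq>I. card J = r \<and> (\<forall>i\<in>J. \<forall>j\<in>J. i \<noteq> j \<longrightarrow> real (card (S i \<inter> S j)) \<ge> (\<eta> ^ 2) ^ 2 / 2 * real (card W)))"
    by blast
  from dense_sets_clique[OF \<eta>, of r, where 'a = 'a and 'i = 'a] obtain L2 where
    L2: "\<And>(W::'a set) (I::'a set) S. finite W \<and> finite I \<and> card I \<ge> L2 \<and> W \<noteq> {} \<and>
     (\<forall>i\<in>I. S i \<subseteq> W \<and> real (card (S i)) \<ge> \<eta> * real (card W)) \<Longrightarrow>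
     (\<exists>J\<subseteq>I. card J = r \<and> (\<forall>i\<in>J. \<forall>j\<in>J. i \<noteq> j \<longrightarrow> real (card (S i \<inter> S j)) \<ge> \<eta> ^ 2 / 2 * real (card W)))"
    by blast
  \<comment> \<open>The number of apexes that \<open>robust_path_even_through\<close> asks for; by
    the choice of \<open>\<gamma>\<close>, heavy pairs with fewer apexes account for at most
    \<open>\<epsilon> / 4 * n ^ 2\<close> triples.\<close>
  define K3 where "K3 = nat \<lceil>2 / \<eta> ^ 2\<rceil> + sl + 2"
  define \<gamma> where "\<gamma> = \<epsilon> / (4 * real K3)"
  have K3: "K3 > 0" by (simp add: K3_def)
  have \<gamma>: "\<gamma> > 0" using \<epsilon> K3 by (simp add: \<gamma>_def)
  define M where "M = 4 * sl + 40"
  define a1 where "a1 = 2 / \<eta> ^ 2 * real (M + L2)"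
  define a2 where "a2 = 2 / \<eta> ^ 4 * real M"
  define a3 where "a3 = 4 / \<epsilon> * real (4 * K * L1)"
  define n0 where "n0 = nat \<lceil>a1\<rceil> + nat \<lceil>a2\<rceil> + nat \<lceil>a3\<rceil> + 3"
  show ?thesis
  proof (rule exI[of _ \<gamma>], rule conjI[OF \<gamma>], rule exI[of _ n0], intro allI impI, elim conjE, rule ccontr)
    fix V :: "'a set" and E
    assume gr: "fin_graph V E" and n0: "n0 \<le> card V" and free: "\<not> has_theta E ps"
      and hv: "real (card {(u,v) \<in> V \<times> V. fin_graph.heavy E K u v}) \<le> \<gamma> * real (card V) ^ 2"
      and big: "\<not> real (card (fin_graph.light_cherries E K)) \<le> \<epsilon> * real (card V) ^ 2"
    interpret fin_graph V E by (rule gr)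
    define n where "n = real (card V)"
    have a: "a1 < n" "a2 < n" "a3 < n" "n > 0" using n0 unfolding n_def n0_def by linarith+
    have n1: "real (M + L2) < \<eta> ^ 2 / 2 * n" and n2: "real M < \<eta> ^ 4 / 2 * n" and n3: "real (4 * K * L1) < \<epsilon> / 4 * n"
      using a \<eta> \<epsilon> by (simp_all add: a1_def a2_def a3_def field_simps)
    define R where "R = light_cherries K"
    have R: "\<epsilon> * n ^ 2 < real (card R)" using big by (simp add: R_def n_def)
    have finR: "finite R" unfolding R_def using cherries_sub(2) fin_triangles by (rule finite_subset)
    have Rin: "heavy K u v \<and> light K w u \<and> light K w v \<and> E w u \<and> E w v \<and> E u v \<and> w \<in> V \<and> u \<in> V \<and> v \<in> V"
      if "(w,u,v) \<in> R" for w u v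
      using that E_V E_V2 by (auto simp: R_def light_cherries_def heavy_def light_def)
    \<comment> \<open>\<open>D\<close> collects the vertices of linear degree and \<open>D2\<close>
      those with linearly many neighbours in \<open>D\<close>; \<open>P1\<close> and
      \<open>P2\<close> are the pairs to be pruned, with the apex as first coordinate.\<close>
    define D where "D = {x\<in>V. \<eta> * n \<le> real (card (N x))}"
    define D2 where "D2 = {w\<in>V. \<eta> * n \<le> real (card (N w \<inter> D))}"
    define P1 where "P1 = (\<lambda>(u,w). (w,u)) ` (SIGMA u:V - D. N u)"
    define P2 where "P2 = (SIGMA w:V - D2. N w \<inter> D)"
    have finP: "finite P1" "finite P2" using finV by (auto simp: P1_def P2_def simp del: N_iff)
    have P1: "real (card P1) \<le> \<eta> * n ^ 2"
    proof -
      have "card P1 \<le> card (SIGMA u:V - D. N u)"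
        unfolding P1_def by (rule card_image_le) (use finV in \<open>auto simp del: N_iff\<close>)
      also have "\<dots> = (\<Sum>u\<in>V - D. card (N u))" using finV by (simp del: N_iff)
      finally have "real (card P1) \<le> (\<Sum>u\<in>V - D. real (card (N u)))"
        by (simp only: of_nat_sum[symmetric] of_nat_le_iff)
      also have "\<dots> \<le> (\<Sum>u\<in>V - D. \<eta> * n)" by (rule sum_mono) (auto simp: D_def)
      also have "\<dots> = real (card (V - D)) * (\<eta> * n)" by simp
      also have "\<dots> \<le> n * (\<eta> * n)"
        unfolding n_def by (intro mult_right_mono of_nat_mono card_mono) (use finV \<eta> in auto)
      finally show ?thesis by (simp add: power2_eq_square mult.left_commute)
    qed
    have P2: "real (card P2) \<le> \<eta> * n ^ 2"
    proof -
      have "card P2 = (\<Sum>w\<in>V - D2. card (N w \<inter> D))" unfolding P2_def using finV by (simp del: N_iff)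
      then have "real (card P2) = (\<Sum>w\<in>V - D2. real (card (N w \<inter> D)))" by (simp only: of_nat_sum)
      also have "\<dots> \<le> (\<Sum>w\<in>V - D2. \<eta> * n)" by (rule sum_mono) (auto simp: D2_def)
      also have "\<dots> = real (card (V - D2)) * (\<eta> * n)" by simp
      also have "\<dots> \<le> n * (\<eta> * n)"
        unfolding n_def by (intro mult_right_mono of_nat_mono card_mono) (use finV \<eta> in auto)
      finally show ?thesis by (simp add: power2_eq_square mult.left_commute)
    qed
    have small: "real (card T) \<le> \<epsilon> / 6 * n ^ 2"
      if "T \<subseteq> R" "finite P" "\<phi> = (\<lambda>(w,u,v). (w,u)) \<or> \<phi> = (\<lambda>(w,u,v). (w,v))" "\<phi> ` T \<subseteq> P"
        "real (card P) \<le> \<eta> * n ^ 2" for T P and \<phi> :: "'a \<times> 'a \<times> 'a \<Rightarrow> 'a \<times> 'a"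
    proof -
      have "card T \<le> K * card P" by (rule card_light_cherries_fibre[OF _ that(2-4)]) (use that R_def in auto)
      then have "real (card T) \<le> real K * real (card P)" by (metis of_nat_le_iff of_nat_mult)
      also have "\<dots> \<le> real K * (\<eta> * n ^ 2)" using that(5) by (rule mult_left_mono) simp
      finally show ?thesis using K by (simp add: \<eta>_def)
    qed
    define Ra where "Ra = {(w,u,v)\<in>R. u \<notin> D}"
    define Rb where "Rb = {(w,u,v)\<in>R. v \<notin> D}"
    define Rc where "Rc = {(w,u,v)\<in>R. u \<in> D \<and> w \<notin> D2}"
    define Rd where "Rd = R - (Ra \<union> (Rb \<union> Rc))"
    have subR: "Ra \<subseteq> R" "Rb \<subseteq> R" "Rc \<subseteq> R" by (auto simp: Ra_def Rb_def Rc_def)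
    have "(\<lambda>(w,u,v). (w,u)) ` Ra \<subseteq> P1" "(\<lambda>(w,u,v). (w,v)) ` Rb \<subseteq> P1" "(\<lambda>(w,u,v). (w,u)) ` Rc \<subseteq> P2"
      using Rin E_sym by (force simp: Ra_def Rb_def Rc_def P1_def P2_def)+
    then have "real (card Ra) \<le> \<epsilon> / 6 * n ^ 2" "real (card Rb) \<le> \<epsilon> / 6 * n ^ 2" "real (card Rc) \<le> \<epsilon> / 6 * n ^ 2"
      by (intro small[OF _ finP(1) _ _ P1] small[OF _ finP(2) _ _ P2]; auto simp: Ra_def Rb_def Rc_def)+
    moreover have "card R \<le> card Rd + (card Ra + (card Rb + card Rc))"
    proof -
      have "R \<subseteq> Rd \<union> (Ra \<union> (Rb \<union> Rc))" by (auto simp: Rd_def)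
      then have "card R \<le> card (Rd \<union> (Ra \<union> (Rb \<union> Rc)))"
        by (rule card_mono[rotated]) (use finR finite_subset[OF subR(1) finR] finite_subset[OF subR(2) finR]
          finite_subset[OF subR(3) finR] in \<open>auto simp: Rd_def\<close>)
      also have "\<dots> \<le> card Rd + (card Ra + (card Rb + card Rc))"
        by (intro order_trans[OF card_Un_le] add_mono) auto
      finally show ?thesis .
    qed
    ultimately have Rd: "\<epsilon> / 2 * n ^ 2 < real (card Rd)" using R by linarith
    have RdR: "Rd \<subseteq> R" by (auto simp: Rd_def)
    have finRd: "finite Rd" using RdR finR by (rule finite_subset)
    have Rdin: "u \<in> D \<and> v \<in> D \<and> w \<in> D2" if "(w,u,v) \<in> Rd" for w u v
      using that by (auto simp: Rd_def Ra_def Rb_def Rc_def)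
    define W where "W u v = {w. (w,u,v) \<in> Rd}" for u v
    define Re where "Re = {(w,u,v)\<in>Rd. card (W u v) < K3}"
    have "card Re \<le> K3 * card {(u,v) \<in> V \<times> V. heavy K u v}"
    proof (rule card_le_fibres[where f = snd])
      show "finite Re" by (rule finite_subset[OF _ finRd]) (auto simp: Re_def)
      show "finite {(u,v) \<in> V \<times> V. heavy K u v}" by (rule finite_subset[of _ "V \<times> V"]) (use finV in auto)
      show "snd ` Re \<subseteq> {(u,v) \<in> V \<times> V. heavy K u v}" using Rin RdR by (auto simp: Re_def)
      fix p :: "'a \<times> 'a"
      obtain u v where p: "p = (u, v)" by (cases p)
      show "card {t\<in>Re. snd t = p} \<le> K3"
      proof (cases "card (W u v) < K3")
        case True
        have "finite (W u v)" unfolding W_def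
          by (rule finite_subset[of _ "fst ` Rd"]) (use finRd in force)+
        moreover have "fst ` {t\<in>Re. snd t = p} \<subseteq> W u v" by (auto simp: Re_def W_def p)
        moreover have "inj_on fst {t\<in>Re. snd t = p}" by (auto simp: inj_on_def)
        ultimately have "card {t\<in>Re. snd t = p} \<le> card (W u v)" by (intro card_inj_on_le)
        then show ?thesis using True by simp
      next
        case False
        then have "{t\<in>Re. snd t = p} = {}" by (auto simp: Re_def p)
        then show ?thesis by (simp only: card.empty)
      qed
    qed
    then have "real (card Re) \<le> real K3 * real (card {(u,v) \<in> V \<times> V. heavy K u v})"
      by (simp only: of_nat_mult[symmetric] of_nat_le_iff)
    also have "\<dots> \<le> real K3 * (\<gamma> * n ^ 2)" using hv by (intro mult_left_mono) (auto simp: n_def)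
    also have "\<dots> = \<epsilon> / 4 * n ^ 2" using K3 by (simp add: \<gamma>_def)
    finally have Re: "real (card Re) \<le> \<epsilon> / 4 * n ^ 2" .
    define Rf where "Rf = Rd - Re"
    have "Re \<subseteq> Rd" by (auto simp: Re_def)
    then have "card Rf = card Rd - card Re" "card Re \<le> card Rd"
      unfolding Rf_def using finRd by (auto intro!: card_Diff_subset card_mono intro: finite_subset)
    then have Rf: "\<epsilon> / 4 * n ^ 2 < real (card Rf)" using Rd Re by linarith
    have RfR: "Rf \<subseteq> Rd" by (auto simp: Rf_def)
    have finRf: "finite Rf" using RfR finRd by (rule finite_subset)
    define Q where "Q w = {p. (w, p) \<in> Rf}" for w
    have finQ: "finite (Q w)" for w
      unfolding Q_def by (rule finite_subset[of _ "snd ` Rf"]) (use finRf in force)+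
    have "\<exists>w\<in>V. \<epsilon> / 4 * n < real (card (Q w))"
    proof (rule ccontr)
      assume neg: "\<not> ?thesis"
      have "Rf = (SIGMA w:V. Q w)" using Rin RfR RdR by (force simp: Q_def)
      then have "real (card Rf) = (\<Sum>w\<in>V. real (card (Q w)))" using finQ finV by simp
      also have "\<dots> \<le> (\<Sum>w\<in>V. \<epsilon> / 4 * n)" by (rule sum_mono) (use neg in \<open>auto simp: not_less\<close>)
      also have "\<dots> = \<epsilon> / 4 * n ^ 2" by (simp add: n_def power2_eq_square)
      finally show False using Rf by simp
    qed
    then obtain w where w: "w \<in> V" "\<epsilon> / 4 * n < real (card (Q w))" by blast
    then have cQ: "4 * K * L1 \<le> card (Q w)" using n3 by linarith
    have Qin: "(w,u,v) \<in> R \<and> (w,u,v) \<in> Rf" if "(u,v) \<in> Q w" for u v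
      using that RfR RdR by (auto simp: Q_def)
    have cK: "card (N w \<inter> N a) \<le> K" if "light K w a" for a using that by (simp add: light_def)
    \<comment> \<open>\<open>Q w\<close> is viewed as a graph on the neighbourhood of
      \<open>w\<close>: a partner of \<open>a\<close> is a common neighbour of \<open>w\<close> and
      \<open>a\<close>, and the edge \<open>wa\<close> is light.\<close>
    have deg: "card {p\<in>Q w. fst p = a} \<le> K" "card {p\<in>Q w. snd p = a} \<le> K" for a
    proof -
      show "card {p\<in>Q w. fst p = a} \<le> K"
      proof (cases "{p\<in>Q w. fst p = a} = {}")
        case True
        then show ?thesis by (simp only: card.empty)
      next
        case False
        then have "light K w a" using Qin Rin by fastforce
        moreover have "snd ` {p\<in>Q w. fst p = a} \<subseteq> N w \<inter> N a" using Qin Rin by fastforce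
        moreover have "inj_on snd {p\<in>Q w. fst p = a}" by (auto simp: inj_on_def)
        ultimately show ?thesis using card_inj_on_le[of snd _ "N w \<inter> N a"] cK by (meson finN finite_Int order_trans)
      qed
      show "card {p\<in>Q w. snd p = a} \<le> K"
      proof (cases "{p\<in>Q w. snd p = a} = {}")
        case True
        then show ?thesis by (simp only: card.empty)
      next
        case False
        then have "light K w a" using Qin Rin by fastforce
        moreover have "fst ` {p\<in>Q w. snd p = a} \<subseteq> N w \<inter> N a" using Qin Rin E_sym by fastforce
        moreover have "inj_on fst {p\<in>Q w. snd p = a}" by (auto simp: inj_on_def)
        ultimately show ?thesis using card_inj_on_le[of fst _ "N w \<inter> N a"] cK by (meson finN finite_Int order_trans)
      qed
    qed
    obtain J0 where J0: "J0 \<subseteq> Q w" "card J0 = L1"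
      "\<forall>p\<in>J0. \<forall>q\<in>J0. p \<noteq> q \<longrightarrow> fst p \<noteq> fst q \<and> snd p \<noteq> snd q \<and> fst p \<noteq> snd q"
      using matching_in_bounded_degree[OF finQ deg cQ] K by (metis One_nat_def Suc_leI gr_zeroI not_less0)
    have "\<exists>J\<subseteq>J0. card J = r \<and> (\<forall>p\<in>J. \<forall>q\<in>J. p \<noteq> q \<longrightarrow>
       (\<eta> ^ 2) ^ 2 / 2 * real (card (V \<times> V)) \<le> real (card ((N (fst p) \<times> N (snd p)) \<inter> (N (fst q) \<times> N (snd q)))))"
    proof (rule L1)
      have "\<eta> ^ 2 * real (card (V \<times> V)) \<le> real (card (N (fst p) \<times> N (snd p)))" if "p \<in> J0" for p
      proof -
        obtain u v where p: "p = (u, v)" by (cases p)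
        have "(w,u,v) \<in> Rd" using that p J0(1) Qin RfR by blast
        then have "u \<in> D" "v \<in> D" using Rdin by auto
        then have "(\<eta> * n) * (\<eta> * n) \<le> real (card (N u)) * real (card (N v))"
          using \<eta> a(4) by (intro mult_mono) (auto simp: D_def)
        then show ?thesis by (simp add: p card_cartesian_product n_def power2_eq_square algebra_simps)
      qed
      then show "finite (V \<times> V) \<and> finite J0 \<and> L1 \<le> card J0 \<and> V \<times> V \<noteq> {} \<and>
        (\<forall>p\<in>J0. N (fst p) \<times> N (snd p) \<subseteq> V \<times> V \<and> \<eta> ^ 2 * real (card (V \<times> V)) \<le> real (card (N (fst p) \<times> N (snd p))))"
        using finV J0(2) finite_subset[OF J0(1) finQ] E_V2 w(1) by auto
    qed
    then obtain J where J: "J \<subseteq> J0" "card J = r" and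
      Jcom: "\<And>p q. p \<in> J \<Longrightarrow> q \<in> J \<Longrightarrow> p \<noteq> q \<Longrightarrow>
         (\<eta> ^ 2) ^ 2 / 2 * real (card (V \<times> V)) \<le> real (card ((N (fst p) \<times> N (snd p)) \<inter> (N (fst q) \<times> N (snd q))))"
      by blast
    have JQ: "J \<subseteq> Q w" using J J0 by auto
    have finJ: "finite J" using JQ finQ by (rule finite_subset)
    have com: "M \<le> card (N (fst p) \<inter> N (fst q)) \<and> M \<le> card (N (snd p) \<inter> N (snd q))"
      if "p \<in> J" "q \<in> J" "p \<noteq> q" for p q
    proof -
      let ?x = "card (N (fst p) \<inter> N (fst q))" and ?y = "card (N (snd p) \<inter> N (snd q))"
      have "(N (fst p) \<times> N (snd p)) \<inter> (N (fst q) \<times> N (snd q)) = (N (fst p) \<inter> N (fst q)) \<times> (N (snd p) \<inter> N (snd q))" by auto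
      then have xy: "(\<eta> ^ 4 / 2 * n) * n \<le> real ?x * real ?y"
        using Jcom[OF that] by (simp add: card_cartesian_product n_def power2_eq_square power4_eq_xxxx)
      \<comment> \<open>Neither factor exceeds \<open>n\<close>, so a product of order
        \<open>n ^ 2\<close> makes both of order \<open>n\<close>.\<close>
      have "?x \<le> card V" "?y \<le> card V" using N_sub finV by (auto intro!: card_mono simp: subset_iff)
      then have "real ?x * real ?y \<le> real ?x * n" "real ?x * real ?y \<le> n * real ?y"
        by (auto simp: n_def intro!: mult_left_mono mult_right_mono)
      then have "(\<eta> ^ 4 / 2 * n) * n \<le> real ?x * n" "(\<eta> ^ 4 / 2 * n) * n \<le> real ?y * n" using xy by (simp_all add: mult.commute)
      then have "\<eta> ^ 4 / 2 * n \<le> real ?x" "\<eta> ^ 4 / 2 * n \<le> real ?y" using a(4) by (simp_all only: mult_le_cancel_right_pos)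
      then show ?thesis using n2 by linarith
    qed
    have "J \<noteq> {}" using J by (auto simp: r_def)
    then obtain u v where uv: "(u, v) \<in> J" by fastforce
    have uvRf: "(w,u,v) \<in> Rf" using uv JQ Qin by blast
    have uvR: "(w,u,v) \<in> R" using uv JQ Qin by blast
    note uvin = Rin[OF uvR]
    have uvne: "u \<noteq> v" using uvin E_ne by blast
    have cW: "K3 \<le> card (W u v)" using uvRf by (auto simp: Rf_def Re_def)
    have "has_theta E ps"
    proof (rule has_theta_robust[OF uvne])
      fix p assume p: "p \<in> set ps"
      have ple: "p \<le> sl" unfolding sl_def using p by (rule member_le_sum_list) simp
      have "p = 1 \<or> p = 2 \<or> (\<exists>j. p = 2 * j + 5) \<or> (\<exists>j. p = 2 * j + 4)"
        using ps[OF p] by presburger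
      then consider "p = 1" | "p = 2" | j where "p = 2 * j + 5" | j where "p = 2 * j + 4" by blast
      then show "robust_path E u v p (sum_list ps)"
      proof cases
        case 1
        then show ?thesis using uvin by (simp add: robust_path_edge)
      next
        case 2
        have "sum_list ps < card (N u \<inter> N v)" using uvin K by (simp add: heavy_def)
        then show ?thesis using 2 robust_path_two by simp
      next
        case 3
        show ?thesis unfolding 3
        proof (rule robust_path_odd_matching[OF finJ _ _ _ _ com uv])
          show "2 * sum_list ps + 2 * j + 8 < card J" "2 * sum_list ps + 2 * j + 8 < M"
            using ple 3 J by (auto simp: r_def M_def sl_def)
          show "fst p \<noteq> fst q \<and> snd p \<noteq> snd q \<and> fst p \<noteq> snd q" if "p \<in> J" "q \<in> J" "p \<noteq> q" for p q
            using that J0(3) J(1) by blast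
          show "E (fst p) (snd p)" if "p \<in> J" for p
            using that JQ Qin Rin by (metis prod.collapse subsetD)
        qed
      next
        case 4
        show ?thesis unfolding 4
        proof (rule robust_path_even_through[where W = "W u v" and D = D and \<eta> = \<eta> and L = L2 and r = r])
          have Win: "(w',u,v) \<in> Rd" if "w' \<in> W u v" for w' using that by (simp add: W_def)
          show "finite (W u v)" unfolding W_def
            by (rule finite_subset[of _ "fst ` Rd"]) (use finRd in force)+
          show "E u w' \<and> E w' v" if "w' \<in> W u v" for w'
            using Win[OF that] RdR Rin E_sym by blast
          show "\<eta> * real (card V) \<le> real (card (N w' \<inter> D))" if "w' \<in> W u v" for w'
            using Rdin[OF Win[OF that]] by (simp add: D2_def n_def)
          show "2 / \<eta> ^ 2 + real (sum_list ps) < real (card (W u v))"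
            using cW unfolding K3_def sl_def by linarith
          show "\<eta> * real (card V) \<le> real (card (N x))" if "x \<in> D" for x
            using that by (simp add: D_def n_def)
          show "2 * sum_list ps + 2 * j + 20 < r" using ple 4 by (simp add: r_def sl_def)
          show "real (2 * sum_list ps + 2 * j + 20) < \<eta> ^ 2 / 2 * real (card V)"
            using ple 4 n1 by (simp add: M_def n_def sl_def)
          show "real L2 < \<eta> ^ 2 / 2 * real (card V)" using n1 by (simp add: n_def)
        qed (rule \<eta> uvne L2; assumption)+
      qed
    qed
    then show False using free by simp
  qed
qed

text \<open>A triangle has no heavy edge, at least two of them, or exactly one; with the position of
  the apex this gives seven sets of triples, each of which may take a tenth of
  \<open>\<epsilon>\<close>. Heavy edges must be rare for two reasons, the heavy cherries and
  \<open>few_light_cherries\<close>, and \<open>\<gamma>'\<close> is the smaller of the two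
  requirements.\<close>

theorem theta_free_triangles_little_o:
  fixes \<epsilon> :: real
  assumes \<epsilon>: "\<epsilon> > 0" and ps: "\<And>p. p \<in> set ps \<Longrightarrow> 1 \<le> p \<and> p \<noteq> 3"
  shows "\<exists>n0. \<forall>(V::'a set) E. fin_graph V E \<and> n0 \<le> card V \<and> \<not> has_theta E ps \<longrightarrow>
     real (card (fin_graph.triangles E)) \<le> \<epsilon> * real (card V) ^ 2"
proof -
  define sl where "sl = sum_list ps"
  define K where "K = 2 * sl + 11"
  define s where "s = 2 * sl + 11"
  have s1: "s \<ge> 1" by (simp add: s_def)
  have e: "\<epsilon> / 10 > 0" using \<epsilon> by simp
  have KK: "2 * sum_list ps + 10 < K" by (simp add: K_def sl_def)
  obtain \<gamma> n1 where \<gamma>: "\<gamma> > 0" and n1: "\<And>(V::'a set) E. fin_graph V E \<and> n1 \<le> card V \<and> \<not> has_theta E ps \<and>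
     real (card {(u,v) \<in> V \<times> V. fin_graph.heavy E K u v}) \<le> \<gamma> * real (card V) ^ 2 \<Longrightarrow>
     real (card (fin_graph.light_cherries E K)) \<le> \<epsilon> / 10 * real (card V) ^ 2"
    using few_light_cherries[where ps = ps and 'a = 'a, OF e ps KK] by blast
  obtain n2 where n2: "\<And>(V::'a set) E. fin_graph V E \<and> n2 \<le> card V \<and>
     (\<forall>x y. E x y \<longrightarrow> card (fin_graph.N E x \<inter> fin_graph.N E y) \<le> K) \<Longrightarrow>
     real (card (fin_graph.triangles E)) \<le> \<epsilon> / 10 * real (card V) ^ 2"
    using few_triangles_if_bounded_codegree[OF e, of K, where 'a = 'a] by blast
  define \<gamma>' where "\<gamma>' = min \<gamma> (\<epsilon> / (40 * (real sl + 1)))"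
  have \<gamma>': "\<gamma>' > 0" "\<gamma>' \<le> \<gamma>" "4 * real sl * \<gamma>' \<le> \<epsilon> / 10"
  proof -
    show "\<gamma>' > 0" "\<gamma>' \<le> \<gamma>" using \<gamma> \<epsilon> by (auto simp: \<gamma>'_def)
    have "4 * real sl * \<gamma>' \<le> 4 * real sl * (\<epsilon> / (40 * (real sl + 1)))"
      unfolding \<gamma>'_def by (intro mult_left_mono) auto
    also have "\<dots> \<le> \<epsilon> / 10" using \<epsilon> by (simp add: field_simps)
    finally show "4 * real sl * \<gamma>' \<le> \<epsilon> / 10" .
  qed
  \<comment> \<open>Once the \<open>s\<close>-th root of \<open>n\<close> reaches \<open>b\<close>,
    the Kovari-Sos-Turan bound is at most \<open>\<gamma>' * n ^ 2\<close>.\<close>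
  define b where "b = 2 * real s ^ 2 / \<gamma>'"
  define n3 where "n3 = nat \<lceil>b ^ s\<rceil> + 1"
  show ?thesis
  proof (rule exI[of _ "n1 + n2 + n3"], intro allI impI, elim conjE)
    fix V :: "'a set" and E
    assume gr: "fin_graph V E" and n0: "n1 + n2 + n3 \<le> card V" and free: "\<not> has_theta E ps"
    interpret fin_graph V E by (rule gr)
    define n where "n = real (card V)"
    have n: "b ^ s \<le> n" "n > 0" using n0 unfolding n_def n3_def by linarith+
    have b: "b > 0" using \<gamma>' s1 by (simp add: b_def)
    have "b = (b ^ s) powr (1 / real s)"
      using b s1 by (simp add: powr_realpow[symmetric] powr_powr)
    also have "\<dots> \<le> n powr (1 / real s)" using n b by (intro powr_mono2) auto
    finally have bn: "b \<le> n powr (1 / real s)" .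
    have "n powr (2 - 1 / real s) = n ^ 2 / n powr (1 / real s)"
      using n by (simp add: powr_diff)
    also have "\<dots> \<le> n ^ 2 / b" using bn b n by (intro divide_left_mono mult_pos_pos) auto
    finally have "2 * real s ^ 2 * n powr (2 - 1 / real s) \<le> 2 * real s ^ 2 * (n ^ 2 / b)"
      by (rule mult_left_mono) simp
    also have "\<dots> = \<gamma>' * n ^ 2" using s1 \<gamma>' by (simp add: b_def)
    finally have nb: "2 * real s ^ 2 * n powr (2 - 1 / real s) \<le> \<gamma>' * n ^ 2" .
    have "real (card {(u,v) \<in> V \<times> V. heavy K u v}) \<le> 2 * real s ^ 2 * real (card V) powr (2 - 1 / real s)"
    proof (rule kovari_sos_turan[OF finV s1], rule notI)
      assume "\<exists>A\<subseteq>V. \<exists>B\<subseteq>V. card A = s \<and> card B = s \<and> (\<forall>a\<in>A. \<forall>b\<in>B. heavy K a b)"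
      then obtain A B where AB: "A \<subseteq> V" "B \<subseteq> V" "card A = s" "card B = s" "\<forall>a\<in>A. \<forall>b\<in>B. heavy K a b" by blast
      have "has_theta E ps"
      proof (rule has_theta_heavy_biclique)
        show "finite A" "finite B" using AB finV by (auto intro: finite_subset)
        show "s \<le> card A" "s \<le> card B" using AB by auto
      qed (use AB ps in \<open>auto simp: K_def s_def sl_def\<close>)
      then show False using free by simp
    qed
    then have hv: "real (card {(u,v) \<in> V \<times> V. heavy K u v}) \<le> \<gamma>' * n ^ 2" using nb by (simp add: n_def)
    have lc: "real (card (light_cherries K)) \<le> \<epsilon> / 10 * n ^ 2"
    proof -
      have "\<gamma>' * n ^ 2 \<le> \<gamma> * n ^ 2" using \<gamma>' by (intro mult_right_mono) auto
      then show ?thesis using n1[of V E] gr n0 free hv by (simp add: n_def)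
    qed
    have "card (heavy_cherries K) \<le> 4 * sl * card {(u,v) \<in> V \<times> V. heavy K u v}"
      unfolding heavy_cherries_def sl_def
      by (rule theta_free_cherries[OF free]) (use ps in \<open>auto simp: heavy_def\<close>)
    then have "real (card (heavy_cherries K)) \<le> real (4 * sl * card {(u,v) \<in> V \<times> V. heavy K u v})"
      by (rule of_nat_mono)
    also have "\<dots> = 4 * real sl * real (card {(u,v) \<in> V \<times> V. heavy K u v})" by simp
    also have "\<dots> \<le> 4 * real sl * (\<gamma>' * n ^ 2)" using hv by (intro mult_left_mono) auto
    also have "\<dots> \<le> \<epsilon> / 10 * n ^ 2" using mult_right_mono[OF \<gamma>'(3), of "n ^ 2"] by (simp add: mult.assoc)
    finally have hc: "real (card (heavy_cherries K)) \<le> \<epsilon> / 10 * n ^ 2" .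
    interpret light: fin_graph V "light K"
    proof
      show "finite V" by (rule finV)
      show "x \<in> V" if "light K x y" for x y using that E_V by (auto simp: light_def)
      show "light K y x" if "light K x y" for x y using that by (rule light_sym)
      show "\<not> light K x x" for x using E_irrefl by (simp add: light_def)
    qed
    have lt: "real (card light.triangles) \<le> \<epsilon> / 10 * n ^ 2"
      unfolding n_def
    proof (rule n2, intro conjI allI impI)
      show "fin_graph V (light K)" by unfold_locales
      show "n2 \<le> card V" using n0 by simp
      fix x y assume "light K x y"
      then have "card (N x \<inter> N y) \<le> K" by (simp add: light_def)
      moreover have "light.N x \<inter> light.N y \<subseteq> N x \<inter> N y" by (auto simp: light.N_def light_def)
      then have "card (light.N x \<inter> light.N y) \<le> card (N x \<inter> N y)" by (rule card_mono[rotated]) simp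
      ultimately show "card (light.N x \<inter> light.N y) \<le> K" by simp
    qed
    \<comment> \<open>These permutations move the apex from the first place to the second and to the
      third.\<close>
    let ?f = "\<lambda>(w,x,y). (x,w,y)" and ?g = "\<lambda>(w,x,y). (x,y,w)"
    let ?H = "heavy_cherries K" and ?L = "light_cherries K"
    have split: "heavy K x y \<or> light K x y" if "E x y" for x y using that by (auto simp: heavy_def light_def)
    have "triangles \<subseteq> light.triangles \<union> ((?H \<union> (?f ` ?H \<union> ?g ` ?H)) \<union> (?L \<union> (?f ` ?L \<union> ?g ` ?L)))"
    proof
      fix t assume t: "t \<in> triangles"
      obtain x y z where txyz: "t = (x,y,z)" by (cases t)
      have E: "E x y" "E x z" "E y z" using t by (auto simp: txyz triangles_def)
      have H: "t \<in> ?H" if "heavy K x y" "heavy K x z" using that E by (simp add: txyz heavy_cherries_def)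
      have fH: "t \<in> ?f ` ?H" if "heavy K x y" "heavy K y z"
        using heavy_sym[OF that(1)] that(2) E by (intro image_eqI[of _ _ "(y,x,z)"]) (auto simp: txyz heavy_cherries_def)
      have gH: "t \<in> ?g ` ?H" if "heavy K x z" "heavy K y z"
        using heavy_sym[OF that(1)] heavy_sym[OF that(2)] E by (intro image_eqI[of _ _ "(z,x,y)"]) (auto simp: txyz heavy_cherries_def)
      have L: "t \<in> ?L" if "light K x y" "light K x z" "heavy K y z" using that by (simp add: txyz light_cherries_def)
      have fL: "t \<in> ?f ` ?L" if "light K x y" "heavy K x z" "light K y z"
        using light_sym[OF that(1)] that by (intro image_eqI[of _ _ "(y,x,z)"]) (auto simp: txyz light_cherries_def)
      have gL: "t \<in> ?g ` ?L" if "heavy K x y" "light K x z" "light K y z"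
        using light_sym[OF that(2)] light_sym[OF that(3)] that by (intro image_eqI[of _ _ "(z,x,y)"]) (auto simp: txyz light_cherries_def)
      have T: "t \<in> light.triangles" if "light K x y" "light K x z" "light K y z"
        using that by (simp add: txyz light.triangles_def)
      show "t \<in> light.triangles \<union> ((?H \<union> (?f ` ?H \<union> ?g ` ?H)) \<union> (?L \<union> (?f ` ?L \<union> ?g ` ?L)))"
        using split[OF E(1)] split[OF E(2)] split[OF E(3)] H fH gH L fL gL T by blast
    qed
    moreover have fin: "finite ?H" "finite ?L" using cherries_sub[of K] fin_triangles by (auto intro: finite_subset)
    ultimately have "card triangles \<le> card (light.triangles \<union> ((?H \<union> (?f ` ?H \<union> ?g ` ?H)) \<union> (?L \<union> (?f ` ?L \<union> ?g ` ?L))))"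
      using light.fin_triangles by (intro card_mono) auto
    also have "\<dots> \<le> card light.triangles + ((card ?H + (card ?H + card ?H)) + (card ?L + (card ?L + card ?L)))"
      by (intro order_trans[OF card_Un_le] add_mono card_image_le fin order_refl)
    finally have "real (card triangles) \<le> real (card light.triangles) + ((real (card ?H) + (real (card ?H) + real (card ?H))) +
       (real (card ?L) + (real (card ?L) + real (card ?L))))"
      by (simp only: of_nat_add[symmetric] of_nat_le_iff)
    also have "\<dots> \<le> 7 * (\<epsilon> / 10 * n ^ 2)" using lt hc lc by linarith
    also have "\<dots> \<le> \<epsilon> * n ^ 2" using \<epsilon> by simp
    finally show "real (card triangles) \<le> \<epsilon> * real (card V) ^ 2" by (simp add: n_def)
  qed
qed

subsection \<open>Copies and embeddings\<close>

definition adj :: "'a graph \<Rightarrow> 'a \<Rightarrow> 'a \<Rightarrow> bool" where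
  "adj G x y \<longleftrightarrow> {x, y} \<in> edges G"

lemma adj_sym: "adj G x y \<Longrightarrow> adj G y x"
  by (simp add: adj_def insert_commute)

lemma fin_graph_adj:
  assumes "simple_graph G"
  shows "fin_graph (verts G) (adj G)"
proof
  show "finite (verts G)" using assms by (simp add: simple_graph_def)
  show "x \<in> verts G" if "adj G x y" for x y using assms that by (auto simp: simple_graph_def adj_def)
  show "adj G y x" if "adj G x y" for x y using that by (rule adj_sym)
  show "\<not> adj G x x" for x using assms by (auto simp: simple_graph_def adj_def)
qed

lemma adj_ne: "simple_graph G \<Longrightarrow> adj G x y \<Longrightarrow> x \<noteq> y"
  by (auto simp: simple_graph_def adj_def)

lemma contains_embedding:
  assumes "contains G F" "simple_graph F"
  shows "\<exists>f. inj_on f (verts F) \<and> f ` verts F \<subseteq> verts G \<and> (\<forall>e\<in>edges F. f ` e \<in> edges G)"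
proof -
  obtain S where S: "subgraph S G" "isomorphic S F" using assms by (auto simp: contains_def copies_def)
  then obtain g where g: "bij_betw g (verts S) (verts F)" "edges F = (\<lambda>e. g ` e) ` edges S"
    by (auto simp: isomorphic_def)
  define f where "f = inv_into (verts S) g"
  have f: "bij_betw f (verts F) (verts S)" unfolding f_def by (rule bij_betw_inv_into[OF g(1)])
  have "f ` e \<in> edges G" if "e \<in> edges F" for e
  proof -
    from that have "e \<in> (\<lambda>e. g ` e) ` edges S" unfolding g(2) .
    then obtain e' where e': "e' \<in> edges S" "e = g ` e'" by blast
    have "e' \<subseteq> verts S" using S e' by (auto simp: subgraph_def simple_graph_def)
    then have "f ` e = e'" using e' g(1) unfolding f_def by (simp add: bij_betw_def inv_into_image_cancel)
    then show ?thesis using S e' by (auto simp: subgraph_def)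
  qed
  moreover have "f ` verts F \<subseteq> verts G" using f S by (auto simp: bij_betw_def subgraph_def)
  ultimately show ?thesis using f by (intro exI[of _ f]) (auto simp: bij_betw_def)
qed

lemma contains_if_embedding:
  assumes F: "simple_graph F" and f: "inj_on f (verts F)" "f ` verts F \<subseteq> verts G"
    "\<And>e. e \<in> edges F \<Longrightarrow> f ` e \<in> edges G"
  shows "contains G F"
proof -
  define S where "S = (f ` verts F, (\<lambda>e. f ` e) ` edges F)"
  have e: "e \<subseteq> verts F" "card e = 2" if "e \<in> edges F" for e using F that by (auto simp: simple_graph_def)
  have "card (f ` e) = 2" if "e \<in> edges F" for e
    using e[OF that] f(1) by (simp add: card_image inj_on_subset)
  then have "simple_graph S" using F e by (auto simp: simple_graph_def S_def)
  then have "subgraph S G" using f by (auto simp: subgraph_def S_def)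
  moreover have "isomorphic S F"
    unfolding isomorphic_def
  proof (intro exI[of _ "inv_into (verts F) f"] conjI)
    show "bij_betw (inv_into (verts F) f) (verts S) (verts F)"
      using f(1) by (simp add: S_def bij_betw_inv_into bij_betw_imageI)
    have "inv_into (verts F) f ` f ` e = e" if "e \<in> edges F" for e
      using e[OF that] f(1) by (simp add: inv_into_image_cancel)
    then show "edges F = (\<lambda>e. inv_into (verts F) f ` e) ` edges S" by (simp add: S_def image_image)
  qed
  ultimately show ?thesis unfolding contains_def copies_def by blast
qed

lemma contains_trans:
  assumes "contains G H" "contains H F" "simple_graph H" "simple_graph F"
  shows "contains G F"
proof -
  obtain f where f: "inj_on f (verts H)" "f ` verts H \<subseteq> verts G" "\<forall>e\<in>edges H. f ` e \<in> edges G"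
    using contains_embedding[OF assms(1,3)] by blast
  obtain g where g: "inj_on g (verts F)" "g ` verts F \<subseteq> verts H" "\<forall>e\<in>edges F. g ` e \<in> edges H"
    using contains_embedding[OF assms(2,4)] by blast
  show ?thesis
  proof (rule contains_if_embedding[OF assms(4), of "f \<circ> g"])
    show "inj_on (f \<circ> g) (verts F)" using f g by (intro comp_inj_on) (auto intro: inj_on_subset)
    show "(f \<circ> g) ` verts F \<subseteq> verts G" using f(2) g(2) by (auto simp: image_subset_iff)
    show "(f \<circ> g) ` e \<in> edges G" if "e \<in> edges F" for e
      using f(3) g(3) that unfolding image_comp[symmetric] by blast
  qed
qed

definition triangle_graph :: "'a \<Rightarrow> 'a \<Rightarrow> 'a \<Rightarrow> 'a graph" where
  "triangle_graph a b c = ({a, b, c}, {{a, b}, {a, c}, {b, c}})"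

lemma complete_graph_3: "complete_graph 3 = triangle_graph 0 1 2"
proof -
  have "{e. e \<subseteq> {0, 1, 2 :: nat} \<and> card e = 2} = {{0, 1}, {0, 2}, {1, 2}}"
  proof
    show "{e. e \<subseteq> {0, 1, 2 :: nat} \<and> card e = 2} \<subseteq> {{0, 1}, {0, 2}, {1, 2}}"
      by (auto simp: card_2_iff doubleton_eq_iff)
  qed auto
  moreover have "{..<3} = {0, 1, 2 :: nat}" by auto
  ultimately show ?thesis by (simp add: complete_graph_def triangle_graph_def)
qed

lemma copies_triangle:
  assumes "simple_graph G"
  shows "copies (complete_graph 3) G = (\<lambda>(a,b,c). triangle_graph a b c) ` fin_graph.triangles (adj G)"
proof -
  interpret fin_graph "verts G" "adj G" using assms by (rule fin_graph_adj)
  show ?thesis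
  proof (intro equalityI subsetI)
    fix S assume "S \<in> copies (complete_graph 3) G"
    then have S: "subgraph S G" "isomorphic S (complete_graph 3)" by (auto simp: copies_def)
    then obtain g where g: "bij_betw g (verts S) {0, 1, 2 :: nat}"
      "{{0, 1}, {0, 2}, {1, 2}} = (\<lambda>e. g ` e) ` edges S"
      by (auto simp: isomorphic_def complete_graph_3 triangle_graph_def)
    define f where "f = inv_into (verts S) g"
    have f: "bij_betw f {0, 1, 2} (verts S)" unfolding f_def by (rule bij_betw_inv_into[OF g(1)])
    have "f ` g ` e = e" if "e \<in> edges S" for e
    proof -
      have "e \<subseteq> verts S" using S that by (auto simp: subgraph_def simple_graph_def)
      then show ?thesis unfolding f_def using g(1) by (simp add: bij_betw_def inv_into_image_cancel)
    qed
    then have "edges S = (\<lambda>e. f ` e) ` ((\<lambda>e. g ` e) ` edges S)" by (simp add: image_image)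
    also have "\<dots> = {{f 0, f 1}, {f 0, f 2}, {f 1, f 2}}" by (simp add: g(2)[symmetric])
    finally have eS: "edges S = {{f 0, f 1}, {f 0, f 2}, {f 1, f 2}}" .
    have "verts S = f ` {0, 1, 2}" using f by (simp add: bij_betw_def)
    then have "S = triangle_graph (f 0) (f 1) (f 2)" using eS by (simp add: triangle_graph_def prod_eq_iff)
    moreover have "(f 0, f 1, f 2) \<in> triangles" using S(1) eS by (auto simp: triangles_def adj_def subgraph_def)
    ultimately show "S \<in> (\<lambda>(a,b,c). triangle_graph a b c) ` triangles" by force
  next
    fix S assume "S \<in> (\<lambda>(a,b,c). triangle_graph a b c) ` triangles"
    then obtain a b c where S: "S = triangle_graph a b c" and t: "(a,b,c) \<in> triangles" by auto
    have E: "adj G a b" "adj G a c" "adj G b c" using t by (auto simp: triangles_def)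
    then have ne: "a \<noteq> b" "a \<noteq> c" "b \<noteq> c" using E_ne by blast+
    have V: "a \<in> verts G" "b \<in> verts G" "c \<in> verts G" using E E_V E_V2 by blast+
    have "simple_graph S" using ne by (simp add: S triangle_graph_def simple_graph_def)
    then have "subgraph S G" using V E by (auto simp: subgraph_def S triangle_graph_def adj_def)
    moreover have "isomorphic S (complete_graph 3)"
      unfolding isomorphic_def
    proof (intro exI[of _ "\<lambda>x. if x = a then 0 else if x = b then 1 else (2::nat)"] conjI)
      show "bij_betw (\<lambda>x. if x = a then 0 else if x = b then 1 else 2) (verts S) (verts (complete_graph 3))"
        using ne by (auto simp: bij_betw_def inj_on_def S triangle_graph_def complete_graph_3)
    qed (use ne in \<open>auto simp: S triangle_graph_def complete_graph_3\<close>)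
    ultimately show "S \<in> copies (complete_graph 3) G" by (simp add: copies_def)
  qed
qed

lemma card_copies_triangle_le:
  assumes "simple_graph G"
  shows "card (copies (complete_graph 3) G) \<le> card (fin_graph.triangles (adj G))"
proof -
  interpret fin_graph "verts G" "adj G" using assms by (rule fin_graph_adj)
  show ?thesis unfolding copies_triangle[OF assms] by (rule card_image_le[OF fin_triangles])
qed

lemma card_copies_triangle_ge:
  assumes "simple_graph G" "T \<subseteq> fin_graph.triangles (adj G)" "inj_on (\<lambda>(a,b,c). triangle_graph a b c) T"
  shows "card T \<le> card (copies (complete_graph 3) G)"
proof -
  interpret fin_graph "verts G" "adj G" using assms(1) by (rule fin_graph_adj)
  have "card T = card ((\<lambda>(a,b,c). triangle_graph a b c) ` T)" using assms(3) by (rule card_image[symmetric])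
  also have "\<dots> \<le> card (copies (complete_graph 3) G)"
    unfolding copies_triangle[OF assms(1)] using fin_triangles assms(2) by (intro card_mono image_mono) auto
  finally show ?thesis .
qed

lemma gen_turan_attained:
  assumes "edges F \<noteq> {}"
  obtains G :: "nat graph" where "simple_graph G" "card (verts G) = n" "\<not> contains G F"
    "gen_turan n T F = card (copies T G)"
proof -
  have "gen_turan n T F \<in> copy_counts n T F"
    unfolding gen_turan_def using finite_copy_counts copy_counts_nonempty[OF assms] by (rule Max_in)
  then show ?thesis using that unfolding copy_counts_def by blast
qed

lemma gen_turan_ge:
  assumes "simple_graph (G :: nat graph)" "card (verts G) = n" "\<not> contains G F"
  shows "card (copies T G) \<le> gen_turan n T F"
proof -
  have "card (copies T G) \<in> copy_counts n T F" unfolding copy_counts_def using assms by blast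
  then show ?thesis unfolding gen_turan_def using finite_copy_counts by (intro Max_ge)
qed

subsection \<open>Theta graphs as subgraphs\<close>

lemma successively_nth: "successively P xs \<Longrightarrow> Suc i < length xs \<Longrightarrow> P (xs ! i) (xs ! Suc i)"
  by (induction P xs arbitrary: i rule: successively.induct) (auto simp: less_Suc_eq_0_disj)

lemma theta_lengths_ge_1: "theta_lengths ps \<Longrightarrow> p \<in> set ps \<Longrightarrow> 1 \<le> p"
  by (auto simp: theta_lengths_def)

lemma contains_theta_if_has_theta:
  assumes ps: "\<And>p. p \<in> set ps \<Longrightarrow> 1 \<le> p" and G: "simple_graph G" and th: "has_theta (adj G) ps"
  shows "contains G (theta_graph ps)"
proof -
  interpret fin_graph "verts G" "adj G" using G by (rule fin_graph_adj)
  obtain u v xss where uv: "u \<noteq> v" and xss: "\<And>i. i < length ps \<Longrightarrow> inner_path (adj G) u v (ps ! i) {} (xss i)"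
    and disj: "\<And>i j. i < length ps \<Longrightarrow> j < length ps \<Longrightarrow> i \<noteq> j \<Longrightarrow> set (xss i) \<inter> set (xss j) = {}"
    using th unfolding has_theta_def by blast
  \<comment> \<open>Inner vertices are numbered from 1 along a path, list positions from 0.\<close>
  define f where "f x = (case x of End1 \<Rightarrow> u | End2 \<Rightarrow> v | Inner i j \<Rightarrow> xss i ! (j - 1))" for x
  have pos: "1 \<le> ps ! i" if "i < length ps" for i using ps that by simp
  have len: "length (xss i) = ps ! i - 1" if "i < length ps" for i
    using xss[OF that] by (auto simp: inner_path_def)
  have f_tv: "f (theta_vertex ps i j) = (u # xss i @ [v]) ! j" if "i < length ps" "j \<le> ps ! i" for i j
    using that pos[OF that(1)] len[OF that(1)]
    by (auto simp: theta_vertex_def f_def nth_Cons' nth_append)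
  have edge: "f ` e \<in> edges G" if "e \<in> edges (theta_graph ps)" for e
  proof -
    obtain i j where ij: "i < length ps" "j < ps ! i" "e = {theta_vertex ps i j, theta_vertex ps i (Suc j)}"
      using \<open>e \<in> edges (theta_graph ps)\<close> by (auto simp: theta_graph_def)
    have "adj G ((u # xss i @ [v]) ! j) ((u # xss i @ [v]) ! Suc j)"
      using xss[OF ij(1)] ij len[OF ij(1)] by (intro successively_nth[of "adj G" "u # xss i @ [v]" j]) (auto simp: inner_path_def)
    then show ?thesis using f_tv[of i j] f_tv[of i "Suc j"] ij by (simp add: adj_def)
  qed
  show ?thesis
  proof (rule contains_if_embedding[OF simple_graph_theta_graph _ _ edge])
    have inner: "xss i ! (j - 1) \<in> set (xss i)" if "i < length ps" "0 < j" "j < ps ! i" for i j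
      using that len[OF that(1)] by (intro nth_mem) auto
    have vert: "x = End1 \<or> x = End2 \<or> (\<exists>i j. i < length ps \<and> 0 < j \<and> j < ps ! i \<and> x = Inner i j)"
      if x: "x \<in> verts (theta_graph ps)" for x
    proof -
      obtain i j where "i < length ps" "j \<le> ps ! i" "x = theta_vertex ps i j"
        using x unfolding theta_graph_def fst_conv by blast
      then show ?thesis by (cases "j = 0"; cases "j = ps ! i") (auto simp: theta_vertex_def)
    qed
    have uvx: "u \<notin> set (xss i)" "v \<notin> set (xss i)" "distinct (xss i)" if "i < length ps" for i
      using xss[OF that] by (auto simp: inner_path_def)
    have ne: "u \<noteq> xss i ! (j - 1)" "v \<noteq> xss i ! (j - 1)" if "i < length ps" "0 < j" "j < ps ! i" for i j
      using inner[OF that] uvx[OF that(1)] by metis+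
    have inn: "i = i' \<and> j = j'" if "i < length ps" "0 < j" "j < ps ! i" "i' < length ps" "0 < j'" "j' < ps ! i'"
      "xss i ! (j - 1) = xss i' ! (j' - 1)" for i j i' j'
    proof -
      have "i = i'" using inner[OF that(1-3)] inner[OF that(4-6)] that(7) disj[OF that(1,4)] by fastforce
      moreover have "j - 1 = j' - 1"
        using that \<open>i = i'\<close> uvx(3)[OF that(1)] len[OF that(1)] by (subst nth_eq_iff_index_eq[symmetric]) auto
      ultimately show ?thesis using that by simp
    qed
    show "inj_on f (verts (theta_graph ps))"
    proof (rule inj_onI)
      fix x y assume xy: "x \<in> verts (theta_graph ps)" "y \<in> verts (theta_graph ps)" "f x = f y"
      show "x = y"
        using vert[OF xy(1)] vert[OF xy(2)]
      proof (elim disjE exE conjE)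
        fix i j i' j' assume "i < length ps" "0 < j" "j < ps ! i" "x = Inner i j"
          "i' < length ps" "0 < j'" "j' < ps ! i'" "y = Inner i' j'"
        then show ?thesis using inn[of i j i' j'] xy(3) by (simp add: f_def)
      qed (use xy(3) uv ne in \<open>auto simp: f_def\<close>)
    qed
    show "f ` verts (theta_graph ps) \<subseteq> verts G"
    proof
      fix y assume "y \<in> f ` verts (theta_graph ps)"
      then obtain i j where ij: "i < length ps" "j \<le> ps ! i" "y = f (theta_vertex ps i j)"
        by (auto simp: theta_graph_def)
      show "y \<in> verts G"
      proof (cases "j = 0")
        case True
        have "{theta_vertex ps i 0, theta_vertex ps i (Suc 0)} \<in> edges (theta_graph ps)"
          unfolding theta_graph_def snd_conv using ij(1) pos[OF ij(1)] by force
        from edge[OF this] have "adj G y (f (theta_vertex ps i (Suc 0)))" using True ij(3) by (simp add: adj_def)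
        then show ?thesis by (rule E_V)
      next
        case False
        then have "{theta_vertex ps i (j - 1), theta_vertex ps i (Suc (j - 1))} \<in> edges (theta_graph ps)"
          unfolding theta_graph_def snd_conv using ij by force
        from edge[OF this] have "adj G (f (theta_vertex ps i (j - 1))) y" using False ij(3) by (simp add: adj_def)
        then show ?thesis by (rule E_V2)
      qed
    qed
  qed
qed

lemma adj_theta_iff:
  "adj (theta_graph ps) x y \<longleftrightarrow> (\<exists>i j. i < length ps \<and> j < ps ! i \<and>
     (x = theta_vertex ps i j \<and> y = theta_vertex ps i (Suc j) \<or> y = theta_vertex ps i j \<and> x = theta_vertex ps i (Suc j)))"
  unfolding adj_def theta_graph_def snd_conv by (auto simp: doubleton_eq_iff)

lemma adj_theta_Inner:
  assumes "adj (theta_graph ps) (Inner i j) y"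
  shows "i < length ps \<and> 0 < j \<and> j < ps ! i \<and> (y = theta_vertex ps i (j - 1) \<or> y = theta_vertex ps i (Suc j))"
  using assms unfolding adj_theta_iff by (auto simp: theta_vertex_def split: if_splits)

lemma adj_theta_Ends: "adj (theta_graph ps) End1 End2 \<Longrightarrow> 1 \<in> set ps"
  unfolding adj_theta_iff by (auto simp: theta_vertex_def in_set_conv_nth split: if_splits)

text \<open>An interior vertex has only its two neighbours along the path. If one of these is
  interior as well, its own neighbours lie along the same path and do not include the other; so both
  are ends, which means a path of length 2 over an edge between the ends.\<close>

lemma theta_triangle:
  assumes "adj (theta_graph ps) (Inner i j) y" "adj (theta_graph ps) (Inner i j) z" "adj (theta_graph ps) y z"
  shows "i < length ps \<and> ps ! i = 2 \<and> j = 1 \<and> {y, z} = {End1, End2} \<and> 1 \<in> set ps"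
proof -
  have yz: "y \<noteq> z" using assms(3) adj_ne[OF simple_graph_theta_graph] by blast
  note a = adj_theta_Inner[OF assms(1)] adj_theta_Inner[OF assms(2)]
  have ij: "i < length ps" "0 < j" "j < ps ! i" using a by auto
  have "{y, z} = {theta_vertex ps i (j - 1), theta_vertex ps i (Suc j)}" using a yz by auto
  then have adj: "adj (theta_graph ps) (theta_vertex ps i (j - 1)) (theta_vertex ps i (Suc j))"
    using assms(3) adj_sym[OF assms(3)] by (auto simp: doubleton_eq_iff)
  have j1: "j = 1"
  proof (rule ccontr)
    assume "j \<noteq> 1"
    then have "theta_vertex ps i (j - 1) = Inner i (j - 1)" using ij by (auto simp: theta_vertex_def)
    then have "adj (theta_graph ps) (Inner i (j - 1)) (theta_vertex ps i (Suc j))" using adj by simp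
    from adj_theta_Inner[OF this] show False using ij \<open>j \<noteq> 1\<close> by (auto simp: theta_vertex_def split: if_splits)
  qed
  have j2: "Suc j = ps ! i"
  proof (rule ccontr)
    assume "Suc j \<noteq> ps ! i"
    then have "theta_vertex ps i (Suc j) = Inner i (Suc j)" using ij by (auto simp: theta_vertex_def)
    then have "adj (theta_graph ps) (Inner i (Suc j)) (theta_vertex ps i (j - 1))" using adj adj_sym by metis
    from adj_theta_Inner[OF this] show False using ij j1 by (auto simp: theta_vertex_def split: if_splits)
  qed
  have "theta_vertex ps i (j - 1) = End1" "theta_vertex ps i (Suc j) = End2"
    using j1 j2 by (auto simp: theta_vertex_def)
  then show ?thesis using j1 j2 ij adj \<open>{y, z} = _\<close> adj_theta_Ends by auto
qed

lemma theta_triangle_graph: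
  assumes "t \<in> fin_graph.triangles (adj (theta_graph ps))" "t = (x, y, z)"
  shows "1 \<in> set ps \<and> (\<exists>i<length ps. ps ! i = 2 \<and> triangle_graph x y z = triangle_graph End1 End2 (Inner i 1))"
proof -
  interpret fin_graph "verts (theta_graph ps)" "adj (theta_graph ps)"
    by (rule fin_graph_adj[OF simple_graph_theta_graph])
  have t: "adj (theta_graph ps) x y" "adj (theta_graph ps) x z" "adj (theta_graph ps) y z"
    using assms by (auto simp: triangles_def)
  have t': "adj (theta_graph ps) y x" "adj (theta_graph ps) z x" "adj (theta_graph ps) z y"
    using t adj_sym by metis+
  have ne: "x \<noteq> y" "x \<noteq> z" "y \<noteq> z" using t E_ne by blast+
  have tg: "triangle_graph x y z = triangle_graph End1 End2 w" if "{a, b} = {End1, End2}"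
    "x = w \<and> y = a \<and> z = b \<or> y = w \<and> x = a \<and> z = b \<or> z = w \<and> x = a \<and> y = b" for a b w
    using that by (auto simp: triangle_graph_def doubleton_eq_iff)
  have "(\<exists>i j. x = Inner i j) \<or> (\<exists>i j. y = Inner i j) \<or> (\<exists>i j. z = Inner i j)"
    using ne by (cases x; cases y; cases z) auto
  then show ?thesis
  proof (elim disjE exE)
    fix i j assume "x = Inner i j"
    then show ?thesis using theta_triangle[of ps i j y z] t tg by blast
  next
    fix i j assume "y = Inner i j"
    then show ?thesis using theta_triangle[of ps i j x z] t t' tg by blast
  next
    fix i j assume "z = Inner i j"
    then show ?thesis using theta_triangle[of ps i j x y] t t' tg by blast
  qed
qed

lemma adj_theta_one: "1 \<in> set ps \<Longrightarrow> adj (theta_graph ps) End1 End2"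
  unfolding adj_theta_iff in_set_conv_nth
  by (elim exE conjE, rule_tac x = i in exI, rule_tac x = 0 in exI) (auto simp: theta_vertex_def)

lemma adj_theta_two:
  assumes "i < length ps" "ps ! i = 2"
  shows "adj (theta_graph ps) End1 (Inner i 1)" "adj (theta_graph ps) End2 (Inner i 1)"
proof -
  show "adj (theta_graph ps) End1 (Inner i 1)"
    unfolding adj_theta_iff using assms by (intro exI[of _ i] exI[of _ 0]) (auto simp: theta_vertex_def)
  show "adj (theta_graph ps) End2 (Inner i 1)"
    unfolding adj_theta_iff using assms by (intro exI[of _ i] exI[of _ 1]) (auto simp: theta_vertex_def)
qed

lemma triangle_graph_Inner_inj: "triangle_graph End1 End2 (Inner i 1) = triangle_graph End1 End2 (Inner i' 1) \<Longrightarrow> i = i'"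
  by (auto simp: triangle_graph_def)

lemma theta_at_most_one_triangle:
  assumes "card (copies (complete_graph 3) (theta_graph ps)) \<le> 1"
  shows "1 \<notin> set ps \<or> count_list ps 2 \<le> 1"
proof (rule ccontr)
  assume neg: "\<not> ?thesis"
  define I where "I = {i. i < length ps \<and> ps ! i = 2}"
  have "card I = count_list ps 2"
    unfolding I_def count_list_eq_length_filter length_filter_conv_card by (simp add: eq_commute)
  then have "2 \<le> card I" using neg by simp
  define T where "T = (\<lambda>i. (End1, End2, Inner i 1)) ` I"
  interpret fin_graph "verts (theta_graph ps)" "adj (theta_graph ps)"
    by (rule fin_graph_adj[OF simple_graph_theta_graph])
  have "card T \<le> card (copies (complete_graph 3) (theta_graph ps))"
  proof (rule card_copies_triangle_ge[OF simple_graph_theta_graph])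
    show "T \<subseteq> triangles" using neg adj_theta_one adj_theta_two by (auto simp: T_def I_def triangles_def)
    show "inj_on (\<lambda>(a,b,c). triangle_graph a b c) T"
      using triangle_graph_Inner_inj by (auto simp: inj_on_def T_def)
  qed
  moreover have "card T = card I" unfolding T_def by (rule card_image) (auto simp: inj_on_def)
  ultimately show False using \<open>2 \<le> card I\<close> assms by simp
qed

lemma theta_two_triangles:
  assumes "2 \<le> card (copies (complete_graph 3) (theta_graph ps))"
  shows "1 \<in> set ps \<and> (\<exists>i<length ps. \<exists>i'<length ps. i \<noteq> i' \<and> ps ! i = 2 \<and> ps ! i' = 2)"
proof -
  let ?C = "copies (complete_graph 3) (theta_graph ps)"
  obtain S S' where S: "S \<in> ?C" "S' \<in> ?C" "S \<noteq> S'"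
    using assms card_le_Suc0_iff_eq[of ?C] by (metis One_nat_def Suc_1 card.infinite not_less_eq_eq not_numeral_le_zero)
  have *: "1 \<in> set ps \<and> (\<exists>i<length ps. ps ! i = 2 \<and> S = triangle_graph End1 End2 (Inner i 1))" if "S \<in> ?C" for S
    using that theta_triangle_graph unfolding copies_triangle[OF simple_graph_theta_graph] by fastforce
  show ?thesis using *[OF S(1)] *[OF S(2)] S(3) by metis
qed

text \<open>Used in the contrapositive: two triangles already provide the lengths 1, 2 and 2, so
  excluding the theta graph with lengths 1, 2, 2, 3 forces 3 out of \<open>ps\<close>.\<close>

lemma theta_contains_1223:
  assumes "1 \<in> set ps" "i < length ps" "i' < length ps" "i \<noteq> i'" "ps ! i = 2" "ps ! i' = 2" "3 \<in> set ps"
  shows "contains (theta_graph ps) (theta_graph [1, 2, 2, 3])"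
proof -
  obtain i0 where i0: "i0 < length ps" "ps ! i0 = 1" using assms(1) by (auto simp: in_set_conv_nth)
  obtain i3 where i3: "i3 < length ps" "ps ! i3 = 3" using assms(7) by (auto simp: in_set_conv_nth)
  let ?qs = "[1, 2, 2, 3] :: nat list"
  define \<sigma> where "\<sigma> = (!) [i0, i, i', i3]"
  define f where "f x = (case x of End1 \<Rightarrow> End1 | End2 \<Rightarrow> End2 | Inner k j \<Rightarrow> Inner (\<sigma> k) j)" for x
  have k4: "k = 0 \<or> k = 1 \<or> k = 2 \<or> k = 3" if "k < 4" for k :: nat using that by auto
  have \<sigma>: "\<sigma> k < length ps \<and> ps ! \<sigma> k = ?qs ! k" if "k < 4" for k
    using k4[OF that] assms i0 i3 by (auto simp: \<sigma>_def)
  have inj: "k = k'" if "k < 4" "k' < 4" "\<sigma> k = \<sigma> k'" for k k'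
    using k4[OF that(1)] k4[OF that(2)] that(3) assms i0 i3 by (auto simp: \<sigma>_def)
  have f: "f (theta_vertex ?qs k j) = theta_vertex ps (\<sigma> k) j" if "k < 4" for k j
    using \<sigma>[OF that] by (auto simp: f_def theta_vertex_def)
  show ?thesis
  proof (rule contains_if_embedding[OF simple_graph_theta_graph, of f])
    have "x = End1 \<or> x = End2 \<or> (\<exists>k j. k < 4 \<and> x = Inner k j)" if x: "x \<in> verts (theta_graph ?qs)" for x
    proof -
      obtain k j where "k < length ?qs" "x = theta_vertex ?qs k j"
        using x unfolding theta_graph_def fst_conv by blast
      then show ?thesis by (cases "j = 0"; cases "j = ?qs ! k") (auto simp: theta_vertex_def)
    qed
    then show "inj_on f (verts (theta_graph ?qs))"
      using inj by (intro inj_onI) (auto simp: f_def split: tvertex.splits, metis tvertex.distinct tvertex.inject)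
    show "f ` verts (theta_graph ?qs) \<subseteq> verts (theta_graph ps)"
    proof
      fix y assume "y \<in> f ` verts (theta_graph ?qs)"
      then obtain k j where kj: "k < length ?qs" "j \<le> ?qs ! k" "y = f (theta_vertex ?qs k j)"
        unfolding theta_graph_def fst_conv by blast
      then have "k < 4" by simp
      then have "y = theta_vertex ps (\<sigma> k) j \<and> \<sigma> k < length ps \<and> j \<le> ps ! \<sigma> k"
        using f \<sigma>[of k] kj by simp
      then show "y \<in> verts (theta_graph ps)" unfolding theta_graph_def fst_conv by blast
    qed
    fix e assume "e \<in> edges (theta_graph ?qs)"
    then obtain k j where kj: "k < length ?qs" "j < ?qs ! k" "e = {theta_vertex ?qs k j, theta_vertex ?qs k (Suc j)}"
      unfolding theta_graph_def snd_conv by blast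
    then have "k < 4" by simp
    with kj have "f ` e = {theta_vertex ps (\<sigma> k) j, theta_vertex ps (\<sigma> k) (Suc j)} \<and> \<sigma> k < length ps \<and> j < ps ! \<sigma> k"
      using f \<sigma>[of k] by simp
    then show "f ` e \<in> edges (theta_graph ps)" unfolding theta_graph_def snd_conv by blast
  qed
qed

subsection \<open>Lower bound constructions\<close>

lemma embedding_adj:
  assumes "\<forall>e\<in>edges F. f ` e \<in> edges G" "adj F x y"
  shows "adj G (f x) (f y)"
  using assms unfolding adj_def by force

text \<open>The matching lives on the numbers below \<open>2 * m\<close>, with \<open>2 * i\<close>
  and \<open>2 * i + 1\<close> as mates, so being mates is equality of \<open>div 2\<close>.\<close>

definition matching_join :: "nat \<Rightarrow> nat \<Rightarrow> nat graph" where
  "matching_join m n = ({..<n}, {{2 * i, 2 * i + 1} | i. i < m} \<union> {{a, b} | a b. a < 2 * m \<and> 2 * m \<le> b \<and> b < n})"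

lemma adj_matching_joinD:
  "adj (matching_join m n) x y \<Longrightarrow>
     x < 2 * m \<and> y < 2 * m \<and> x div 2 = y div 2 \<and> x \<noteq> y \<or> x < 2 * m \<and> 2 * m \<le> y \<or> y < 2 * m \<and> 2 * m \<le> x"
  by (auto simp: adj_def matching_join_def doubleton_eq_iff)

text \<open>Let \<open>a\<close> and \<open>b\<close> be the images of the ends. If both lie in the
  matching part, they are mates, so the path of length 3 has both inner vertices in the independent
  set, although they are adjacent. If only one of them does, the apexes of both triangles are
  adjacent to the other one, hence lie in the matching part and are both its mate, although they are
  distinct.\<close>

lemma matching_join_no_1223: "\<not> contains (matching_join m n) (theta_graph [1, 2, 2, 3])"
proof
  let ?qs = "[1, 2, 2, 3] :: nat list" and ?G = "matching_join m n"
  let ?H = "theta_graph ?qs"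
  assume "contains ?G ?H"
  then obtain f where f: "inj_on f (verts ?H)" "\<forall>e\<in>edges ?H. f ` e \<in> edges ?G"
    using contains_embedding[OF _ simple_graph_theta_graph] by blast
  have e: "adj ?H (theta_vertex ?qs i j) (theta_vertex ?qs i (Suc j))" if "i < 4" "j < ?qs ! i" for i j
    unfolding adj_theta_iff using that by (intro exI[of _ i] exI[of _ j]) auto
  have H: "adj ?H End1 End2" "adj ?H End1 (Inner 1 1)" "adj ?H (Inner 1 1) End2"
    "adj ?H End1 (Inner 2 1)" "adj ?H (Inner 2 1) End2"
    "adj ?H End1 (Inner 3 1)" "adj ?H (Inner 3 1) (Inner 3 2)" "adj ?H (Inner 3 2) End2"
    using e[of 0 0] e[of 1 0] e[of 1 1] e[of 2 0] e[of 2 1] e[of 3 0] e[of 3 1] e[of 3 2]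
    by (simp_all add: theta_vertex_def numeral_eq_Suc)
  interpret H: fin_graph "verts ?H" "adj ?H" by (rule fin_graph_adj[OF simple_graph_theta_graph])
  have V: "End1 \<in> verts ?H" "End2 \<in> verts ?H" "Inner 1 1 \<in> verts ?H" "Inner 2 1 \<in> verts ?H"
    "Inner 3 1 \<in> verts ?H" "Inner 3 2 \<in> verts ?H"
    using H H.E_V H.E_V2 by blast+
  define a b c d x y where abcdxy: "a = f End1" "b = f End2" "c = f (Inner 1 1)" "d = f (Inner 2 1)"
    "x = f (Inner 3 1)" "y = f (Inner 3 2)"
  have ne: "c \<noteq> d" "a \<noteq> y" "b \<noteq> x"
    unfolding abcdxy using inj_on_eq_iff[OF f(1)] V by simp_all
  have G: "adj ?G a b" "adj ?G a c" "adj ?G c b" "adj ?G a d" "adj ?G d b" "adj ?G a x" "adj ?G x y" "adj ?G y b"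
    unfolding abcdxy by (rule embedding_adj[OF f(2)], rule H)+
  define L where "L p \<longleftrightarrow> p < 2 * m" for p
  have E: "L p \<and> L q \<and> p div 2 = q div 2 \<and> p \<noteq> q \<or> L p \<and> \<not> L q \<or> L q \<and> \<not> L p" if "adj ?G p q" for p q
    using adj_matching_joinD[OF that] by (simp add: L_def not_less)
  have mate: "p = q" if "adj ?G p r" "adj ?G q r" "L p" "L q" "L r" for p q r
  proof -
    have "p div 2 = r div 2" "q div 2 = r div 2" "p \<noteq> r" "q \<noteq> r" using E[OF that(1)] E[OF that(2)] that(3-5) by blast+
    moreover have "x = 2 * (x div 2) \<or> x = 2 * (x div 2) + 1" for x :: nat by presburger
    ultimately show ?thesis by metis
  qed
  show False
  proof (cases "L a \<and> L b")
    case True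
    have "\<not> L x" using mate[of b a x] G(1,6)[THEN adj_sym] True ne(3) by blast
    moreover have "\<not> L y" using mate[of a b y] G(1,8) True ne(2) by blast
    ultimately show False using E[OF G(7)] by blast
  next
    case False
    then consider "L a" "\<not> L b" | "L b" "\<not> L a" using E[OF G(1)] by blast
    then show False
    proof cases
      case 1
      then have "L c" "L d" using E[OF G(3)] E[OF G(5)] by blast+
      then show False using mate[of c a d] G(2,4)[THEN adj_sym] 1 ne(1) by blast
    next
      case 2
      then have "L c" "L d" using E[OF G(2)] E[OF G(4)] by blast+
      then show False using mate[of c b d] G(3,5) 2 ne(1) by blast
    qed
  qed
qed

lemma matching_join_triangles:
  assumes "2 * m \<le> n"
  shows "simple_graph (matching_join m n)" "m * (n - 2 * m) \<le> card (copies (complete_graph 3) (matching_join m n))"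
proof -
  let ?G = "matching_join m n"
  show G: "simple_graph ?G"
    using assms by (auto simp: simple_graph_def matching_join_def card_insert_if)
  interpret fin_graph "verts ?G" "adj ?G" by (rule fin_graph_adj[OF G])
  define T where "T = (\<lambda>(i, b). (2 * i, 2 * i + 1, b)) ` ({..<m} \<times> {2 * m..<n})"
  have "card T = m * (n - 2 * m)"
    unfolding T_def by (subst card_image) (auto simp: inj_on_def)
  moreover have "card T \<le> card (copies (complete_graph 3) ?G)"
  proof (rule card_copies_triangle_ge[OF G])
    show "T \<subseteq> triangles"
    proof
      fix t assume "t \<in> T"
      then obtain i b where t: "t = (2 * i, 2 * i + 1, b)" "i < m" "2 * m \<le> b" "b < n" by (auto simp: T_def)
      have "{2 * i, 2 * i + 1} \<in> edges ?G" using t(2) unfolding matching_join_def snd_conv by blast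
      moreover have "{c, b} \<in> edges ?G" if "c < 2 * m" for c
        using that t(3,4) unfolding matching_join_def snd_conv by blast
      ultimately show "t \<in> triangles" using t(1,2) by (simp add: triangles_def adj_def)
    qed
    show "inj_on (\<lambda>(a,b,c). triangle_graph a b c) T"
    proof (rule inj_onI)
      fix t t' assume "t \<in> T" "t' \<in> T" and eq: "(\<lambda>(a,b,c). triangle_graph a b c) t = (\<lambda>(a,b,c). triangle_graph a b c) t'"
      then obtain i b i' b' where t: "t = (2 * i, 2 * i + 1, b)" "t' = (2 * i', 2 * i' + 1, b')"
        "i < m" "2 * m \<le> b" "i' < m" "2 * m \<le> b'" by (auto simp: T_def)
      then have "{2 * i, 2 * i + 1, b} = {2 * i', 2 * i' + 1, b'}" using eq by (simp add: triangle_graph_def)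
      then have "2 * i \<in> {2 * i', 2 * i' + 1, b'}" "b \<in> {2 * i', 2 * i' + 1, b'}" by blast+
      then have "i = i' \<and> b = b'" using t(3-6) by auto
      then show "t = t'" using t by simp
    qed
  qed
  ultimately show "m * (n - 2 * m) \<le> card (copies (complete_graph 3) ?G)" by simp
qed

lemma gen_turan_quadratic_lower:
  assumes H: "contains H (theta_graph [1, 2, 2, 3])" "simple_graph H" and n: "n \<ge> 8"
  shows "real n ^ 2 / 16 \<le> real (gen_turan n (complete_graph 3) H)"
proof -
  \<comment> \<open>The number \<open>m * (n - 2 * m)\<close> of triangles is largest near this
    value.\<close>
  define m where "m = n div 4"
  have m: "2 * m \<le> n" by (simp add: m_def)
  have "\<not> contains (matching_join m n) H"
    using contains_trans[OF _ H simple_graph_theta_graph] matching_join_no_1223 by blast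
  then have "card (copies (complete_graph 3) (matching_join m n)) \<le> gen_turan n (complete_graph 3) H"
    by (intro gen_turan_ge matching_join_triangles m) (simp add: matching_join_def)
  with matching_join_triangles(2)[OF m] have "m * (n - 2 * m) \<le> gen_turan n (complete_graph 3) H" by simp
  then have "real (m * (n - 2 * m)) \<le> real (gen_turan n (complete_graph 3) H)" by (rule of_nat_mono)
  moreover have "(real n / 8) * (real n / 2) \<le> real m * real (n - 2 * m)"
  proof (rule mult_mono)
    have "n \<le> 8 * m" using n unfolding m_def by presburger
    then show "real n / 8 \<le> real m" by simp
    have "n \<le> 2 * (n - 2 * m)" unfolding m_def by presburger
    then show "real n / 2 \<le> real (n - 2 * m)" by simp
  qed auto
  ultimately show ?thesis by (simp add: power2_eq_square)
qed

text \<open>Behrend's idea: a sphere contains no three points in arithmetic progression.\<close>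

lemma progression_free_box_subset:
  assumes k: "k \<ge> 1" and d: "d \<ge> (1::nat)"
  shows "\<exists>A \<subseteq> PiE {..<k} (\<lambda>_. {..<d}). d ^ k \<le> card A * (k * d ^ 2) \<and>
     (\<forall>a\<in>A. \<forall>b\<in>A. \<forall>c\<in>A. (\<forall>i<k. a i + b i = 2 * c i) \<longrightarrow> a = b \<and> b = c)"
proof -
  define D where "D = PiE {..<k} (\<lambda>_. {..<d})"
  define q where "q a = (\<Sum>i<k. a i ^ 2)" for a :: "nat \<Rightarrow> nat"
  define F where "F r = {a\<in>D. q a = r}" for r
  have finD: "finite D" unfolding D_def by (rule finite_PiE) auto
  have cD: "card D = d ^ k" unfolding D_def by (subst card_PiE) auto
  let ?P = "{..<k * d ^ 2}"
  have qP: "q ` D \<subseteq> ?P"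
  proof
    fix r assume "r \<in> q ` D"
    then obtain a where a: "a \<in> D" "r = q a" by auto
    have "q a < (\<Sum>i<k. d ^ 2)"
      unfolding q_def
    proof (rule sum_strict_mono)
      fix i assume "i \<in> {..<k}"
      then have "a i < d" using a(1) by (auto simp: D_def)
      then show "a i ^ 2 < d ^ 2" by (intro power_strict_mono) auto
    qed (use k in \<open>auto simp: lessThan_empty_iff bot_nat_def\<close>)
    then show "r \<in> ?P" using a by simp
  qed
  have Pne: "?P \<noteq> {}" using k d by (simp add: lessThan_empty_iff bot_nat_def)
  define M where "M = Max ((\<lambda>r. card (F r)) ` ?P)"
  have "M \<in> (\<lambda>r. card (F r)) ` ?P" unfolding M_def using Pne by (intro Max_in) auto
  then obtain r where r: "M = card (F r)" by auto
  have "card (F s) \<le> M" if "s \<in> ?P" for s unfolding M_def using that by (intro Max_ge) auto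
  then have "card D \<le> M * card ?P"
    by (intro card_le_fibres[OF finD _ qP]) (auto simp: F_def)
  then have "d ^ k \<le> card (F r) * (k * d ^ 2)" using cD r by simp
  moreover have "a = b \<and> b = c" if abc: "a \<in> F r" "b \<in> F r" "c \<in> F r" "\<forall>i<k. a i + b i = 2 * c i" for a b c
  proof -
    have q: "(\<Sum>i<k. real (e i) ^ 2) = real r" if "e \<in> F r" for e
    proof -
      have "real (q e) = real r" using that by (simp add: F_def)
      then show ?thesis by (simp add: q_def)
    qed
    \<comment> \<open>The parallelogram identity: with \<open>c\<close> as midpoint of
      \<open>a\<close> and \<open>b\<close>, equal norms leave no room for a nonzero
      difference.\<close>
    have "(\<Sum>i<k. (real (a i) - real (b i)) ^ 2) = (\<Sum>i<k. 2 * real (a i) ^ 2 + 2 * real (b i) ^ 2 - 4 * real (c i) ^ 2)"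
    proof (rule sum.cong)
      fix i assume "i \<in> {..<k}"
      then have "a i + b i = 2 * c i" using abc(4) by simp
      then have "real (a i) + real (b i) = 2 * real (c i)" by (metis of_nat_add of_nat_mult of_nat_numeral)
      then have c: "real (c i) = (real (a i) + real (b i)) / 2" by simp
      show "(real (a i) - real (b i)) ^ 2 = 2 * real (a i) ^ 2 + 2 * real (b i) ^ 2 - 4 * real (c i) ^ 2"
        unfolding c by (simp add: power2_eq_square field_simps)
    qed simp
    also have "\<dots> = 0"
      using q[OF abc(1)] q[OF abc(2)] q[OF abc(3)]
      by (simp add: sum.distrib sum_subtractf sum_distrib_left[symmetric])
    finally have "\<forall>i\<in>{..<k}. (real (a i) - real (b i)) ^ 2 = 0"
      by (subst (asm) sum_nonneg_eq_0_iff) auto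
    then have eq: "a i = b i" if "i < k" for i using that by auto
    then have eq': "b i = c i" if "i < k" for i using that abc(4) by force
    have "a \<in> D" "b \<in> D" "c \<in> D" using abc by (auto simp: F_def)
    moreover have "x = y" if "x \<in> D" "y \<in> D" "\<And>i. i < k \<Longrightarrow> x i = y i" for x y
      using that unfolding D_def by (auto intro: PiE_ext)
    ultimately show ?thesis using eq eq' by blast
  qed
  moreover have "F r \<subseteq> D" by (auto simp: F_def)
  ultimately show ?thesis unfolding D_def[symmetric] by blast
qed

text \<open>The three vertex classes are the residues modulo 3, and the last hypothesis says that every
  triangle of the union comes from a single triple.\<close>

lemma triple_system_graph:
  fixes T :: "(nat \<times> nat \<times> nat) set"
  assumes T: "\<And>x y z. (x,y,z) \<in> T \<Longrightarrow> x < n \<and> y < n \<and> z < n \<and> x mod 3 = 0 \<and> y mod 3 = 1 \<and> z mod 3 = 2"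
    and star: "\<And>x y z x' y' z'. (x,y,z') \<in> T \<Longrightarrow> (x,y',z) \<in> T \<Longrightarrow> (x',y,z) \<in> T \<Longrightarrow> x' = x \<and> y' = y \<and> z' = z"
  shows "\<exists>G :: nat graph. simple_graph G \<and> card (verts G) = n \<and>
     (\<forall>a b c d. adj G a b \<and> adj G a c \<and> adj G b c \<and> adj G a d \<and> adj G b d \<longrightarrow> c = d) \<and>
     card T \<le> card (copies (complete_graph 3) G)"
proof -
  define G where "G = ({..<n}, \<Union>(x,y,z)\<in>T. {{x,y}, {x,z}, {y,z}})"
  define XY where "XY x y \<longleftrightarrow> (\<exists>z. (x,y,z) \<in> T)" for x y
  define XZ where "XZ x z \<longleftrightarrow> (\<exists>y. (x,y,z) \<in> T)" for x z
  define YZ where "YZ y z \<longleftrightarrow> (\<exists>x. (x,y,z) \<in> T)" for y z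
  have tri: "(x,y,z) \<in> T" if "XY x y" "XZ x z" "YZ y z" for x y z
    using that star unfolding XY_def XZ_def YZ_def by metis
  \<comment> \<open>Two of the three triples in \<open>star\<close> are taken equal: any two
    coordinates of a triple determine the third.\<close>
  have uz: "z = z'" if "(x,y,z) \<in> T" "(x,y,z') \<in> T" for x y z z' using star[OF that(2,1,1)] by simp
  have uy: "y = y'" if "(x,y,z) \<in> T" "(x,y',z) \<in> T" for x y y' z using star[OF that(1,2,1)] by simp
  have ux: "x = x'" if "(x,y,z) \<in> T" "(x',y,z) \<in> T" for x x' y z using star[OF that(1,1,2)] by simp
  have adj: "adj G p q \<Longrightarrow> XY p q \<or> XY q p \<or> XZ p q \<or> XZ q p \<or> YZ p q \<or> YZ q p" for p q
    unfolding adj_def G_def XY_def XZ_def YZ_def by (auto simp: doubleton_eq_iff)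
  have res: "XY x y \<Longrightarrow> x mod 3 = 0 \<and> y mod 3 = 1" "XZ x y \<Longrightarrow> x mod 3 = 0 \<and> y mod 3 = 2"
    "YZ x y \<Longrightarrow> x mod 3 = 1 \<and> y mod 3 = 2" for x y
    using T unfolding XY_def XZ_def YZ_def by blast+
  have A0: "q mod 3 = 1 \<and> XY p q \<or> q mod 3 = 2 \<and> XZ p q" if "adj G p q" "p mod 3 = 0" for p q
    using adj[OF that(1)] that(2) res[of p q] res[of q p] by (elim disjE) simp_all
  have A1: "q mod 3 = 0 \<and> XY q p \<or> q mod 3 = 2 \<and> YZ p q" if "adj G p q" "p mod 3 = 1" for p q
    using adj[OF that(1)] that(2) res[of p q] res[of q p] by (elim disjE) simp_all
  have A2: "q mod 3 = 0 \<and> XZ q p \<or> q mod 3 = 1 \<and> YZ q p" if "adj G p q" "p mod 3 = 2" for p q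
    using adj[OF that(1)] that(2) res[of p q] res[of q p] by (elim disjE) simp_all
  have T_of: "(x,y,z) \<in> T" if "adj G x y" "adj G x z" "adj G y z" "x mod 3 = 0" "y mod 3 = 1" "z mod 3 = 2" for x y z
    using A0[OF that(1,4)] A0[OF that(2,4)] A1[OF that(3,5)] that tri by auto
  have uniq: "c = d" if "adj G a b" "adj G a c" "adj G b c" "adj G a d" "adj G b d" for a b c d
  proof -
    note s = that that[THEN adj_sym]
    have ne3: "p mod 3 \<noteq> q mod 3" if "adj G p q" for p q
      using adj[OF that] res[of p q] res[of q p] by (elim disjE) simp_all
    have m: "b mod 3 \<noteq> a mod 3" "c mod 3 \<noteq> a mod 3" "c mod 3 \<noteq> b mod 3" "d mod 3 \<noteq> a mod 3" "d mod 3 \<noteq> b mod 3"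
      using that[THEN ne3] by (auto simp: eq_commute)
    have r3: "x mod 3 = 0 \<or> x mod 3 = 1 \<or> x mod 3 = 2" for x :: nat by linarith
    have "(a mod 3 = 0 \<and> b mod 3 = 1 \<and> c mod 3 = 2 \<and> d mod 3 = 2) \<or> (a mod 3 = 1 \<and> b mod 3 = 0 \<and> c mod 3 = 2 \<and> d mod 3 = 2)
      \<or> (a mod 3 = 0 \<and> b mod 3 = 2 \<and> c mod 3 = 1 \<and> d mod 3 = 1) \<or> (a mod 3 = 2 \<and> b mod 3 = 0 \<and> c mod 3 = 1 \<and> d mod 3 = 1)
      \<or> (a mod 3 = 1 \<and> b mod 3 = 2 \<and> c mod 3 = 0 \<and> d mod 3 = 0) \<or> (a mod 3 = 2 \<and> b mod 3 = 1 \<and> c mod 3 = 0 \<and> d mod 3 = 0)"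
      using r3[of a] r3[of b] r3[of c] r3[of d] m by (elim disjE) simp_all
    then show "c = d"
    proof (elim disjE conjE, goal_cases)
      case 1
      then show ?case using uz[of a b c d] T_of[of a b c] T_of[of a b d] s by simp
    next
      case 2
      then show ?case using uz[of b a c d] T_of[of b a c] T_of[of b a d] s by simp
    next
      case 3
      then show ?case using uy[of a c b d] T_of[of a c b] T_of[of a d b] s by simp
    next
      case 4
      then show ?case using uy[of b c a d] T_of[of b c a] T_of[of b d a] s by simp
    next
      case 5
      then show ?case using ux[of c a b d] T_of[of c a b] T_of[of d a b] s by simp
    next
      case 6
      then show ?case using ux[of c b a d] T_of[of c b a] T_of[of d b a] s by simp
    qed
  qed
  have ne: "x \<noteq> y \<and> x \<noteq> z \<and> y \<noteq> z" if "(x,y,z) \<in> T" for x y z using T[OF that] by auto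
  have G: "simple_graph G"
    unfolding simple_graph_def G_def using T ne by (fastforce simp: card_2_iff)
  have "card T \<le> card (copies (complete_graph 3) G)"
  proof (rule card_copies_triangle_ge[OF G])
    interpret fin_graph "verts G" "adj G" by (rule fin_graph_adj[OF G])
    have "adj G x y \<and> adj G x z \<and> adj G y z" if "(x,y,z) \<in> T" for x y z
      unfolding adj_def G_def snd_conv using that by blast
    then show "T \<subseteq> triangles" by (auto simp: triangles_def)
    show "inj_on (\<lambda>(a,b,c). triangle_graph a b c) T"
    proof (rule inj_onI)
      fix t t' assume t: "t \<in> T" "t' \<in> T" and eq: "(\<lambda>(a,b,c). triangle_graph a b c) t = (\<lambda>(a,b,c). triangle_graph a b c) t'"
      obtain x y z where txyz: "t = (x,y,z)" by (cases t)
      obtain x' y' z' where t': "t' = (x',y',z')" by (cases t')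
      have "{x,y,z} = {x',y',z'}" using eq by (simp add: txyz t' triangle_graph_def)
      then have "x \<in> {x',y',z'}" "y \<in> {x',y',z'}" "z \<in> {x',y',z'}" by blast+
      then show "t = t'" using T[of x y z] T[of x' y' z'] t by (auto simp: txyz t')
    qed
  qed
  moreover have "card (verts G) = n" by (simp add: G_def)
  ultimately show ?thesis using G uniq by blast
qed

text \<open>The Ruzsa-Szemeredi construction on triples \<open>(x, x + a, x + 2 * a)\<close> with
  \<open>a\<close> from a progression-free set, done coordinatewise with vectors so that no carries
  arise. Coordinates stay below \<open>3 * d\<close>, hence classes of size
  \<open>(3 * d) ^ k\<close>; \<open>h\<close> numbers the vectors, and residues modulo 3 keep the
  classes apart.\<close>

lemma edge_disjoint_triangles_graph:
  assumes k: "k \<ge> 1" and d: "d \<ge> (1::nat)" and n: "3 * (3 * d) ^ k \<le> n"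
  shows "\<exists>G :: nat graph. simple_graph G \<and> card (verts G) = n \<and>
     (\<forall>a b c d. adj G a b \<and> adj G a c \<and> adj G b c \<and> adj G a d \<and> adj G b d \<longrightarrow> c = d) \<and>
     d ^ k * d ^ k \<le> card (copies (complete_graph 3) G) * (k * d ^ 2)"
proof -
  define D where "D = PiE {..<k} (\<lambda>_. {..<d})"
  define B where "B = PiE {..<k} (\<lambda>_. {..<3 * d})"
  have finB: "finite B" unfolding B_def by (rule finite_PiE) auto
  have cB: "card B = (3 * d) ^ k" unfolding B_def by (subst card_PiE) auto
  have cD: "card D = d ^ k" unfolding D_def by (subst card_PiE) auto
  have finD: "finite D" unfolding D_def by (rule finite_PiE) auto
  obtain h where h: "bij_betw h B {..<(3 * d) ^ k}"
    using ex_bij_betw_finite_nat[OF finB] by (auto simp: cB atLeast0LessThan)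
  have h_inj: "x = y" if "h x = h y" "x \<in> B" "y \<in> B" for x y using h that by (auto simp: bij_betw_def inj_on_def)
  have h_less: "3 * h x + 2 < n" if "x \<in> B" for x
  proof -
    have "h x < (3 * d) ^ k" using h that by (auto simp: bij_betw_def)
    then show ?thesis using n by linarith
  qed
  obtain A where A: "A \<subseteq> D" "d ^ k \<le> card A * (k * d ^ 2)"
    and free: "\<And>a b c. a \<in> A \<Longrightarrow> b \<in> A \<Longrightarrow> c \<in> A \<Longrightarrow> \<forall>i<k. a i + b i = 2 * c i \<Longrightarrow> a = b \<and> b = c"
    using progression_free_box_subset[OF k d] unfolding D_def by blast
  define add where "add x a c = (\<lambda>i\<in>{..<k}. x i + c * a i)" for x a :: "nat \<Rightarrow> nat" and c :: nat
  have add_B: "add x a c \<in> B" if "x \<in> D" "a \<in> D" "c \<le> 2" for x a c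
  proof -
    have "x i + c * a i < 3 * d" if "i < k" for i
    proof -
      have "x i < d" "a i < d" using \<open>x \<in> D\<close> \<open>a \<in> D\<close> that by (auto simp: D_def)
      moreover have "c * a i \<le> 2 * a i" using \<open>c \<le> 2\<close> by (rule mult_right_mono) simp
      ultimately show ?thesis by linarith
    qed
    then show ?thesis by (auto simp: B_def add_def)
  qed
  have DB: "x \<in> B" if "x \<in> D" for x
  proof -
    have "x i < 3 * d" if "i < k" for i using \<open>x \<in> D\<close> that by (auto simp: D_def dest!: PiE_mem[of _ _ _ i])
    then show ?thesis using that by (auto simp: B_def D_def PiE_iff)
  qed
  have add_eq: "x i + c * a i = x' i + c * a' i" if "add x a c = add x' a' c" "i < k" for x a x' a' c i
    using fun_cong[OF that(1), of i] that(2) by (simp add: add_def)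
  define trip where "trip = (\<lambda>(x, a). (3 * h x, 3 * h (add x a 1) + 1, 3 * h (add x a 2) + 2))"
  define T where "T = trip ` (D \<times> A)"
  have T_elim: "\<exists>x\<in>D. \<exists>a\<in>A. p = 3 * h x \<and> q = 3 * h (add x a 1) + 1 \<and> r = 3 * h (add x a 2) + 2"
    if "(p,q,r) \<in> T" for p q r
    using that by (auto simp: T_def trip_def)
  have ext: "a = a'" if "a \<in> D" "a' \<in> D" "\<And>i. i < k \<Longrightarrow> a i = a' i" for a a'
    using that unfolding D_def by (auto intro: PiE_ext)
  \<comment> \<open>Three edges that close up to a triangle: comparing the two equations between
    vectors gives \<open>a + a'' = 2 * a'\<close>, a progression in \<open>A\<close>, so all three
    differences agree.\<close>
  have key: "x' = x \<and> a' = a \<and> a'' = a"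
    if D: "x \<in> D" "x' \<in> D" "a \<in> A" "a' \<in> A" "a'' \<in> A"
      and y: "h (add x a 1) = h (add x' a'' 1)" and z: "h (add x a' 2) = h (add x' a'' 2)" for x x' a a' a''
  proof -
    have AD: "a \<in> D" "a' \<in> D" "a'' \<in> D" using D A by auto
    have y': "x i + a i = x' i + a'' i" if "i < k" for i
      using add_eq[OF h_inj[OF y add_B add_B] that] D AD by simp
    have z': "x i + 2 * a' i = x' i + 2 * a'' i" if "i < k" for i
      using add_eq[OF h_inj[OF z add_B add_B] that] D AD by simp
    have "a i + a'' i = 2 * a' i" if "i < k" for i using y'[OF that] z'[OF that] by linarith
    then have "a = a'' \<and> a'' = a'" using free D by blast
    moreover have "x i = x' i" if "i < k" for i using y'[OF that] calculation by simp
    ultimately show ?thesis using ext D by metis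
  qed
  have "\<exists>G :: nat graph. simple_graph G \<and> card (verts G) = n \<and>
     (\<forall>a b c d. adj G a b \<and> adj G a c \<and> adj G b c \<and> adj G a d \<and> adj G b d \<longrightarrow> c = d) \<and>
     card T \<le> card (copies (complete_graph 3) G)"
  proof (rule triple_system_graph)
    fix p q r assume "(p,q,r) \<in> T"
    then obtain x a where xa: "x \<in> D" "a \<in> A" "p = 3 * h x" "q = 3 * h (add x a 1) + 1" "r = 3 * h (add x a 2) + 2"
      using T_elim by blast
    have "a \<in> D" using xa A by auto
    then show "p < n \<and> q < n \<and> r < n \<and> p mod 3 = 0 \<and> q mod 3 = 1 \<and> r mod 3 = 2"
      using h_less[OF DB[OF xa(1)]] h_less[OF add_B[OF xa(1), of a 1]] h_less[OF add_B[OF xa(1), of a 2]] xa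
      by (auto simp: mod_Suc)
  next
    fix p q r p' q' r' assume t: "(p,q,r') \<in> T" "(p,q',r) \<in> T" "(p',q,r) \<in> T"
    obtain x a where 1: "x \<in> D" "a \<in> A" "p = 3 * h x" "q = 3 * h (add x a 1) + 1" "r' = 3 * h (add x a 2) + 2"
      using T_elim[OF t(1)] by blast
    obtain x1 a' where 2: "x1 \<in> D" "a' \<in> A" "p = 3 * h x1" "q' = 3 * h (add x1 a' 1) + 1" "r = 3 * h (add x1 a' 2) + 2"
      using T_elim[OF t(2)] by blast
    obtain x' a'' where 3: "x' \<in> D" "a'' \<in> A" "p' = 3 * h x'" "q = 3 * h (add x' a'' 1) + 1" "r = 3 * h (add x' a'' 2) + 2"
      using T_elim[OF t(3)] by blast
    have "h x = h x1" using 1 2 by simp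
    then have "x1 = x" using h_inj 1 2 DB by metis
    then have "x' = x \<and> a' = a \<and> a'' = a" using key[of x x' a a' a''] 1 2 3 by simp
    then show "p' = p \<and> q' = q \<and> r' = r" using 1 2 3 \<open>x1 = x\<close> by simp
  qed
  then obtain G :: "nat graph" where G: "simple_graph G" "card (verts G) = n"
    "\<forall>a b c d. adj G a b \<and> adj G a c \<and> adj G b c \<and> adj G a d \<and> adj G b d \<longrightarrow> c = d"
    "card T \<le> card (copies (complete_graph 3) G)" by blast
  have "inj_on trip (D \<times> A)"
  proof (rule inj_onI)
    fix u v assume uv: "u \<in> D \<times> A" "v \<in> D \<times> A" "trip u = trip v"
    obtain x a where u: "u = (x, a)" by (cases u)
    obtain x' a' where v: "v = (x', a')" by (cases v)
    show "u = v" using key[of x x' a a a'] uv by (auto simp: u v trip_def)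
  qed
  then have "card T = d ^ k * card A" unfolding T_def by (simp add: card_image card_cartesian_product cD)
  then have "d ^ k * d ^ k \<le> card T * (k * d ^ 2)" using mult_left_mono[OF A(2), of "d ^ k"] by (simp add: mult.assoc)
  also have "\<dots> \<le> card (copies (complete_graph 3) G) * (k * d ^ 2)" using G(4) by (rule mult_right_mono) simp
  finally show ?thesis using G by blast
qed

text \<open>Two triangles of a theta graph share the edge between its ends, whereas in
  \<open>G\<close> an edge lies in at most one triangle.\<close>

lemma no_theta_in_edge_disjoint_triangles:
  assumes uniq: "\<And>a b c d. adj G a b \<Longrightarrow> adj G a c \<Longrightarrow> adj G b c \<Longrightarrow> adj G a d \<Longrightarrow> adj G b d \<Longrightarrow> c = d"
    and two: "2 \<le> card (copies (complete_graph 3) (theta_graph ps))"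
  shows "\<not> contains G (theta_graph ps)"
proof
  let ?H = "theta_graph ps"
  assume "contains G ?H"
  then obtain f where f: "inj_on f (verts ?H)" "\<forall>e\<in>edges ?H. f ` e \<in> edges G"
    using contains_embedding[OF _ simple_graph_theta_graph] by blast
  obtain i i' where one: "1 \<in> set ps" and i: "i < length ps" "i' < length ps" "i \<noteq> i'" "ps ! i = 2" "ps ! i' = 2"
    using theta_two_triangles[OF two] by blast
  interpret H: fin_graph "verts ?H" "adj ?H" by (rule fin_graph_adj[OF simple_graph_theta_graph])
  note H = adj_theta_one[OF one] adj_theta_two[OF i(1,4)] adj_theta_two[OF i(2,5)]
  have "f (Inner i 1) = f (Inner i' 1)"
    by (rule uniq) (rule embedding_adj[OF f(2)], rule H)+
  moreover have "Inner i 1 \<in> verts ?H" "Inner i' 1 \<in> verts ?H" using H H.E_V2 by blast+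
  ultimately have "Inner i 1 = Inner i' 1" using f(1) by (meson inj_onD)
  then show False using i by simp
qed

text \<open>The dimension \<open>k\<close> is fixed while \<open>d\<close> grows with
  \<open>n\<close>. With \<open>y\<close> the \<open>k\<close>-th root of \<open>n\<close>, two lost
  factors \<open>y\<close> come from the \<open>d ^ 2\<close> in the number of squared radii and a
  third absorbs the constant \<open>M\<close>; together they make up the exponent
  \<open>3 / k\<close>.\<close>

lemma gen_turan_almost_quadratic_lower:
  assumes two: "2 \<le> card (copies (complete_graph 3) (theta_graph ps))" and k: "k \<ge> 1"
  shows "\<forall>\<^sub>F n in sequentially.
     real n powr (2 - 3 / real k) \<le> real (gen_turan n (complete_graph 3) (theta_graph ps))"
proof (rule eventually_sequentiallyI)
  \<comment> \<open>Collects the dimension and the loss in \<open>d\<close>, which is at least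
    \<open>y / 18\<close>: \<open>z\<close> is at least \<open>y / 3\<close>, and rounding
    \<open>z / 3\<close> down costs at most a factor 2.\<close>
  define M where "M = real k * 18 ^ (2 * k)"
  fix n :: nat assume n: "nat \<lceil>M ^ k\<rceil> + 3 \<le> n"
  define y where "y = real n powr (1 / real k)"
  have n1: "real n \<ge> M ^ k" "n \<ge> 3" using n by linarith+
  have M: "M \<ge> 18"
  proof -
    have "(18::real) ^ 1 \<le> 18 ^ (2 * k)" using k by (intro power_increasing) auto
    then have "1 * 18 \<le> real k * 18 ^ (2 * k)" using k by (intro mult_mono) auto
    then show ?thesis by (simp add: M_def)
  qed
  have "M = (M ^ k) powr (1 / real k)" using M k by (simp add: powr_realpow[symmetric] powr_powr)
  also have "\<dots> \<le> y" unfolding y_def using n1 M by (intro powr_mono2) auto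
  finally have yM: "M \<le> y" .
  then have y18: "18 \<le> y" using M by simp
  have yk: "y ^ k = real n"
    using n1 k y18 unfolding y_def by (simp add: powr_realpow[symmetric] powr_powr)
  define z where "z = (real n / 3) powr (1 / real k)"
  have zk: "z ^ k = real n / 3"
  proof -
    have "z > 0" using n1 by (simp add: z_def)
    then show ?thesis using n1 k unfolding z_def by (simp add: powr_realpow[symmetric] powr_powr)
  qed
  have z_ge: "y / 3 \<le> z"
  proof (rule ccontr)
    assume "\<not> y / 3 \<le> z"
    then have "z ^ k < (y / 3) ^ k" using k by (intro power_strict_mono) (auto simp: z_def)
    also have "\<dots> = real n / 3 ^ k" by (simp add: power_divide yk)
    also have "\<dots> \<le> real n / 3"
      using k self_le_power[of "3::real" k] by (intro divide_left_mono) auto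
    finally show False using zk by simp
  qed
  \<comment> \<open>The largest \<open>d\<close> with
    \<open>3 * (3 * d) ^ k \<le> n\<close>.\<close>
  define d where "d = nat \<lfloor>z / 3\<rfloor>"
  have z0: "z \<ge> 0" by (simp add: z_def)
  have d_le: "3 * real d \<le> z" unfolding d_def using z0 by linarith
  have d_ge: "y / 18 \<le> real d"
  proof -
    have "z / 3 - 1 \<le> real d" unfolding d_def by linarith
    then show ?thesis using z_ge y18 by linarith
  qed
  then have d1: "d \<ge> 1" using y18 by linarith
  have "real (3 * (3 * d) ^ k) = 3 * (3 * real d) ^ k" by simp
  also have "\<dots> \<le> 3 * z ^ k" using d_le by (intro mult_left_mono power_mono) auto
  also have "\<dots> = real n" by (simp add: zk)
  finally have dn: "3 * (3 * d) ^ k \<le> n" by (simp only: of_nat_le_iff)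
  obtain G :: "nat graph" where G: "simple_graph G" "card (verts G) = n"
    "\<forall>a b c d. adj G a b \<and> adj G a c \<and> adj G b c \<and> adj G a d \<and> adj G b d \<longrightarrow> c = d"
    "d ^ k * d ^ k \<le> card (copies (complete_graph 3) G) * (k * d ^ 2)"
    using edge_disjoint_triangles_graph[OF k d1 dn] by blast
  have "\<not> contains G (theta_graph ps)"
    by (rule no_theta_in_edge_disjoint_triangles[OF _ two]) (use G(3) in blast)
  then have ge: "card (copies (complete_graph 3) G) \<le> gen_turan n (complete_graph 3) (theta_graph ps)"
    by (rule gen_turan_ge[OF G(1,2)])
  define C where "C = real (gen_turan n (complete_graph 3) (theta_graph ps))"
  have "real (d ^ k * d ^ k) \<le> real (card (copies (complete_graph 3) G) * (k * d ^ 2))"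
    using G(4) by (rule of_nat_mono)
  also have "\<dots> = real (card (copies (complete_graph 3) G)) * (real k * real d ^ 2)" by simp
  also have "\<dots> \<le> C * (real k * real d ^ 2)"
    unfolding C_def using ge by (intro mult_right_mono) auto
  also have "\<dots> \<le> C * (real k * y ^ 2)"
  proof -
    have "z \<le> y" unfolding z_def y_def by (intro powr_mono2) auto
    then have "real d \<le> y" using d_le by linarith
    then have "real d ^ 2 \<le> y ^ 2" by (intro power_mono) auto
    then show ?thesis by (intro mult_left_mono) (auto simp: C_def)
  qed
  finally have 1: "real d ^ k * real d ^ k \<le> C * (real k * y ^ 2)" by simp
  have "real n ^ 2 / 18 ^ (2 * k) = (y / 18) ^ k * (y / 18) ^ k"
    by (simp add: power_divide yk power2_eq_square power_mult[symmetric] mult_2 power_add)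
  also have "\<dots> \<le> real d ^ k * real d ^ k"
    using d_ge y18 by (intro mult_mono power_mono) auto
  finally have "real n ^ 2 / 18 ^ (2 * k) \<le> C * (real k * y ^ 2)" using 1 by linarith
  then have "real n ^ 2 \<le> C * (M * y ^ 2)" by (simp add: M_def field_simps)
  also have "\<dots> \<le> C * (y * y ^ 2)" using yM by (intro mult_left_mono mult_right_mono) (auto simp: C_def)
  finally have 2: "real n ^ 2 \<le> C * y ^ 3" by (simp add: power3_eq_cube power2_eq_square)
  have y3: "y ^ 3 = real n powr (3 / real k)"
  proof -
    have "y ^ 3 = y powr 3" using y18 by (simp add: powr_numeral)
    also have "\<dots> = real n powr (3 / real k)" by (simp add: y_def powr_powr)
    finally show ?thesis .
  qed
  have "real n powr (2 - 3 / real k) = real n ^ 2 / y ^ 3"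
    using n1 by (simp add: powr_diff y3)
  also have "\<dots> \<le> C" using 2 y18 by (simp add: pos_divide_le_eq)
  finally show "real n powr (2 - 3 / real k) \<le> real (gen_turan n (complete_graph 3) (theta_graph ps))"
    by (simp add: C_def)
qed

text \<open>The exponent is read off from \<open>g\<close> itself, as the gap between 2 and the
  logarithm of \<open>g n\<close> to base \<open>n\<close>; each \<open>k\<close> shows that it is
  eventually at most \<open>3 / k\<close>. Truncation at 0 keeps \<open>\<epsilon>\<close>
  nonnegative and only lowers the bound.\<close>

lemma almost_quadratic_exponent:
  fixes g :: "nat \<Rightarrow> real"
  assumes g: "\<And>k::nat. k \<ge> 1 \<Longrightarrow> \<forall>\<^sub>F n in sequentially. real n powr (2 - 3 / real k) \<le> g n"
  shows "\<exists>\<epsilon>::nat \<Rightarrow> real. \<epsilon> \<in> o(\<lambda>_. 1) \<and> (\<forall>\<^sub>F n in sequentially. real n powr (2 - \<epsilon> n) \<le> g n)"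
proof (intro exI conjI)
  define \<epsilon> where "\<epsilon> n = max 0 (2 - ln (g n) / ln (real n))" for n
  have "\<epsilon> \<longlonglongrightarrow> 0"
  proof (rule order_tendstoI)
    fix a :: real assume "a < 0"
    then show "\<forall>\<^sub>F n in sequentially. a < \<epsilon> n" by (auto simp: \<epsilon>_def less_max_iff_disj)
  next
    fix a :: real assume a: "0 < a"
    define k where "k = nat \<lceil>3 / a\<rceil> + 1"
    have k: "k \<ge> 1" "3 / a < real k" unfolding k_def by linarith+
    have ka: "3 / real k < a" using k a by (simp add: field_simps)
    show "\<forall>\<^sub>F n in sequentially. \<epsilon> n < a"
      using g[OF k(1)] eventually_ge_at_top[of 2]
    proof eventually_elim
      case (elim n)
      have pos: "0 < real n powr (2 - 3 / real k)" using elim by simp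
      then have gpos: "0 < g n" using elim(1) by (rule less_le_trans)
      have "ln (real n powr (2 - 3 / real k)) \<le> ln (g n)"
        using ln_le_cancel_iff[OF pos gpos] elim(1) by blast
      then have "(2 - 3 / real k) * ln (real n) \<le> ln (g n)" using elim by (simp add: ln_powr)
      moreover have "ln (real n) > 0" using elim by simp
      ultimately have "2 - 3 / real k \<le> ln (g n) / ln (real n)" by (simp add: pos_le_divide_eq)
      then show ?case using ka a by (auto simp: \<epsilon>_def)
    qed
  qed
  then show "\<epsilon> \<in> o(\<lambda>_. 1)" by (intro smalloI_tendsto) auto
  show "\<forall>\<^sub>F n in sequentially. real n powr (2 - \<epsilon> n) \<le> g n"
    using g[of 1, OF order_refl] eventually_ge_at_top[of 2]
  proof eventually_elim
    case (elim n)
    have n: "real n > 1" using elim by simp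
    have "0 < real n powr (2 - 3 / real 1)" using n by simp
    then have g0: "0 < g n" using elim(1) by (rule less_le_trans)
    have "real n powr (2 - \<epsilon> n) \<le> real n powr (ln (g n) / ln (real n))"
      using n by (intro powr_mono) (auto simp: \<epsilon>_def)
    also have "\<dots> = g n" using n g0 by (simp add: powr_def)
    finally show ?case .
  qed
qed

section \<open>Assembling the three cases\<close>

lemma gen_turan_theta_le_triangles:
  assumes "theta_lengths ps"
  obtains G :: "nat graph" where "fin_graph (verts G) (adj G)" "card (verts G) = n" "\<not> has_theta (adj G) ps"
    "gen_turan n (complete_graph 3) (theta_graph ps) \<le> card (fin_graph.triangles (adj G))"
proof -
  obtain G :: "nat graph" where G: "simple_graph G" "card (verts G) = n" "\<not> contains G (theta_graph ps)"
    "gen_turan n (complete_graph 3) (theta_graph ps) = card (copies (complete_graph 3) G)"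
    using gen_turan_attained[OF theta_graph_edges_nonempty[OF assms]] by blast
  then show ?thesis
    using that[of G] fin_graph_adj contains_theta_if_has_theta[OF theta_lengths_ge_1[OF assms]] card_copies_triangle_le
    by metis
qed

theorem theorem1p1:
  fixes ps :: "nat list" and H :: "tvertex graph"
  assumes "theta_lengths ps"
    and "H = theta_graph ps"
  shows
    "(card (copies (complete_graph 3) H) \<le> 1 \<longrightarrow>
        (\<exists>\<alpha>::real. \<alpha> > 0 \<and>
           (\<lambda>n::nat. real (gen_turan n (complete_graph 3) H)) \<in> O(\<lambda>n. real n powr (2 - \<alpha>))))
     \<and> (card (copies (complete_graph 3) H) \<ge> 2 \<and> \<not> contains H (theta_graph [1, 2, 2, 3]) \<longrightarrow>
        (\<exists>\<epsilon>::nat \<Rightarrow> real. \<epsilon> \<in> o(\<lambda>_. 1) \<and>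
           (\<forall>\<^sub>F n in sequentially.
              real n powr (2 - \<epsilon> n) \<le> real (gen_turan n (complete_graph 3) H)))
        \<and> (\<lambda>n::nat. real (gen_turan n (complete_graph 3) H)) \<in> o(\<lambda>n. real n ^ 2))
     \<and> (contains H (theta_graph [1, 2, 2, 3]) \<longrightarrow>
        (\<lambda>n::nat. real (gen_turan n (complete_graph 3) H)) \<in> \<Theta>(\<lambda>n. real n ^ 2))"
proof (intro conjI impI)
  let ?g = "\<lambda>n::nat. real (gen_turan n (complete_graph 3) H)"
  note ge1 = theta_lengths_ge_1[OF assms(1)]
  {
    assume "card (copies (complete_graph 3) H) \<le> 1"
    then have "1 \<notin> set ps \<or> count_list ps 2 \<le> 1" using theta_at_most_one_triangle assms(2) by simp
    from theta_free_triangles_subquadratic[OF ge1 this, where 'a = nat]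
    obtain s :: nat where s: "s \<ge> 1" "\<And>(V::nat set) E. fin_graph V E \<and> \<not> has_theta E ps \<Longrightarrow>
      real (card (fin_graph.triangles E)) \<le>
       4 * real (sum_list ps) * (2 * real s ^ 2 * real (card V) powr (2 - 1 / real s))" by blast
    have le: "?g n \<le> (4 * real (sum_list ps) * (2 * real s ^ 2)) * real n powr (2 - 1 / real s)" for n
    proof -
      obtain G :: "nat graph" where G: "fin_graph (verts G) (adj G)" "card (verts G) = n" "\<not> has_theta (adj G) ps"
        "gen_turan n (complete_graph 3) H \<le> card (fin_graph.triangles (adj G))"
        using gen_turan_theta_le_triangles[OF assms(1)] assms(2) by metis
      have "?g n \<le> real (card (fin_graph.triangles (adj G)))" using G(4) by simp
      also have "\<dots> \<le> 4 * real (sum_list ps) * (2 * real s ^ 2 * real n powr (2 - 1 / real s))"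
        using s(2)[of "verts G" "adj G"] G by simp
      finally show ?thesis by (simp add: mult.assoc)
    qed
    have "?g \<in> O(\<lambda>n. real n powr (2 - 1 / real s))"
      by (rule bigoI[where c = "4 * real (sum_list ps) * (2 * real s ^ 2)"]) (use le in auto)
    then show "\<exists>\<alpha>::real. \<alpha> > 0 \<and> ?g \<in> O(\<lambda>n. real n powr (2 - \<alpha>))"
      using s(1) by (intro exI[of _ "1 / real s"]) auto
  next
    assume a: "2 \<le> card (copies (complete_graph 3) H) \<and> \<not> contains H (theta_graph [1, 2, 2, 3])"
    show "\<exists>\<epsilon>::nat \<Rightarrow> real. \<epsilon> \<in> o(\<lambda>_. 1) \<and> (\<forall>\<^sub>F n in sequentially. real n powr (2 - \<epsilon> n) \<le> ?g n)"
      using a gen_turan_almost_quadratic_lower unfolding assms(2) by (intro almost_quadratic_exponent) blast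
    have "3 \<notin> set ps"
      using a theta_two_triangles[of ps] theta_contains_1223[of ps] assms(2) by metis
    then have ps: "1 \<le> p \<and> p \<noteq> 3" if "p \<in> set ps" for p using ge1[OF that] that by metis
    show "?g \<in> o(\<lambda>n. real n ^ 2)"
    proof (rule landau_o.smallI)
      fix c :: real assume "c > 0"
      from theta_free_triangles_little_o[OF this ps, where 'a = nat]
      obtain n0 where n0: "\<And>(V::nat set) E. fin_graph V E \<and> n0 \<le> card V \<and> \<not> has_theta E ps \<Longrightarrow>
        real (card (fin_graph.triangles E)) \<le> c * real (card V) ^ 2" by blast
      show "\<forall>\<^sub>F n in sequentially. norm (?g n) \<le> c * norm (real n ^ 2)"
      proof (rule eventually_sequentiallyI)
        fix n assume n: "n0 \<le> n"
        obtain G :: "nat graph" where G: "fin_graph (verts G) (adj G)" "card (verts G) = n" "\<not> has_theta (adj G) ps"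
          "gen_turan n (complete_graph 3) H \<le> card (fin_graph.triangles (adj G))"
          using gen_turan_theta_le_triangles[OF assms(1)] assms(2) by metis
        have "?g n \<le> real (card (fin_graph.triangles (adj G)))" using G(4) by simp
        also have "\<dots> \<le> c * real n ^ 2" using n0[of "verts G" "adj G"] G n by simp
        finally show "norm (?g n) \<le> c * norm (real n ^ 2)" by simp
      qed
    qed
  next
    assume c: "contains H (theta_graph [1, 2, 2, 3])"
    have le: "?g n \<le> 4 * real (sum_list ps) * real n ^ 2" for n
    proof -
      obtain G :: "nat graph" where G: "fin_graph (verts G) (adj G)" "card (verts G) = n" "\<not> has_theta (adj G) ps"
        "gen_turan n (complete_graph 3) H \<le> card (fin_graph.triangles (adj G))"
        using gen_turan_theta_le_triangles[OF assms(1)] assms(2) by metis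
      interpret fin_graph "verts G" "adj G" by (rule G(1))
      have "gen_turan n (complete_graph 3) H \<le> 4 * sum_list ps * n ^ 2"
        using theta_free_triangles_quadratic[OF G(3) ge1] G(2,4) by simp
      from of_nat_mono[OF this, where 'a = real] show ?thesis by simp
    qed
    show "?g \<in> \<Theta>(\<lambda>n. real n ^ 2)"
    proof (rule bigthetaI)
      show "?g \<in> O(\<lambda>n. real n ^ 2)"
        by (rule bigoI[where c = "4 * real (sum_list ps)"]) (use le in auto)
      have "real n ^ 2 / 16 \<le> ?g n" if "8 \<le> n" for n
        using gen_turan_quadratic_lower[OF c _ that] simple_graph_theta_graph assms(2) by simp
      then show "?g \<in> \<Omega>(\<lambda>n. real n ^ 2)"
        by (intro landau_omega.bigI[of "1 / 16"] eventually_sequentiallyI[of 8]) auto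
    qed
  }
qed

end
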